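(* Let $M$ be a countable transitive model of $\mathsf{ZFC}$. Then $\equiv^\mathbb{B}_M$ is not treeable.
   Context: $\mathbb{B}$ is the partial order, computed in $M$, of all Borel subsets of $2^\omega$ of positive measure, ordered by inclusion; $\mathcal{R}$ is the set of $x\in2^\omega$ such that $\{B^M\in\mathbb{B}:x\in B\}$ is $M$-generic (where $B^M$, $B$ are the interpretations in $M$, $\mathbf{V}$ of a Borel code in $M$), and $x\equiv^\mathbb{B}_M y$ iff $M[x]=M[y]$ for $x,y\in\mathcal{R}$. A countable Borel equivalence relation is treeable if there is a Borel acyclic graph on the underlying space whose connected components are exactly its equivalence classes. *)

theory Defs
  imports "HOL-Analysis.Analysis" "HOL-Library.Countable_Set_Type"
begin
text \<open>
  Every element of a countable transitive set is hereditarily countable, so a countable transitive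
  set is the same thing as a countable transitive set of elements of the type \<open>hc\<close> below. Equality
  on \<open>hc\<close> is extensional and membership is well-founded, since \<open>hc\<close> is a datatype.
\<close>

datatype hc = HC "hc cset"

primrec elts :: "hc \<Rightarrow> hc set" where
  "elts (HC A) = rcset A"

text \<open>The set with the given members; meaningful only for countable families.\<close>

definition hset :: "hc set \<Rightarrow> hc" where
  "hset A = HC (acset A)"

lemma elts_hset [simp]: "countable A \<Longrightarrow> elts (hset A) = A"
  by (simp add: hset_def)

lemma countable_elts [simp]: "countable (elts x)"
  by (cases x) simp

lemma hset_elts [simp]: "hset (elts x) = x"
  by (cases x) (simp add: hset_def rcset_inverse)

lemma hc_ext: "elts x = elts y \<Longrightarrow> x = y"
  by (metis hset_elts)

definition opair :: "hc \<Rightarrow> hc \<Rightarrow> hc" where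
  "opair a b = hset {hset {a}, hset {a, b}}"

primrec ord_nat :: "nat \<Rightarrow> hc" where
  "ord_nat 0 = hset {}"
| "ord_nat (Suc n) = hset (insert (ord_nat n) (elts (ord_nat n)))"

text \<open>A sequence of sets, as the set of pairs that is its graph.\<close>

definition hseq :: "(nat \<Rightarrow> hc) \<Rightarrow> hc" where
  "hseq f = hset (range (\<lambda>n. opair (ord_nat n) (f n)))"

definition hbit :: "bool \<Rightarrow> hc" where
  "hbit b = ord_nat (of_bool b)"

definition hreal :: "(nat \<Rightarrow> bool) \<Rightarrow> hc" where
  "hreal x = hseq (\<lambda>n. hbit (x n))"

definition hstring :: "bool list \<Rightarrow> hc" where
  "hstring s = hset ((\<lambda>i. opair (ord_nat i) (hbit (s ! i))) ` {..<length s})"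

definition hreals :: "(nat \<Rightarrow> bool) set \<Rightarrow> hc" where
  "hreals Y = hset (hreal ` Y)"

datatype fm = Mem nat nat | Equ nat nat | Neg fm | Conj fm fm | All nat fm

abbreviation Disj :: "fm \<Rightarrow> fm \<Rightarrow> fm" where
  "Disj p q \<equiv> Neg (Conj (Neg p) (Neg q))"

abbreviation Imp :: "fm \<Rightarrow> fm \<Rightarrow> fm" where
  "Imp p q \<equiv> Neg (Conj p (Neg q))"

abbreviation Iff :: "fm \<Rightarrow> fm \<Rightarrow> fm" where
  "Iff p q \<equiv> Conj (Imp p q) (Imp q p)"

abbreviation Exi :: "nat \<Rightarrow> fm \<Rightarrow> fm" where
  "Exi n p \<equiv> Neg (All n (Neg p))"

primrec free_vars :: "fm \<Rightarrow> nat set" where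
  "free_vars (Mem i j) = {i, j}"
| "free_vars (Equ i j) = {i, j}"
| "free_vars (Neg p) = free_vars p"
| "free_vars (Conj p q) = free_vars p \<union> free_vars q"
| "free_vars (All n p) = free_vars p - {n}"

primrec sat :: "hc set \<Rightarrow> (nat \<Rightarrow> hc) \<Rightarrow> fm \<Rightarrow> bool" where
  "sat M e (Mem i j) \<longleftrightarrow> e i \<in> elts (e j)"
| "sat M e (Equ i j) \<longleftrightarrow> e i = e j"
| "sat M e (Neg p) \<longleftrightarrow> \<not> sat M e p"
| "sat M e (Conj p q) \<longleftrightarrow> sat M e p \<and> sat M e q"
| "sat M e (All n p) \<longleftrightarrow> (\<forall>a\<in>M. sat M (e(n := a)) p)"

text \<open>Truth of the universal closure.\<close>

definition models :: "hc set \<Rightarrow> fm \<Rightarrow> bool" (infix "\<Turnstile>" 50) where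
  "M \<Turnstile> p \<longleftrightarrow> (\<forall>e. range e \<subseteq> M \<longrightarrow> sat M e p)"

definition ax_extensionality :: fm where
  "ax_extensionality =
     All 0 (All 1 (Imp (All 2 (Iff (Mem 2 0) (Mem 2 1))) (Equ 0 1)))"

definition ax_foundation :: fm where
  "ax_foundation =
     All 0 (Imp (Exi 1 (Mem 1 0)) (Exi 1 (Conj (Mem 1 0) (Neg (Exi 2 (Conj (Mem 2 1) (Mem 2 0)))))))"

definition ax_pairing :: fm where
  "ax_pairing = All 0 (All 1 (Exi 2 (All 3 (Iff (Mem 3 2) (Disj (Equ 3 0) (Equ 3 1))))))"

definition ax_union :: fm where
  "ax_union = All 0 (Exi 1 (All 2 (Iff (Mem 2 1) (Exi 3 (Conj (Mem 3 0) (Mem 2 3))))))"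

definition ax_powerset :: fm where
  "ax_powerset = All 0 (Exi 1 (All 2 (Iff (Mem 2 1) (All 3 (Imp (Mem 3 2) (Mem 3 0))))))"

definition ax_infinity :: fm where
  "ax_infinity =
     Exi 0 (Conj (Exi 1 (Conj (Mem 1 0) (All 2 (Neg (Mem 2 1)))))
       (All 1 (Imp (Mem 1 0)
         (Exi 2 (Conj (Mem 2 0) (All 3 (Iff (Mem 3 2) (Disj (Mem 3 1) (Equ 3 1)))))))))"

text \<open>Every family of nonempty, pairwise disjoint sets has a transversal.\<close>

definition ax_choice :: fm where
  "ax_choice =
     All 0 (Imp
       (Conj (All 1 (Imp (Mem 1 0) (Exi 2 (Mem 2 1))))
         (All 1 (All 2 (Imp
           (Conj (Conj (Mem 1 0) (Mem 2 0)) (Exi 3 (Conj (Mem 3 1) (Mem 3 2))))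
           (Equ 1 2)))))
       (Exi 4 (All 1 (Imp (Mem 1 0)
         (Exi 5 (All 2 (Iff (Conj (Mem 2 4) (Mem 2 1)) (Equ 2 5))))))))"

text \<open>The element is variable 0, the given set variable 1, the new set variable 2; all further
  variables of \<open>p\<close> are parameters.\<close>

definition ax_separation :: "fm \<Rightarrow> fm" where
  "ax_separation p = All 1 (Exi 2 (All 0 (Iff (Mem 0 2) (Conj (Mem 0 1) p))))"

text \<open>Argument and value are variables 0 and 1, the domain is variable 2, the new set
  variable 3; variable 4 expresses uniqueness of the value.\<close>

definition ax_replacement :: "fm \<Rightarrow> fm" where
  "ax_replacement p =
     All 2 (Imp (All 0 (Imp (Mem 0 2) (Exi 4 (All 1 (Iff p (Equ 1 4))))))
       (Exi 3 (All 0 (Imp (Mem 0 2) (Exi 1 (Conj (Mem 1 3) p))))))"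

definition ZFC :: "fm set" where
  "ZFC = {ax_extensionality, ax_foundation, ax_pairing, ax_union, ax_powerset, ax_infinity,
          ax_choice}
     \<union> {ax_separation p | p. 2 \<notin> free_vars p}
     \<union> {ax_replacement p | p. 3 \<notin> free_vars p \<and> 4 \<notin> free_vars p}"

text \<open>Over the empty set there are no assignments, and \<open>\<Turnstile>\<close> would hold vacuously.\<close>

definition ctm_ZFC :: "hc set \<Rightarrow> bool" where
  "ctm_ZFC M \<longleftrightarrow>
     M \<noteq> {} \<and> countable M \<and> (\<forall>x\<in>M. elts x \<subseteq> M) \<and> (\<forall>p\<in>ZFC. M \<Turnstile> p)"

definition reals_of :: "hc set \<Rightarrow> (nat \<Rightarrow> bool) set" where
  "reals_of M = {x. hreal x \<in> M}"

definition cyl :: "bool list \<Rightarrow> (nat \<Rightarrow> bool) set" where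
  "cyl s = {x. \<forall>i<length s. x i = s ! i}"

text \<open>Relativization to \<open>M\<close> of: \<open>S\<close> is a \<open>\<sigma>\<close>-algebra on Cantor space containing the basic clopen
  sets. Only unions of sequences that are elements of \<open>M\<close> are considered.\<close>

definition sigma_algebra_in :: "hc set \<Rightarrow> hc \<Rightarrow> bool" where
  "sigma_algebra_in M S \<longleftrightarrow>
     S \<in> M \<and> elts S \<subseteq> hreals ` Pow (reals_of M)
     \<and> (\<forall>s. hreals (cyl s \<inter> reals_of M) \<in> elts S)
     \<and> (\<forall>Y \<subseteq> reals_of M. hreals Y \<in> elts S \<longrightarrow> hreals (reals_of M - Y) \<in> elts S)
     \<and> (\<forall>Y :: nat \<Rightarrow> _. (\<forall>n. Y n \<subseteq> reals_of M \<and> hreals (Y n) \<in> elts S)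
          \<and> hseq (\<lambda>n. hreals (Y n)) \<in> M \<longrightarrow> hreals (\<Union>n. Y n) \<in> elts S)"

definition borel_in :: "hc set \<Rightarrow> (nat \<Rightarrow> bool) set \<Rightarrow> bool" where
  "borel_in M Y \<longleftrightarrow>
     Y \<subseteq> reals_of M \<and> hreals Y \<in> M \<and> (\<forall>S. sigma_algebra_in M S \<longrightarrow> hreals Y \<in> elts S)"

text \<open>The value in \<open>M\<close> of the uniform product (``coin-tossing'') measure on Cantor space, as the
  infimum of the total measures of the covers in \<open>M\<close> by basic clopen sets. Taken over all covers,
  it would be zero, as \<open>Y\<close> is countable in the universe.\<close>

definition measure_in :: "hc set \<Rightarrow> (nat \<Rightarrow> bool) set \<Rightarrow> ennreal" where
  "measure_in M Y =
     (INF s \<in> {s :: nat \<Rightarrow> bool list. hseq (\<lambda>n. hstring (s n)) \<in> M \<and> Y \<subseteq> (\<Union>n. cyl (s n))}.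
        \<Sum>n. ennreal ((1 / 2) ^ length (s n)))"

definition random_poset :: "hc set \<Rightarrow> hc set" where
  "random_poset M = {hreals Y | Y. borel_in M Y \<and> measure_in M Y > 0}"

definition incl :: "hc \<Rightarrow> hc \<Rightarrow> bool" where
  "incl b c \<longleftrightarrow> elts b \<subseteq> elts c"

definition dense_in :: "hc set \<Rightarrow> (hc \<Rightarrow> hc \<Rightarrow> bool) \<Rightarrow> hc set \<Rightarrow> bool" where
  "dense_in P le D \<longleftrightarrow> D \<subseteq> P \<and> (\<forall>p\<in>P. \<exists>d\<in>D. le d p)"

definition filter_on :: "hc set \<Rightarrow> (hc \<Rightarrow> hc \<Rightarrow> bool) \<Rightarrow> hc set \<Rightarrow> bool" where
  "filter_on P le G \<longleftrightarrow>
     G \<subseteq> P \<and> G \<noteq> {} \<and> (\<forall>p\<in>G. \<forall>q\<in>P. le p q \<longrightarrow> q \<in> G)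
     \<and> (\<forall>p\<in>G. \<forall>q\<in>G. \<exists>r\<in>G. le r p \<and> le r q)"

definition generic :: "hc set \<Rightarrow> hc set \<Rightarrow> (hc \<Rightarrow> hc \<Rightarrow> bool) \<Rightarrow> hc set \<Rightarrow> bool" where
  "generic M P le G \<longleftrightarrow>
     filter_on P le G \<and> (\<forall>D\<in>M. dense_in P le (elts D) \<longrightarrow> G \<inter> elts D \<noteq> {})"

inductive is_name :: "hc set \<Rightarrow> hc \<Rightarrow> bool" for P where
  "(\<And>z. z \<in> elts t \<Longrightarrow> \<exists>s p. z = opair s p \<and> p \<in> P \<and> is_name P s) \<Longrightarrow> is_name P t"

definition elts_rel :: "hc rel" where
  "elts_rel = {(x, y). x \<in> elts y}"

lemma wf_elts_rel: "wf elts_rel"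
proof (rule wfUNIVI)
  fix P x assume "\<forall>x. (\<forall>y. (y, x) \<in> elts_rel \<longrightarrow> P y) \<longrightarrow> P x"
  then show "P x" by (induction x) (auto simp: elts_rel_def)
qed

lemma fst_opair_elts: "opair s p \<in> elts t \<Longrightarrow> (s, t) \<in> elts_rel\<^sup>+"
proof -
  assume "opair s p \<in> elts t"
  moreover have "hset {s} \<in> elts (opair s p)" "s \<in> elts (hset {s})"
    by (simp_all add: opair_def)
  ultimately show ?thesis
    unfolding elts_rel_def by (blast intro: trancl.intros)
qed

function val :: "hc set \<Rightarrow> hc \<Rightarrow> hc" where
  "val G t = hset (val G ` {s. \<exists>p\<in>G. opair s p \<in> elts t})"
  by auto
termination
  by (relation "inv_image (elts_rel\<^sup>+) snd")
    (auto intro: wf_trancl wf_elts_rel dest: fst_opair_elts)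

declare val.simps [simp del]

definition generic_ext :: "hc set \<Rightarrow> hc set \<Rightarrow> hc set \<Rightarrow> hc set" where
  "generic_ext M P G = {val G t | t. t \<in> M \<and> is_name P t}"

datatype borel_code = Basic "bool list" | Compl borel_code | Union "nat \<Rightarrow> borel_code"

primrec hcode :: "borel_code \<Rightarrow> hc" where
  "hcode (Basic s) = opair (ord_nat 0) (hstring s)"
| "hcode (Compl c) = opair (ord_nat 1) (hcode c)"
| "hcode (Union f) = opair (ord_nat 2) (hseq (\<lambda>n. hcode (f n)))"

text \<open>The interpretation of a code when Cantor space is \<open>X\<close>: for \<open>X = UNIV\<close> this is the
  interpretation in the universe, for \<open>X = reals_of M\<close> the one in \<open>M\<close>.\<close>

primrec interp :: "(nat \<Rightarrow> bool) set \<Rightarrow> borel_code \<Rightarrow> (nat \<Rightarrow> bool) set" where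
  "interp X (Basic s) = cyl s \<inter> X"
| "interp X (Compl c) = X - interp X c"
| "interp X (Union f) = (\<Union>n. interp X (f n))"

definition random_filter :: "hc set \<Rightarrow> (nat \<Rightarrow> bool) \<Rightarrow> hc set" where
  "random_filter M x =
     {hreals (interp (reals_of M) c) | c. hcode c \<in> M \<and> x \<in> interp UNIV c} \<inter> random_poset M"

definition random_reals :: "hc set \<Rightarrow> (nat \<Rightarrow> bool) set" where
  "random_reals M = {x. generic M (random_poset M) incl (random_filter M x)}"

text \<open>For a random real \<open>x\<close>, \<open>M[x]\<close> is the generic extension by the filter that \<open>x\<close> determines.\<close>

definition random_ext :: "hc set \<Rightarrow> (nat \<Rightarrow> bool) \<Rightarrow> hc set" where
  "random_ext M x = generic_ext M (random_poset M) (random_filter M x)"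

definition random_equiv :: "hc set \<Rightarrow> (nat \<Rightarrow> bool) rel" where
  "random_equiv M =
     {(x, y). x \<in> random_reals M \<and> y \<in> random_reals M \<and> random_ext M x = random_ext M y}"

definition acyclic_graph :: "'a rel \<Rightarrow> bool" where
  "acyclic_graph T \<longleftrightarrow>
     \<not> (\<exists>p. length p \<ge> 3 \<and> distinct p \<and>
          (\<forall>i<length p. (p ! i, p ! (Suc i mod length p)) \<in> T))"

text \<open>\<open>X\<close> carries the Borel structure of a subspace of the ambient topological space. That \<open>E\<close> is a
  countable Borel equivalence relation is not made part of the definition, which would only
  weaken the negation.\<close>

definition treeable :: "'a::topological_space set \<Rightarrow> 'a rel \<Rightarrow> bool" where
  "treeable X E \<longleftrightarrow>
     (\<exists>T \<subseteq> X \<times> X. T \<in> sets (restrict_space borel (X \<times> X)) \<and> sym T \<and> irrefl T \<and> acyclic_graph T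
        \<and> (\<forall>x\<in>X. \<forall>y\<in>X. (x, y) \<in> E \<longleftrightarrow> (x, y) \<in> T\<^sup>*))"

end

theory Submission
  imports Defs "HOL-Probability.Probability"
begin

text \<open>
  Let \<open>g\<close> be an involution of Cantor space that permutes the cylinders of each length and whose
  action on finite strings belongs to \<open>M\<close>. Then \<open>M[x] = M[g x]\<close> for almost every \<open>x\<close>, since \<open>g\<close> acts on
  names, and since the measure of a Borel set coded in \<open>M\<close> is the same in \<open>M\<close> and in the universe, as
  witnessed by approximations by open sets with codes in \<open>M\<close>.

  Among these \<open>g\<close> are finitely many, at least three, involutions \<open>\<alpha> c\<close> that generate their free product
  \<open>\<Delta>\<close>, which acts freely almost everywhere, and infinitely many \<open>z n\<close> that commute with \<open>\<Delta>\<close>. Suppose that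
  \<open>T\<close> is a Borel forest whose components are the classes. Give the edges of \<open>T\<close> weights such that balls in the
  weighted distance are finite; then \<open>z n\<close> moves almost every point \<open>x\<close> arbitrarily far as \<open>n\<close> grows.
  By means of a Borel enumeration of the class, each vertex \<open>u\<close> on the path from \<open>x\<close> to \<open>z n x\<close> picks a
  point of the \<open>\<Delta>\<close>-orbit of \<open>x\<close>. Let \<open>F c x\<close> be the fraction of the path whose picked point
  is reached from \<open>x\<close> by a reduced word beginning with \<open>c\<close>. Moving from \<open>x\<close> to \<open>\<alpha> c x\<close> exchanges the words
  beginning with \<open>c\<close> with the others, and the two paths agree except near their ends. So \<open>F c x + F c (\<alpha> c x)\<close> is
  nearly \<open>1\<close> for most \<open>x\<close>, the integral of \<open>F c\<close> is nearly \<open>1/2\<close>, and the sum of the \<open>F c\<close>, which is at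
  most \<open>1\<close>, has integral nearly \<open>3/2\<close> or more.
\<close>

section \<open>Definability over a countable transitive model\<close>

text \<open>\<open>M\<close> satisfies \<open>ZFC\<close> as a set of formulas, so every set claimed
  to lie in \<open>M\<close> needs a defining formula; the closure rules for \<open>dfn\<close> and
  \<open>dtm\<close> read such formulas off from HOL terms. A dense set in \<open>M\<close> may be
  uncountable in \<open>M\<close>, and then the union of its members need not have a code in
  \<open>M\<close>; this is the obstacle to showing that almost every \<open>x\<close> is random.
  Vertices of \<open>T\<close> may have infinite degree, so the plain length of the path to
  \<open>z n x\<close> need not tend to infinity; hence the weights. Commutation gives
  \<open>z n (\<alpha> c x) = \<alpha> c (z n x)\<close>: both ends of the path move by one
  generator, and the cost of this has the same distribution at \<open>x\<close> and at
  \<open>z n x\<close>. Three is the least number of halves with sum above 1; two involutions would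
  generate a dihedral group, which is amenable. There are four here because a letter consists of two
  bits. A product of a nonamenable group and an infinite group is a classical source of
  nontreeability.\<close>

primrec ren :: "(nat \<Rightarrow> nat) \<Rightarrow> fm \<Rightarrow> fm" where
  "ren f (Mem i j) = Mem (f i) (f j)"
| "ren f (Equ i j) = Equ (f i) (f j)"
| "ren f (Neg p) = Neg (ren f p)"
| "ren f (Conj p q) = Conj (ren f p) (ren f q)"
| "ren f (All n p) = All (f n) (ren f p)"

primrec vars :: "fm \<Rightarrow> nat set" where
  "vars (Mem i j) = {i, j}"
| "vars (Equ i j) = {i, j}"
| "vars (Neg p) = vars p"
| "vars (Conj p q) = vars p \<union> vars q"
| "vars (All n p) = insert n (vars p)"

lemma finite_vars [simp]: "finite (vars p)"
  by (induction p) auto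

text \<open>Binders are renamed together with the other variables, so an injective renaming cannot
  capture anything.\<close>

lemma sat_ren: "inj f \<Longrightarrow> sat M e (ren f p) \<longleftrightarrow> sat M (e \<circ> f) p"
proof (induction p arbitrary: e)
  case (All n p)
  have "e(f n := a) \<circ> f = (e \<circ> f)(n := a)" for a
    using All.prems by (auto simp: fun_eq_iff inj_eq)
  then show ?case by (simp only: ren.simps sat.simps All.IH[OF All.prems])
qed auto

lemma sat_cong: "(\<And>i. i \<in> vars p \<Longrightarrow> e i = e' i) \<Longrightarrow> sat M e p \<longleftrightarrow> sat M e' p"
proof (induction p arbitrary: e e')
  case (All n p)
  have "sat M (e(n := a)) p \<longleftrightarrow> sat M (e'(n := a)) p" for a
    by (rule All.IH) (use All.prems in auto)
  then show ?case by simp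
next
  case (Neg p)
  show ?case using Neg.IH[of e e'] Neg.prems by simp
next
  case (Conj p q)
  show ?case using Conj.IH[of e e'] Conj.prems by simp
qed simp_all

lemma free_vars_ren: "free_vars (ren f p) \<subseteq> range f"
  by (induction p) auto

definition join :: "(nat \<Rightarrow> 'a) \<Rightarrow> (nat \<Rightarrow> 'a) \<Rightarrow> nat \<Rightarrow> 'a" where
  "join e a i = (if even i then e (i div 2) else a (i div 2))"

lemma join_simps [simp]:
  "join e a (2 * i) = e i" "join e a (Suc (2 * i)) = a i"
  "join e a 0 = e 0" "join e a (4 * i) = e (2 * i)"
  "join e a (Suc (4 * i)) = a (2 * i)" "join e a (Suc (Suc (Suc (4 * i)))) = a (Suc (2 * i))"
proof -
  show "join e a (4 * i) = e (2 * i)" by (simp add: join_def)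
  have "Suc (4 * i) div 2 = 2 * i" "Suc (Suc (Suc (4 * i))) div 2 = Suc (2 * i)" by presburger+
  then show "join e a (Suc (4 * i)) = a (2 * i)"
    "join e a (Suc (Suc (Suc (4 * i)))) = a (Suc (2 * i))" by (simp_all add: join_def)
qed (simp_all add: join_def)

lemma parity_cases:
  fixes i :: nat
  obtains n where "i = 2 * n" | n where "i = Suc (2 * n)"
  by (metis evenE oddE Suc_eq_plus1)

locale ctm =
  fixes M :: "hc set"
  assumes ctm: "ctm_ZFC M"
begin

lemma M_ne: "M \<noteq> {}" and M_countable: "countable M"
  and trans: "y \<in> elts x \<Longrightarrow> x \<in> M \<Longrightarrow> y \<in> M"
  and ax: "p \<in> ZFC \<Longrightarrow> M \<Turnstile> p"
  using ctm unfolding ctm_ZFC_def by auto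

lemma countable_M [simp]: "A \<subseteq> M \<Longrightarrow> countable A"
  using M_countable countable_subset by blast

lemma countable_sep [simp]: "countable {x \<in> elts A. P x}"
  by (rule countable_subset[of _ "elts A"]) auto

lemma countable_sepM [simp]: "countable {x \<in> M. P x}"
  by (rule countable_subset[of _ M]) (auto simp: M_countable)

text \<open>A predicate on environments (read as de Bruijn stacks) that is expressed over \<open>M\<close> by a
  formula with parameters; the parameters are kept at the odd variables.\<close>

definition dfn :: "((nat \<Rightarrow> hc) \<Rightarrow> bool) \<Rightarrow> bool" where
  "dfn P \<longleftrightarrow> (\<exists>p a. (\<forall>i. a i \<in> M) \<and> (\<forall>e. (\<forall>i. e i \<in> M) \<longrightarrow> (sat M (join e a) p \<longleftrightarrow> P e)))"

lemma dfn_cong: "dfn P \<Longrightarrow> (\<And>e. (\<And>i. e i \<in> M) \<Longrightarrow> P e \<longleftrightarrow> Q e) \<Longrightarrow> dfn Q"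
  unfolding dfn_def by (smt (verit, best))

named_theorems dfn_intro

lemma dfn_neg [dfn_intro]: "dfn P \<Longrightarrow> dfn (\<lambda>e. \<not> P e)"
  unfolding dfn_def
proof (elim exE conjE)
  fix p a assume "\<forall>i. a i \<in> M" "\<forall>e. (\<forall>i. e i \<in> M) \<longrightarrow> sat M (join e a) p = P e"
  then show "\<exists>p a. (\<forall>i. a i \<in> M) \<and> (\<forall>e. (\<forall>i. e i \<in> M) \<longrightarrow> sat M (join e a) p = (\<not> P e))"
    by (intro exI[of _ "Neg p"] exI[of _ a]) auto
qed

lemma dfn_conj [dfn_intro]: assumes "dfn P" "dfn Q" shows "dfn (\<lambda>e. P e \<and> Q e)"
proof -
  obtain p a where p: "\<And>i. a i \<in> M" "\<And>e. (\<forall>i. e i \<in> M) \<Longrightarrow> sat M (join e a) p = P e"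
    using assms(1) unfolding dfn_def by blast
  obtain q b where q: "\<And>i. b i \<in> M" "\<And>e. (\<forall>i. e i \<in> M) \<Longrightarrow> sat M (join e b) q = Q e"
    using assms(2) unfolding dfn_def by blast
  \<comment> \<open>The parameters of \<open>p\<close> and of \<open>q\<close> go to alternate odd
    variables, where \<open>join a b\<close> keeps them; the even variables stay shared.\<close>
  define f :: "nat \<Rightarrow> nat" where "f i = (if even i then i else 2 * i - 1)" for i
  define g :: "nat \<Rightarrow> nat" where "g i = (if even i then i else 2 * i + 1)" for i
  have inj: "inj f" "inj g"
    by (auto simp: inj_def f_def g_def dest: arg_cong[of _ _ even])
  have f: "f (2 * n) = 2 * n" "f (Suc (2 * n)) = Suc (4 * n)"
    and g: "g (2 * n) = 2 * n" "g (Suc (2 * n)) = Suc (Suc (Suc (4 * n)))" for n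
    by (auto simp: f_def g_def)
  have "join e (join a b) \<circ> f = join e a" for e
  proof
    fix i show "(join e (join a b) \<circ> f) i = join e a i"
      by (cases i rule: parity_cases) (simp_all add: f)
  qed
  moreover have "join e (join a b) \<circ> g = join e b" for e
  proof
    fix i show "(join e (join a b) \<circ> g) i = join e b i"
      by (cases i rule: parity_cases) (simp_all add: g)
  qed
  ultimately have "sat M (join e (join a b)) (Conj (ren f p) (ren g q)) = (P e \<and> Q e)"
    if "\<forall>i. e i \<in> M" for e
    using p(2)[OF that] q(2)[OF that] inj by (simp add: sat_ren)
  moreover have "join a b i \<in> M" for i using p(1) q(1) by (simp add: join_def)
  ultimately show ?thesis unfolding dfn_def by blast
qed

lemma dfn_all [dfn_intro]:
  assumes "dfn (\<lambda>e. Q (e 0) (\<lambda>n. e (Suc n)))" shows "dfn (\<lambda>e. \<forall>a\<in>M. Q a e)"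
proof -
  obtain p a where a: "\<And>i. a i \<in> M"
    and p: "\<And>e. (\<forall>i. e i \<in> M) \<Longrightarrow> sat M (join e a) p = Q (e 0) (\<lambda>n. e (Suc n))"
    using assms unfolding dfn_def by blast
  obtain K where K: "\<And>i. i \<in> vars p \<Longrightarrow> i < K"
    using finite_nat_set_iff_bounded[of "vars p"] by auto
  \<comment> \<open>A permutation of the variables: entry 0 of the environment of the body moves to
    the fresh even variable \<open>2 * K\<close>, which can then be quantified, and the other
    entries used by \<open>p\<close> move down by one place.\<close>
  define f where "f i = (if odd i then i else if i = 0 then 2 * K else if i \<le> 2 * K then i - 2 else i)" for i
  have inj: "inj f"
  proof (rule injI)
    fix x y assume eq: "f x = f y"
    show "x = y"
    proof (cases x rule: parity_cases; cases y rule: parity_cases)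
      fix n m assume "x = 2 * n" "y = 2 * m"
      then show ?thesis using eq by (auto simp: f_def split: if_splits)
    next
      fix n m assume xy: "x = 2 * n" "y = Suc (2 * m)"
      then have "even (f x)" "odd (f y)" by (auto simp: f_def)
      then show ?thesis using eq by simp
    next
      fix n m assume xy: "x = Suc (2 * n)" "y = 2 * m"
      then have "odd (f x)" "even (f y)" by (auto simp: f_def)
      then show ?thesis using eq by simp
    qed (use eq in \<open>auto simp: f_def\<close>)
  qed
  have "sat M (join e a) (All (2 * K) (ren f p)) \<longleftrightarrow> (\<forall>b\<in>M. Q b e)" if e: "\<forall>i. e i \<in> M" for e
  proof -
    have "sat M (((join e a)(2 * K := b)) \<circ> f) p \<longleftrightarrow> sat M (join (case_nat b e) a) p" for b
    proof (rule sat_cong)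
      fix i assume "i \<in> vars p"
      then have "i < K" by (rule K)
      then show "((join e a)(2 * K := b) \<circ> f) i = join (case_nat b e) a i"
      proof (cases i rule: parity_cases)
        case (1 n)
        show ?thesis
        proof (cases n)
          case (Suc m)
          then have "f i = 2 * m" "2 * m \<noteq> 2 * K" using 1 \<open>i < K\<close> by (auto simp: f_def)
          moreover have "join (case_nat b e) a i = case_nat b e n" using 1 by simp
          ultimately show ?thesis using Suc by simp
        qed (simp add: 1 f_def)
      next
        case (2 n)
        have "Suc (2 * n) \<noteq> 2 * K" by presburger
        then show ?thesis using 2 by (simp add: f_def)
      qed
    qed
    moreover have "sat M (join (case_nat b e) a) p \<longleftrightarrow> Q b e" if "b \<in> M" for b
      using p[of "case_nat b e"] e that by (auto split: nat.split)
    ultimately show ?thesis using inj by (simp add: sat_ren)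
  qed
  then show ?thesis unfolding dfn_def using a by blast
qed

lemma dfn_ren:
  assumes "inj g" "dfn P" shows "dfn (\<lambda>e. P (\<lambda>n. e (g n)))"
proof -
  obtain p a where a: "\<And>i. a i \<in> M"
    and p: "\<And>e. (\<forall>i. e i \<in> M) \<Longrightarrow> sat M (join e a) p = P e"
    using assms unfolding dfn_def by blast
  define f where "f i = (if odd i then i else 2 * g (i div 2))" for i
  have f: "f (2 * n) = 2 * g n" "f (Suc (2 * n)) = Suc (2 * n)" for n by (auto simp: f_def)
  have "inj f"
  proof (rule injI)
    fix x y assume "f x = f y"
    then show "x = y"
      using injD[OF assms(1), of "x div 2" "y div 2"] unfolding f_def
      by (metis div_mult_self1_is_m dvd_mult_div_cancel dvd_triv_left even_Suc pos2)
  qed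
  moreover have "join e a \<circ> f = join (\<lambda>n. e (g n)) a" for e
  proof
    fix i show "(join e a \<circ> f) i = join (\<lambda>n. e (g n)) a i"
      by (cases i rule: parity_cases) (simp_all add: f)
  qed
  ultimately have "sat M (join e a) (ren f p) = P (\<lambda>n. e (g n))" if "\<forall>i. e i \<in> M" for e
    using that p by (simp add: sat_ren)
  then show ?thesis unfolding dfn_def using a by blast
qed

lemma dfn_shift: "dfn P \<Longrightarrow> dfn (\<lambda>e. P (\<lambda>n. e (Suc n)))"
  by (rule dfn_ren) auto

text \<open>Environment entries from \<open>k\<close> on become parameters. A formula about a
  varying environment thus turns into one about fixed sets, the form that Separation and Replacement
  accept.\<close>

lemma dfn_params:
  assumes "dfn P" "\<And>i. c i \<in> M" shows "dfn (\<lambda>e. P (\<lambda>n. if n < k then e n else c (n - k)))"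
proof -
  obtain p a where a: "\<And>i. a i \<in> M"
    and p: "\<And>e. (\<forall>i. e i \<in> M) \<Longrightarrow> sat M (join e a) p = P e"
    using assms unfolding dfn_def by blast
  define f where "f i = (if odd i then 2 * i + 1 else if i < 2 * k then i else 2 * (i - 2 * k) + 1)" for i
  have f: "f (2 * n) = (if n < k then 2 * n else Suc (4 * (n - k)))"
    "f (Suc (2 * n)) = Suc (Suc (Suc (4 * n)))" for n by (auto simp: f_def)
  have "inj f"
  proof (rule injI)
    fix x y assume eq: "f x = f y"
    have *: "Suc (4 * i) \<noteq> 2 * j" "4 * i \<noteq> Suc (Suc (4 * j))"
      "Suc (Suc (Suc (4 * i))) \<noteq> 2 * j" for i j :: nat by presburger+
    show "x = y"
      using eq by (cases x rule: parity_cases; cases y rule: parity_cases)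
        (auto simp: f * *[symmetric] split: if_splits)
  qed
  moreover have "join e (join c a) \<circ> f = join (\<lambda>n. if n < k then e n else c (n - k)) a" for e
  proof
    fix i show "(join e (join c a) \<circ> f) i = join (\<lambda>n. if n < k then e n else c (n - k)) a i"
      by (cases i rule: parity_cases) (simp_all add: f)
  qed
  ultimately have "sat M (join e (join c a)) (ren f p) = P (\<lambda>n. if n < k then e n else c (n - k))"
    if "\<forall>i. e i \<in> M" for e
    using that p assms(2) by (simp add: sat_ren)
  moreover have "join c a i \<in> M" for i using assms(2) a by (simp add: join_def)
  ultimately show ?thesis unfolding dfn_def by blast
qed

lemma dfn_var_mem: "dfn (\<lambda>e. e i \<in> elts (e j))" and dfn_var_eq: "dfn (\<lambda>e. e i = e j)"
proof -
  obtain c where "c \<in> M" using M_ne by auto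
  then show "dfn (\<lambda>e. e i \<in> elts (e j))" unfolding dfn_def
    by (auto intro!: exI[of _ "Mem (2 * i) (2 * j)"] exI[of _ "\<lambda>_. c"])
  show "dfn (\<lambda>e. e i = e j)" unfolding dfn_def
    using \<open>c \<in> M\<close> by (auto intro!: exI[of _ "Equ (2 * i) (2 * j)"] exI[of _ "\<lambda>_. c"])
qed

lemma dfn_const [dfn_intro]: "dfn (\<lambda>e. b)"
proof (cases b)
  case True
  then show ?thesis using dfn_cong[OF dfn_var_eq[of 0 0], of "\<lambda>_. b"] by simp
next
  case False
  then show ?thesis using dfn_cong[OF dfn_neg[OF dfn_var_eq[of 0 0]], of "\<lambda>_. b"] by simp
qed

lemma dfn_imp [dfn_intro]:
  assumes "dfn P" "dfn Q" shows "dfn (\<lambda>e. P e \<longrightarrow> Q e)"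
  by (rule dfn_cong[OF dfn_neg[OF dfn_conj[OF assms(1) dfn_neg[OF assms(2)]]]]) simp

lemma dfn_disj [dfn_intro]:
  assumes "dfn P" "dfn Q" shows "dfn (\<lambda>e. P e \<or> Q e)"
  by (rule dfn_cong[OF dfn_neg[OF dfn_conj[OF dfn_neg[OF assms(1)] dfn_neg[OF assms(2)]]]]) simp

lemma dfn_iff [dfn_intro]:
  assumes "dfn P" "dfn Q" shows "dfn (\<lambda>e. P e \<longleftrightarrow> Q e)"
  by (rule dfn_cong[OF dfn_conj[OF dfn_imp[OF assms] dfn_imp[OF assms(2,1)]]]) auto

lemma dfn_ex [dfn_intro]: "dfn (\<lambda>e. Q (e 0) (\<lambda>n. e (Suc n))) \<Longrightarrow> dfn (\<lambda>e. \<exists>a\<in>M. Q a e)"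
  by (rule dfn_cong[OF dfn_neg[OF dfn_all[of "\<lambda>a e. \<not> Q a e"]]]) (auto intro: dfn_neg)

text \<open>The language has no function symbols, so a term is represented by a formula for its
  graph. Closure of \<open>M\<close> is part of the notion because substitution quantifies over
  \<open>M\<close>.\<close>

definition dtm :: "((nat \<Rightarrow> hc) \<Rightarrow> hc) \<Rightarrow> bool" where
  "dtm t \<longleftrightarrow> (\<forall>e. (\<forall>i. e i \<in> M) \<longrightarrow> t e \<in> M) \<and> dfn (\<lambda>e. e 0 = t (\<lambda>n. e (Suc n)))"

lemma dtm_closed: "dtm t \<Longrightarrow> (\<And>i. e i \<in> M) \<Longrightarrow> t e \<in> M"
  by (auto simp: dtm_def)

lemma dtm_shift: "dtm t \<Longrightarrow> dtm (\<lambda>e. t (\<lambda>n. e (Suc n)))"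
  unfolding dtm_def
proof (safe)
  assume "dfn (\<lambda>e. e 0 = t (\<lambda>n. e (Suc n)))"
  then have "dfn (\<lambda>e. (\<lambda>n. e (case n of 0 \<Rightarrow> 0 | Suc n \<Rightarrow> Suc (Suc n))) 0 =
      t (\<lambda>m. (\<lambda>n. e (case n of 0 \<Rightarrow> 0 | Suc n \<Rightarrow> Suc (Suc n))) (Suc m)))"
    by (rule dfn_ren[rotated]) (auto simp: inj_def split: nat.split)
  then show "dfn (\<lambda>e. e 0 = t (\<lambda>n. e (Suc (Suc n))))" by simp
qed auto

lemma dtm_var [dfn_intro]: "dtm (\<lambda>e. e i)"
  unfolding dtm_def using dfn_var_eq[of 0 "Suc i"] by simp

lemma dtm_const [dfn_intro]: assumes "c \<in> M" shows "dtm (\<lambda>e. c)"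
  using dfn_params[OF dfn_var_eq[of 0 1], of "\<lambda>_. c" 1] assms
  unfolding dtm_def by simp

lemma dfn_subst:
  assumes "dfn (\<lambda>e. Q (e 0) (\<lambda>n. e (Suc n)))" "dtm t" shows "dfn (\<lambda>e. Q (t e) e)"
proof -
  have "dfn (\<lambda>e. \<exists>a\<in>M. a = t e \<and> Q a e)"
    using assms by (intro dfn_intro) (auto simp: dtm_def)
  then show ?thesis by (rule dfn_cong) (use assms in \<open>auto simp: dtm_def\<close>)
qed

lemma dfn_subst1:
  assumes "dfn (\<lambda>e. R (e 0))" "dtm t" shows "dfn (\<lambda>e. R (t e))"
  by (rule dfn_subst[of "\<lambda>a e. R a"]) (use assms in auto)

lemma dfn_eq_shift: "dtm t \<Longrightarrow> i < k \<Longrightarrow> dfn (\<lambda>e. e i = t (\<lambda>n. e (n + k)))"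
proof -
  assume t: "dtm t" and i: "i < k"
  define g where "g n = (case n of 0 \<Rightarrow> i | Suc n \<Rightarrow> n + k)" for n
  have "inj g" using i by (auto simp: inj_def g_def split: nat.split)
  then have "dfn (\<lambda>e. (\<lambda>n. e (g n)) 0 = t (\<lambda>m. (\<lambda>n. e (g n)) (Suc m)))"
    using t by (rule_tac dfn_ren) (auto simp: dtm_def)
  then show ?thesis by (simp add: g_def)
qed

text \<open>The values of the terms are quantified over \<open>M\<close>, so it is enough to have a
  formula for the relation between variables. The rules for derived notions rest on this.\<close>

lemma dfn_subst2:
  assumes "dfn (\<lambda>e. R (e 0) (e 1))" "dtm t" "dtm s" shows "dfn (\<lambda>e. R (t e) (s e))"
proof -
  have "dfn (\<lambda>e. R (e 0) (e (Suc 0)) \<and> e 0 = t (\<lambda>n. e (Suc (Suc n))) \<and> e (Suc 0) = s (\<lambda>n. e (Suc (Suc n))))"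
    using assms dfn_eq_shift[OF assms(2), of 0 2] dfn_eq_shift[OF assms(3), of 1 2]
    by (auto intro!: dfn_conj)
  then have "dfn (\<lambda>e. \<exists>b\<in>M. \<exists>a\<in>M. R a b \<and> a = t e \<and> b = s e)"
    by (rule_tac dfn_ex, rule_tac dfn_ex)
  then show ?thesis by (rule dfn_cong) (use assms in \<open>auto simp: dtm_def\<close>)
qed

lemma dfn_subst3:
  assumes "dfn (\<lambda>e. R (e 0) (e 1) (e 2))" "dtm t" "dtm s" "dtm r" shows "dfn (\<lambda>e. R (t e) (s e) (r e))"
proof -
  have "dfn (\<lambda>e. R (e 0) (e (Suc 0)) (e (Suc (Suc 0))) \<and> e 0 = t (\<lambda>n. e (Suc (Suc (Suc n))))
     \<and> e (Suc 0) = s (\<lambda>n. e (Suc (Suc (Suc n)))) \<and> e (Suc (Suc 0)) = r (\<lambda>n. e (Suc (Suc (Suc n)))))"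
    using assms dfn_eq_shift[OF assms(2), of 0 3] dfn_eq_shift[OF assms(3), of 1 3]
      dfn_eq_shift[OF assms(4), of 2 3]
    by (auto intro!: dfn_conj simp: numeral_2_eq_2 numeral_3_eq_3)
  then have "dfn (\<lambda>e. \<exists>c\<in>M. \<exists>b\<in>M. \<exists>a\<in>M. R a b c \<and> a = t e \<and> b = s e \<and> c = r e)"
    by (rule_tac dfn_ex, rule_tac dfn_ex, rule_tac dfn_ex)
  then show ?thesis by (rule dfn_cong) (use assms in \<open>auto simp: dtm_def\<close>)
qed

lemma dfn_mem [dfn_intro]: "dtm t \<Longrightarrow> dtm s \<Longrightarrow> dfn (\<lambda>e. t e \<in> elts (s e))"
  by (rule dfn_subst2[of "\<lambda>x y. x \<in> elts y"]) (auto intro: dfn_var_mem)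

lemma dfn_eq [dfn_intro]: "dtm t \<Longrightarrow> dtm s \<Longrightarrow> dfn (\<lambda>e. t e = s e)"
  by (rule dfn_subst2[of "\<lambda>x y. x = y"]) (auto intro: dfn_var_eq)

lemma dtm_subst1:
  assumes "dtm (\<lambda>e. f (e 0))" "dtm t" shows "dtm (\<lambda>e. f (t e))"
  unfolding dtm_def
proof safe
  show "f (t e) \<in> M" if "\<forall>i. e i \<in> M" for e
    using dtm_closed[OF assms(1), of "\<lambda>_. t e"] dtm_closed[OF assms(2), of e] that by simp
  have "dfn (\<lambda>e. e 1 = f (e 0))"
    by (rule dfn_eq[OF dtm_var assms(1)])
  then show "dfn (\<lambda>e. e 0 = f (t (\<lambda>n. e (Suc n))))"
    by (rule_tac dfn_subst2[of "\<lambda>x y. y = f x"]) (auto intro!: dtm_shift assms(2) dtm_var)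
qed

lemma dtm_subst2:
  assumes "dtm (\<lambda>e. f (e 0) (e 1))" "dtm t" "dtm s" shows "dtm (\<lambda>e. f (t e) (s e))"
  unfolding dtm_def
proof safe
  show "f (t e) (s e) \<in> M" if "\<forall>i. e i \<in> M" for e
    using dtm_closed[OF assms(1), of "case_nat (t e) (\<lambda>_. s e)"] dtm_closed[OF assms(2), of e]
      dtm_closed[OF assms(3), of e] that by (simp add: split: nat.split)
  have "dfn (\<lambda>e. e 2 = f (e 0) (e 1))"
    by (rule dfn_eq[OF dtm_var assms(1)])
  then show "dfn (\<lambda>e. e 0 = f (t (\<lambda>n. e (Suc n))) (s (\<lambda>n. e (Suc n))))"
    by (rule_tac dfn_subst3[of "\<lambda>x y z. z = f x y"]) (auto intro!: dtm_shift assms dtm_var)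
qed

text \<open>As \<open>M\<close> is transitive, a set of \<open>M\<close> is determined by its
  members in \<open>M\<close>; a formula for membership in the value therefore yields one for the
  graph.\<close>

lemma dtm_ext:
  assumes "\<And>e. (\<forall>i. e i \<in> M) \<Longrightarrow> t e \<in> M" "dfn (\<lambda>e. e 0 \<in> elts (t (\<lambda>n. e (Suc n))))"
  shows "dtm t"
  unfolding dtm_def
proof safe
  have "dfn (\<lambda>e. (\<lambda>n. e (case n of 0 \<Rightarrow> 0 | Suc n \<Rightarrow> Suc (Suc n))) 0 \<in>
      elts (t (\<lambda>m. (\<lambda>n. e (case n of 0 \<Rightarrow> 0 | Suc n \<Rightarrow> Suc (Suc n))) (Suc m))))"
    by (rule dfn_ren[OF _ assms(2)]) (auto simp: inj_def split: nat.split)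
  then have "dfn (\<lambda>e. \<forall>a\<in>M. a \<in> elts (e 0) \<longleftrightarrow> a \<in> elts (t (\<lambda>n. e (Suc n))))"
    by (rule_tac dfn_all, rule_tac dfn_iff[OF dfn_var_mem]) simp
  then show "dfn (\<lambda>e. e 0 = t (\<lambda>n. e (Suc n)))"
  proof (rule dfn_cong)
    fix e :: "nat \<Rightarrow> hc" assume e: "\<And>i. e i \<in> M"
    have "t (\<lambda>n. e (Suc n)) \<in> M" by (rule assms(1)) (use e in auto)
    then show "(\<forall>a\<in>M. a \<in> elts (e 0) \<longleftrightarrow> a \<in> elts (t (\<lambda>n. e (Suc n)))) \<longleftrightarrow> e 0 = t (\<lambda>n. e (Suc n))"
      using e trans by (auto intro!: hc_ext)
  qed
qed (rule assms(1))

text \<open>Transitivity again: a quantifier bounded by a set of \<open>M\<close> ranges over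
  elements of \<open>M\<close> only.\<close>

lemma dfn_ball [dfn_intro]:
  assumes "dtm t" "dfn (\<lambda>e. Q (e 0) (\<lambda>n. e (Suc n)))"
  shows "dfn (\<lambda>e. \<forall>a\<in>elts (t e). Q a e)"
proof -
  have "dfn (\<lambda>e. \<forall>a\<in>M. a \<in> elts (t e) \<longrightarrow> Q a e)"
    using assms by (intro dfn_intro dtm_shift)
  then show ?thesis
    by (rule dfn_cong) (use dtm_closed[OF assms(1)] trans in blast)
qed

lemma dfn_bex [dfn_intro]:
  assumes "dtm t" "dfn (\<lambda>e. Q (e 0) (\<lambda>n. e (Suc n)))"
  shows "dfn (\<lambda>e. \<exists>a\<in>elts (t e). Q a e)"
  by (rule dfn_cong[OF dfn_neg[OF dfn_ball[of t "\<lambda>a e. \<not> Q a e"]]])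
    (use assms in \<open>auto intro: dfn_neg\<close>)

lemma dfn_subset [dfn_intro]:
  "dtm t \<Longrightarrow> dtm s \<Longrightarrow> dfn (\<lambda>e. elts (t e) \<subseteq> elts (s e))"
  unfolding subset_iff Ball_def[symmetric] by (intro dfn_intro dtm_shift)

end

section \<open>Pairs, functions and well-founded recursion on hereditarily countable sets\<close>

lemma elts_induct [case_names elts]: "(\<And>x. (\<And>y. y \<in> elts x \<Longrightarrow> P y) \<Longrightarrow> P x) \<Longrightarrow> P x"
  using wf_induct_rule[OF wf_elts_rel, of P] by (auto simp: elts_rel_def)

lemma elts_irrefl: "x \<notin> elts x"
  by (induction x rule: elts_induct) blast

lemma elts_asym: "x \<in> elts y \<Longrightarrow> y \<notin> elts x"
  by (induction x arbitrary: y rule: elts_induct) blast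

lemma elts_hset_subset [simp]: "A \<subseteq> elts x \<Longrightarrow> elts (hset A) = A"
  by (meson countable_elts countable_subset elts_hset)

lemma hset_inj: "countable A \<Longrightarrow> countable B \<Longrightarrow> hset A = hset B \<longleftrightarrow> A = B"
  by (metis elts_hset)

lemma opair_inj [simp]: "opair a b = opair c d \<longleftrightarrow> a = c \<and> b = d"
  by (auto simp: opair_def hset_inj doubleton_eq_iff)

definition hUnion :: "hc \<Rightarrow> hc" where "hUnion x = hset (\<Union> (elts ` elts x))"

lemma elts_hUnion [simp]: "elts (hUnion x) = \<Union> (elts ` elts x)"
  by (simp add: hUnion_def)

definition hins :: "hc \<Rightarrow> hc \<Rightarrow> hc" where "hins a x = hset (insert a (elts x))"

lemma elts_hins [simp]: "elts (hins a x) = insert a (elts x)"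
  by (simp add: hins_def)

text \<open>The components are sought inside \<open>hUnion z\<close>, which keeps all quantifiers
  bounded; a set that is not a pair gets the empty set.\<close>

definition hfst :: "hc \<Rightarrow> hc" where
  "hfst z = hset {u \<in> elts (hUnion (hUnion z)). \<exists>a\<in>elts (hUnion z). \<exists>b\<in>elts (hUnion z). z = opair a b \<and> u \<in> elts a}"

definition hsnd :: "hc \<Rightarrow> hc" where
  "hsnd z = hset {u \<in> elts (hUnion (hUnion z)). \<exists>a\<in>elts (hUnion z). \<exists>b\<in>elts (hUnion z). z = opair a b \<and> u \<in> elts b}"

text \<open>The union of all values at \<open>x\<close>: the value itself where that is unique, and
  empty outside the domain. Evaluation thus is a total operation with bounded quantifiers.\<close>

definition app :: "hc \<Rightarrow> hc \<Rightarrow> hc" where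
  "app f x = hset {u \<in> elts (hUnion (hUnion (hUnion f))). \<exists>y\<in>elts (hUnion (hUnion f)). opair x y \<in> elts f \<and> u \<in> elts y}"

lemma elts_opair [simp]: "elts (opair a b) = {hset {a}, hset {a, b}}"
  by (simp add: opair_def)

lemma hUnion_opair [simp]: "elts (hUnion (opair a b)) = {a, b}"
  by auto

lemma elts_sep: "elts (hset {x \<in> elts A. P x}) = {x \<in> elts A. P x}"
  by (rule elts_hset_subset[of _ A]) auto

lemma elts_hfst: "u \<in> elts (hfst (opair a b)) \<longleftrightarrow> u \<in> elts a"
  and elts_hsnd: "u \<in> elts (hsnd (opair a b)) \<longleftrightarrow> u \<in> elts b"
proof -
  have 1: "elts (hUnion (opair a b)) = {a, b}" by (rule hUnion_opair)
  then have 2: "elts (hUnion (hUnion (opair a b))) = elts a \<union> elts b" by (subst elts_hUnion) auto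
  show "u \<in> elts (hfst (opair a b)) \<longleftrightarrow> u \<in> elts a"
    unfolding hfst_def elts_sep unfolding 1 2 opair_inj by blast
  show "u \<in> elts (hsnd (opair a b)) \<longleftrightarrow> u \<in> elts b"
    unfolding hsnd_def elts_sep unfolding 1 2 opair_inj by blast
qed

lemma hfst_opair [simp]: "hfst (opair a b) = a" and hsnd_opair [simp]: "hsnd (opair a b) = b"
  by (auto intro!: hc_ext simp: elts_hfst elts_hsnd simp del: elts_opair)

lemma opair_in_Union:
  assumes "opair a b \<in> elts f"
  shows "a \<in> elts (hUnion (hUnion f)) \<and> b \<in> elts (hUnion (hUnion f))"
proof -
  have "hset {a, b} \<in> elts (hUnion f)" using assms by (subst elts_hUnion) (auto intro!: bexI[of _ "opair a b"])
  moreover have "a \<in> elts (hset {a, b})" "b \<in> elts (hset {a, b})" by auto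
  ultimately show ?thesis by (subst (1 2) elts_hUnion) blast
qed

lemma elts_app: "u \<in> elts (app f x) \<longleftrightarrow> (\<exists>y. opair x y \<in> elts f \<and> u \<in> elts y)"
proof -
  have "u \<in> elts (hUnion (hUnion (hUnion f)))" if "opair x y \<in> elts f" "u \<in> elts y" for y
    using opair_in_Union[OF that(1)] that(2) by (subst elts_hUnion) blast
  then show ?thesis
    unfolding app_def elts_sep using opair_in_Union[of x _ f] by blast
qed

lemma app_eq: "opair x y \<in> elts f \<Longrightarrow> (\<And>y'. opair x y' \<in> elts f \<Longrightarrow> y' = y) \<Longrightarrow> app f x = y"
  by (rule hc_ext, rule set_eqI) (metis elts_app)

definition gr :: "(hc \<Rightarrow> hc) \<Rightarrow> hc \<Rightarrow> hc" where
  "gr F A = hset ((\<lambda>u. opair u (F u)) ` elts A)"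

lemma elts_gr [simp]: "elts (gr F A) = (\<lambda>u. opair u (F u)) ` elts A"
  by (simp add: gr_def)

lemma app_gr [simp]: "x \<in> elts A \<Longrightarrow> app (gr F A) x = F x"
  by (rule app_eq) auto

lemma elts_hseq [simp]: "elts (hseq f) = range (\<lambda>n. opair (ord_nat n) (f n))"
  by (simp add: hseq_def)

lemma elts_ord_nat: "elts (ord_nat n) = ord_nat ` {..<n}"
proof (induction n)
  case (Suc n)
  then show ?case by (auto simp: lessThan_Suc countable_finite)
qed simp

lemma ord_nat_inj [simp]: "ord_nat m = ord_nat n \<longleftrightarrow> m = n"
proof -
  have "m < n \<Longrightarrow> ord_nat m \<noteq> ord_nat n" for m n
    using elts_irrefl[of "ord_nat n"] elts_ord_nat[of n] by (metis imageI lessThan_iff)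
  then show ?thesis by (metis nat_neq_iff)
qed

lemma ord_nat_mem [simp]: "ord_nat m \<in> elts (ord_nat n) \<longleftrightarrow> m < n"
  by (auto simp: elts_ord_nat)

lemma ord_nat_Suc: "ord_nat (Suc n) = hins (ord_nat n) (ord_nat n)"
  by (simp add: hins_def)

lemma app_hseq [simp]: "app (hseq f) (ord_nat n) = f n"
  by (rule app_eq) auto

lemma hseq_inj [simp]: "hseq f = hseq g \<longleftrightarrow> f = g"
proof
  assume "hseq f = hseq g"
  then have "app (hseq f) (ord_nat n) = app (hseq g) (ord_nat n)" for n by simp
  then show "f = g" by auto
qed simp

text \<open>\<open>x\<close> itself is left out, so that \<open>tc x\<close> consists of the
  arguments that a recursion may consult at \<open>x\<close>.\<close>

definition tc :: "hc \<Rightarrow> hc" where "tc x = hset {y. (y, x) \<in> elts_rel\<^sup>+}"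

lemma tc_set: "{y. (y, x) \<in> elts_rel\<^sup>+} = elts x \<union> (\<Union>u\<in>elts x. {y. (y, u) \<in> elts_rel\<^sup>+})"
  by (auto simp: elts_rel_def intro: trancl.intros elim: tranclE)

lemma countable_tc: "countable {y. (y, x) \<in> elts_rel\<^sup>+}"
  by (induction x rule: elts_induct) (subst tc_set, auto)

lemma elts_tc': "elts (tc x) = {y. (y, x) \<in> elts_rel\<^sup>+}"
  using countable_tc by (simp add: tc_def)

lemma elts_tc: "elts (tc x) = elts x \<union> (\<Union>u\<in>elts x. elts (tc u))"
  unfolding elts_tc' by (rule tc_set)

lemma tc_trans: "y \<in> elts (tc x) \<Longrightarrow> elts (tc y) \<subseteq> elts (tc x)"
  by (auto simp: elts_tc' intro: trancl_trans)

lemma tc_elts: "u \<in> elts y \<Longrightarrow> y \<in> elts (tc x) \<Longrightarrow> u \<in> elts (tc x)"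
  using tc_trans[of y x] elts_tc[of y] by auto

lemma elts_sub_tc: "u \<in> elts x \<Longrightarrow> u \<in> elts (tc x)"
  by (subst elts_tc) auto

lemma tc_min: "(\<And>y u. y \<in> elts z \<Longrightarrow> u \<in> elts y \<Longrightarrow> u \<in> elts z) \<Longrightarrow> elts x \<subseteq> elts z \<Longrightarrow> elts (tc x) \<subseteq> elts z"
proof (induction x rule: elts_induct)
  case (elts x)
  then show ?case by (subst elts_tc) blast
qed

lemma opair_tc: "opair a b \<in> elts t \<Longrightarrow> a \<in> elts (tc t) \<and> b \<in> elts (tc t)"
  by (rule conjI; rule tc_elts[of _ "hset {a, b}", OF _ tc_elts[of _ "opair a b", OF _ elts_sub_tc]]) auto

text \<open>Recursion along the transitive closure of membership, since subcodes and subnames sit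
  several levels deep inside ordered pairs. The earlier values are handed over as a set, so that the
  step \<open>G\<close> is an operation on sets and may be definable over \<open>M\<close>.\<close>

definition hrec :: "(hc \<Rightarrow> hc \<Rightarrow> hc) \<Rightarrow> hc \<Rightarrow> hc" where
  "hrec G = wfrec (elts_rel\<^sup>+) (\<lambda>F x. G x (gr F (tc x)))"

lemma hrec: "hrec G x = G x (gr (hrec G) (tc x))"
proof -
  have "hrec G x = G x (gr (cut (hrec G) (elts_rel\<^sup>+) x) (tc x))"
    by (rule def_wfrec[of "hrec G"]) (simp_all add: hrec_def wf_trancl wf_elts_rel)
  also have "gr (cut (hrec G) (elts_rel\<^sup>+) x) (tc x) = gr (hrec G) (tc x)"
    by (rule hc_ext) (auto simp: elts_tc' cut_def)
  finally show ?thesis .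
qed

definition restr :: "hc \<Rightarrow> hc \<Rightarrow> hc" where
  "restr g A = hset {p \<in> elts g. hfst p \<in> elts A}"

lemma elts_restr [simp]: "elts (restr g A) = {p \<in> elts g. hfst p \<in> elts A}"
  by (simp add: restr_def countable_subset[of _ "elts g"])

lemma sat_Imp: "sat M e (Imp p q) \<longleftrightarrow> (sat M e p \<longrightarrow> sat M e q)"
  and sat_Iff: "sat M e (Iff p q) \<longleftrightarrow> (sat M e p \<longleftrightarrow> sat M e q)"
  and sat_Exi: "sat M e (Exi n p) \<longleftrightarrow> (\<exists>a\<in>M. sat M (e(n := a)) p)"
  by auto

lemma sat_separation:
  "sat M E (ax_separation p) \<longleftrightarrow> (\<forall>A\<in>M. \<exists>B\<in>M. \<forall>x\<in>M. x \<in> elts B \<longleftrightarrow> x \<in> elts A \<and> sat M (E(1 := A, 2 := B, 0 := x)) p)"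
  by (simp only: ax_separation_def sat_Iff sat_Exi sat.simps(5)) simp

lemma sat_replacement:
  "sat M E (ax_replacement p) \<longleftrightarrow> (\<forall>A\<in>M.
    (\<forall>x\<in>M. x \<in> elts A \<longrightarrow> (\<exists>y\<in>M. \<forall>z\<in>M. sat M (E(2 := A, 0 := x, 4 := y, 1 := z)) p \<longleftrightarrow> z = y))
    \<longrightarrow> (\<exists>B\<in>M. \<forall>x\<in>M. x \<in> elts A \<longrightarrow> (\<exists>y\<in>M. y \<in> elts B \<and> sat M (E(2 := A, 3 := B, 0 := x, 1 := y)) p)))"
  by (simp only: ax_replacement_def sat_Iff sat_Exi sat_Imp sat.simps(5)) simp

section \<open>Separation and Replacement for definable terms\<close>

context ctm begin

lemma sep_M:
  assumes "A \<in> M" "dfn (\<lambda>e. R (e 0))" shows "hset {x \<in> elts A. R x} \<in> M"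
proof -
  obtain p a where a: "\<And>i. a i \<in> M" and p: "\<And>e. (\<forall>i. e i \<in> M) \<Longrightarrow> sat M (join e a) p = R (e 0)"
    using assms(2) unfolding dfn_def by blast
  \<comment> \<open>Variable 0 stays the element; 1 and 2 are vacated for the two sets that the
    axiom binds.\<close>
  define f :: "nat \<Rightarrow> nat" where "f i = (if i = 0 then 0 else i + 2)" for i
  have f: "inj f" "2 \<notin> free_vars (ren f p)"
    using free_vars_ren[of f p] by (auto simp: inj_def f_def)
  then have m: "M \<Turnstile> ax_separation (ren f p)"
    by (intro ax) (auto simp: ZFC_def)
  define E where "E = (\<lambda>i. join (\<lambda>_. A) a (i - 2))"
  have "E i \<in> M" for i using a assms(1) by (simp add: E_def join_def)
  then have "sat M E (ax_separation (ren f p))"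
    using m unfolding models_def by blast
  then obtain B where B: "B \<in> M"
    "\<And>x. x \<in> M \<Longrightarrow> x \<in> elts B \<longleftrightarrow> x \<in> elts A \<and> sat M (E(1 := A, 2 := B, 0 := x)) (ren f p)"
    using assms(1) unfolding sat_separation by blast
  have "sat M (E(1 := A, 2 := B, 0 := x)) (ren f p) \<longleftrightarrow> R x" if "x \<in> M" for x
  proof -
    have "E(1 := A, 2 := B, 0 := x) \<circ> f = join ((\<lambda>_. A)(0 := x)) a"
      by (auto simp: f_def E_def fun_eq_iff join_def)
    then show ?thesis using p[of "(\<lambda>_. A)(0 := x)"] that assms(1) f by (simp add: sat_ren)
  qed
  with B have "elts B = {x \<in> elts A. R x}" using trans assms(1) by blast
  then show ?thesis using B(1) by (metis hset_elts)
qed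

lemma repl_M:
  assumes "A \<in> M" "dfn (\<lambda>e. R (e 0) (e 1))"
    "\<And>x. x \<in> elts A \<Longrightarrow> \<exists>y\<in>M. \<forall>z\<in>M. R x z \<longleftrightarrow> z = y"
  shows "\<exists>B\<in>M. \<forall>x\<in>elts A. \<exists>y\<in>elts B. R x y"
proof -
  obtain p a where a: "\<And>i. a i \<in> M" and p: "\<And>e. (\<forall>i. e i \<in> M) \<Longrightarrow> sat M (join e a) p = R (e 0) (e 1)"
    using assms(2) unfolding dfn_def by blast
  \<comment> \<open>Entry 1 of the environment sits at the even variable 2 and becomes the value
    variable 1; all further variables move past those that the axiom binds.\<close>
  define f :: "nat \<Rightarrow> nat" where "f i = (if i = 0 then 0 else if i = 2 then 1 else i + 4)" for i
  have f: "inj f" "3 \<notin> free_vars (ren f p)" "4 \<notin> free_vars (ren f p)"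
    using free_vars_ren[of f p] by (auto simp: inj_def f_def)
  then have m: "M \<Turnstile> ax_replacement (ren f p)"
    by (intro ax) (auto simp: ZFC_def)
  define E where "E = (\<lambda>i. join (\<lambda>_. A) a (i - 4))"
  have E: "E i \<in> M" for i using a assms(1) by (simp add: E_def join_def)
  have R: "sat M e (ren f p) \<longleftrightarrow> R x y"
    if "x \<in> M" "y \<in> M" "e 0 = x" "e 1 = y" "\<And>i. i > 4 \<Longrightarrow> e i = E i" for e x y
  proof -
    have "e \<circ> f = join ((\<lambda>_. A)(0 := x, 1 := y)) a"
      using that by (auto simp: f_def E_def fun_eq_iff join_def)
    then show ?thesis using p[of "(\<lambda>_. A)(0 := x, 1 := y)"] that assms(1) f by (simp add: sat_ren)
  qed
  have "sat M E (ax_replacement (ren f p))"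
    using m E unfolding models_def by blast
  then have *: "(\<forall>x\<in>M. x \<in> elts A \<longrightarrow> (\<exists>y\<in>M. \<forall>z\<in>M. sat M (E(2 := A, 0 := x, 4 := y, 1 := z)) (ren f p) \<longleftrightarrow> z = y))
    \<Longrightarrow> \<exists>B\<in>M. \<forall>x\<in>M. x \<in> elts A \<longrightarrow> (\<exists>y\<in>M. y \<in> elts B \<and> sat M (E(2 := A, 3 := B, 0 := x, 1 := y)) (ren f p))"
    using assms(1) unfolding sat_replacement by blast
  have "\<exists>B\<in>M. \<forall>x\<in>M. x \<in> elts A \<longrightarrow> (\<exists>y\<in>M. y \<in> elts B \<and> sat M (E(2 := A, 3 := B, 0 := x, 1 := y)) (ren f p))"
  proof (rule *, safe)
    fix x assume x: "x \<in> M" "x \<in> elts A"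
    then obtain y where y: "y \<in> M" "\<forall>z\<in>M. R x z \<longleftrightarrow> z = y" using assms(3) by blast
    show "\<exists>y\<in>M. \<forall>z\<in>M. sat M (E(2 := A, 0 := x, 4 := y, 1 := z)) (ren f p) \<longleftrightarrow> z = y"
      by (rule bexI[OF _ y(1)]) (use x y in \<open>auto simp: R\<close>)
  qed
  then obtain B where B: "B \<in> M"
    "\<And>x. x \<in> M \<Longrightarrow> x \<in> elts A \<Longrightarrow> \<exists>y\<in>M. y \<in> elts B \<and> sat M (E(2 := A, 3 := B, 0 := x, 1 := y)) (ren f p)"
    by blast
  have "\<exists>y\<in>elts B. R x y" if xA: "x \<in> elts A" for x
  proof -
    have x: "x \<in> M" using xA assms(1) trans by blast
    obtain y where y: "y \<in> M" "y \<in> elts B" "sat M (E(2 := A, 3 := B, 0 := x, 1 := y)) (ren f p)"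
      using B(2)[OF x xA] by blast
    then have "R x y" using R[of x y "E(2 := A, 3 := B, 0 := x, 1 := y)"] x by simp
    then show ?thesis using y by blast
  qed
  then show ?thesis using B(1) by blast
qed

lemma dtm_sep [dfn_intro]:
  assumes "dtm s" "dfn (\<lambda>e. Q (e 0) (\<lambda>n. e (Suc n)))"
  shows "dtm (\<lambda>e. hset {x \<in> elts (s e). Q x e})"
proof (rule dtm_ext)
  fix e :: "nat \<Rightarrow> hc" assume e: "\<forall>i. e i \<in> M"
  then have "dfn (\<lambda>f. Q (f 0) e)"
    using dfn_params[OF assms(2), of e 1] by simp
  then show "hset {x \<in> elts (s e). Q x e} \<in> M"
    using sep_M[of "s e" "\<lambda>x. Q x e"] assms(1) e by (auto simp: dtm_def)
next
  have "dfn (\<lambda>e. e 0 \<in> elts (s (\<lambda>n. e (Suc n))) \<and> Q (e 0) (\<lambda>n. e (Suc n)))"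
    using assms by (intro dfn_conj dfn_mem dtm_var dtm_shift)
  then show "dfn (\<lambda>e. e 0 \<in> elts (hset {x \<in> elts (s (\<lambda>n. e (Suc n))). Q x (\<lambda>n. e (Suc n))}))"
    by simp
qed

lemma dtm_image [dfn_intro]:
  assumes "dtm s" "dtm (\<lambda>e. f (e 0) (\<lambda>n. e (Suc n)))"
  shows "dtm (\<lambda>e. hset ((\<lambda>x. f x e) ` elts (s e)))"
proof (rule dtm_ext)
  fix e :: "nat \<Rightarrow> hc" assume e: "\<forall>i. e i \<in> M"
  have f: "f x e \<in> M" if "x \<in> M" for x
    using dtm_closed[OF assms(2), of "case_nat x e"] that e by (simp split: nat.split)
  have s: "s e \<in> M" using assms(1) e by (auto simp: dtm_def)
  have "dfn (\<lambda>e. e 1 = f (e 0) (\<lambda>n. e (Suc (Suc n))))"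
  proof -
    \<comment> \<open>The graph of a term has its value at entry 0 and its argument at entry 1;
      Replacement wants them exchanged.\<close>
    define g where "g n = (case n of 0 \<Rightarrow> 1 | Suc n \<Rightarrow> (case n of 0 \<Rightarrow> 0 | Suc n \<Rightarrow> Suc (Suc n)))" for n :: nat
    have "dfn (\<lambda>e. (\<lambda>n. e (g n)) 0 = f ((\<lambda>n. e (g n)) 1) (\<lambda>m. (\<lambda>n. e (g n)) (Suc (Suc m))))"
      using assms(2) unfolding dtm_def
      by (rule_tac dfn_ren) (auto simp: inj_def g_def split: nat.splits)
    then show ?thesis by (simp add: g_def)
  qed
  from dfn_params[OF this, of e 2] e have d: "dfn (\<lambda>g. g 1 = f (g 0) e)"
    by simp
  obtain B where B: "B \<in> M" "\<forall>x\<in>elts (s e). \<exists>y\<in>elts B. y = f x e"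
  proof -
    have "\<exists>y\<in>M. \<forall>z\<in>M. z = f x e \<longleftrightarrow> z = y" if "x \<in> elts (s e)" for x
      using f[OF trans[OF that s]] by blast
    then show ?thesis using repl_M[of "s e" "\<lambda>x y. y = f x e", OF s d] that by blast
  qed
  \<comment> \<open>The set from \<open>ax_replacement\<close> only contains the values, so the
    image still has to be cut out of it.\<close>
  have "dfn (\<lambda>g. \<exists>x\<in>elts (s e). g 0 = f x e)"
    using d s by (rule_tac dfn_bex) (auto intro: dtm_const)
  from sep_M[OF B(1) this]
  have "hset {y \<in> elts B. \<exists>x\<in>elts (s e). y = f x e} \<in> M" .
  moreover have "{y \<in> elts B. \<exists>x\<in>elts (s e). y = f x e} = (\<lambda>x. f x e) ` elts (s e)"
    using B(2) by auto
  ultimately show "hset ((\<lambda>x. f x e) ` elts (s e)) \<in> M" by simp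
next
  define g where "g n = (case n of 0 \<Rightarrow> 1 | Suc n \<Rightarrow> (case n of 0 \<Rightarrow> 0 | Suc n \<Rightarrow> Suc (Suc n)))" for n :: nat
  have "dfn (\<lambda>e. (\<lambda>n. e (g n)) 0 = f ((\<lambda>n. e (g n)) 1) (\<lambda>m. (\<lambda>n. e (g n)) (Suc (Suc m))))"
    using assms(2) unfolding dtm_def
    by (rule_tac dfn_ren) (auto simp: inj_def g_def split: nat.splits)
  then have "dfn (\<lambda>e. \<exists>x\<in>elts (s (\<lambda>n. e (Suc n))). e 0 = f x (\<lambda>n. e (Suc n)))"
    using assms(1) by (intro dfn_bex dtm_shift) (auto simp: g_def)
  then show "dfn (\<lambda>e. e 0 \<in> elts (hset ((\<lambda>x. f x (\<lambda>n. e (Suc n))) ` elts (s (\<lambda>n. e (Suc n))))))"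
    by (rule dfn_cong) auto
qed

end

text \<open>Absolute between \<open>M\<close> and the universe, since all quantifiers are bounded by elements of \<open>x\<close>.\<close>

definition nat_like :: "hc \<Rightarrow> bool" where
  "nat_like x \<longleftrightarrow> (\<forall>y\<in>elts x. elts y \<subseteq> elts x) \<and>
     (\<forall>y\<in>elts (hins x x). y = hset {} \<or> (\<exists>z\<in>elts y. y = hins z z))"

text \<open>Since the condition covers \<open>x\<close> itself, \<open>x\<close> is empty or of the
  form \<open>hins z z\<close>, and \<open>z\<close> inherits the condition; well-foundedness does
  the rest.\<close>

lemma nat_like_iff: "nat_like x \<longleftrightarrow> x \<in> range ord_nat"
proof
  show "nat_like x \<Longrightarrow> x \<in> range ord_nat"
  proof (induction x rule: elts_induct)
    case (elts x)
    then consider "x = hset {}" | z where "z \<in> elts x" "x = hins z z"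
      unfolding nat_like_def by (metis elts_hins insertI1)
    then show ?case
    proof cases
      case 1
      then show ?thesis by (metis ord_nat.simps(1) rangeI)
    next
      case 2
      have "nat_like z"
        unfolding nat_like_def
      proof (intro conjI ballI subsetI)
        fix y u assume yu: "y \<in> elts z" "u \<in> elts y"
        then have "y \<in> elts x" using 2 by auto
        then have "u \<in> elts x" using yu elts.prems unfolding nat_like_def by blast
        moreover have "u \<noteq> z" using yu elts_asym by blast
        ultimately show "u \<in> elts z" using 2(2) by (metis elts_hins insertE)
      next
        fix y assume "y \<in> elts (hins z z)"
        then have "y \<in> elts (hins x x)" using 2 by auto
        then show "y = hset {} \<or> (\<exists>w\<in>elts y. y = hins w w)"
          using elts.prems unfolding nat_like_def by blast
      qed
      then obtain n where "z = ord_nat n" using elts.IH 2 by blast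
      then show ?thesis using 2(2) ord_nat_Suc by (metis rangeI)
    qed
  qed
  have "ord_nat m = hset {} \<or> (\<exists>z\<in>elts (ord_nat m). ord_nat m = hins z z)" for m
  proof (cases m)
    case (Suc k)
    then show ?thesis by (metis elts_hins insertI1 ord_nat_Suc)
  qed simp
  moreover have "y \<in> elts (hins (ord_nat n) (ord_nat n)) \<Longrightarrow> y \<in> range ord_nat" for y n
    by (auto simp: elts_ord_nat)
  moreover have "\<forall>y\<in>elts (ord_nat n). elts y \<subseteq> elts (ord_nat n)" for n
    by (auto simp: elts_ord_nat)
  ultimately show "x \<in> range ord_nat \<Longrightarrow> nat_like x"
    unfolding nat_like_def by blast
qed

definition omega :: hc where "omega = hset (range ord_nat)"

lemma elts_omega [simp]: "elts omega = range ord_nat"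
  by (simp add: omega_def)

section \<open>Closure of \<open>M\<close> under the basic operations of set theory\<close>

context ctm begin

lemma empty_M: "hset {} \<in> M"
proof -
  obtain A where "A \<in> M" using M_ne by auto
  from sep_M[OF this dfn_const[of False]] show ?thesis by simp
qed

lemma pair_M: assumes "a \<in> M" "b \<in> M" shows "hset {a, b} \<in> M"
proof -
  have "M \<Turnstile> ax_pairing" by (intro ax) (simp add: ZFC_def)
  then have "sat M (\<lambda>_. a) ax_pairing" unfolding models_def using assms by auto
  then have "\<forall>a\<in>M. \<forall>b\<in>M. \<exists>c\<in>M. \<forall>x\<in>M. x \<in> elts c \<longleftrightarrow> x = a \<or> x = b"
    unfolding ax_pairing_def by (simp only: sat_Iff sat_Exi sat.simps(5)) simp
  then obtain c where c: "c \<in> M" "\<forall>x\<in>M. x \<in> elts c \<longleftrightarrow> x = a \<or> x = b" using assms by blast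
  then have "elts c = {a, b}" using trans assms by blast
  then show ?thesis using c(1) by (metis hset_elts)
qed

lemma Union_M: assumes "a \<in> M" shows "hUnion a \<in> M"
proof -
  have "M \<Turnstile> ax_union" by (intro ax) (simp add: ZFC_def)
  then have "sat M (\<lambda>_. a) ax_union" unfolding models_def using assms by auto
  then have "\<forall>a\<in>M. \<exists>c\<in>M. \<forall>x\<in>M. x \<in> elts c \<longleftrightarrow> (\<exists>y\<in>M. y \<in> elts a \<and> x \<in> elts y)"
    unfolding ax_union_def by (simp only: sat_Iff sat_Exi sat.simps(5)) simp
  then obtain c where c: "c \<in> M" "\<forall>x\<in>M. x \<in> elts c \<longleftrightarrow> (\<exists>y\<in>M. y \<in> elts a \<and> x \<in> elts y)"
    using assms by blast
  then have "elts c = \<Union> (elts ` elts a)" using trans assms by blast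
  then show ?thesis using c(1) by (metis hset_elts hUnion_def)
qed

definition PM :: "hc \<Rightarrow> hc" where "PM a = hset {x \<in> M. elts x \<subseteq> elts a}"

lemma elts_PM [simp]: "elts (PM a) = {x \<in> M. elts x \<subseteq> elts a}"
  by (simp add: PM_def)

lemma PM_M: assumes "a \<in> M" shows "PM a \<in> M"
proof -
  have "M \<Turnstile> ax_powerset" by (intro ax) (simp add: ZFC_def)
  then have "sat M (\<lambda>_. a) ax_powerset" unfolding models_def using assms by auto
  then have "\<forall>a\<in>M. \<exists>c\<in>M. \<forall>x\<in>M. x \<in> elts c \<longleftrightarrow> (\<forall>y\<in>M. y \<in> elts x \<longrightarrow> y \<in> elts a)"
    unfolding ax_powerset_def by (simp only: sat_Iff sat_Imp sat_Exi sat.simps(5)) simp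
  then obtain c where c: "c \<in> M" "\<forall>x\<in>M. x \<in> elts c \<longleftrightarrow> (\<forall>y\<in>M. y \<in> elts x \<longrightarrow> y \<in> elts a)"
    using assms by blast
  then have "elts c = {x \<in> M. elts x \<subseteq> elts a}" using trans assms by blast
  then show ?thesis using c(1) by (metis hset_elts PM_def)
qed

lemma dtm_pair [dfn_intro]: "dtm t \<Longrightarrow> dtm s \<Longrightarrow> dtm (\<lambda>e. hset {t e, s e})"
proof (rule dtm_ext)
  assume ts: "dtm t" "dtm s"
  show "hset {t e, s e} \<in> M" if "\<forall>i. e i \<in> M" for e
    using ts that by (intro pair_M) (auto simp: dtm_def)
  have "dfn (\<lambda>e. e 0 = t (\<lambda>n. e (Suc n)) \<or> e 0 = s (\<lambda>n. e (Suc n)))"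
    using ts by (intro dfn_intro dtm_shift)
  then show "dfn (\<lambda>e. e 0 \<in> elts (hset {t (\<lambda>n. e (Suc n)), s (\<lambda>n. e (Suc n))}))" by simp
qed

lemma dtm_sing [dfn_intro]: "dtm t \<Longrightarrow> dtm (\<lambda>e. hset {t e})"
  using dtm_pair[of t t] by simp

lemma dtm_opair [dfn_intro]: "dtm t \<Longrightarrow> dtm s \<Longrightarrow> dtm (\<lambda>e. opair (t e) (s e))"
  unfolding opair_def by (intro dfn_intro)

lemma dtm_Union [dfn_intro]: assumes "dtm t" shows "dtm (\<lambda>e. hUnion (t e))"
proof (rule dtm_ext)
  show "hUnion (t e) \<in> M" if "\<forall>i. e i \<in> M" for e
    using assms that by (intro Union_M) (auto simp: dtm_def)
  have "dfn (\<lambda>e. \<exists>y\<in>elts (t (\<lambda>n. e (Suc n))). e 0 \<in> elts y)"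
    using assms by (intro dfn_intro dtm_shift)
  then show "dfn (\<lambda>e. e 0 \<in> elts (hUnion (t (\<lambda>n. e (Suc n)))))" by simp
qed

lemma dtm_hins [dfn_intro]: assumes "dtm t" "dtm s" shows "dtm (\<lambda>e. hins (t e) (s e))"
proof -
  have "dtm (\<lambda>e. hUnion (hset {s e, hset {t e}}))"
    using assms by (intro dfn_intro)
  moreover have "hUnion (hset {s e, hset {t e}}) = hins (t e) (s e)" for e
    by (rule hc_ext) auto
  ultimately show ?thesis by simp
qed

lemma dtm_PM [dfn_intro]: assumes "dtm t" shows "dtm (\<lambda>e. PM (t e))"
proof (rule dtm_ext)
  show "PM (t e) \<in> M" if "\<forall>i. e i \<in> M" for e
    using assms that by (intro PM_M) (auto simp: dtm_def)
  have "dfn (\<lambda>e. elts (e 0) \<subseteq> elts (t (\<lambda>n. e (Suc n))))"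
    using assms by (intro dfn_intro dtm_shift)
  then show "dfn (\<lambda>e. e 0 \<in> elts (PM (t (\<lambda>n. e (Suc n)))))"
    by (rule dfn_cong) auto
qed

lemma dtm_empty [dfn_intro]: "dtm (\<lambda>e. hset {})"
  by (rule dtm_const[OF empty_M])

lemma dtm_hfst [dfn_intro]: "dtm t \<Longrightarrow> dtm (\<lambda>e. hfst (t e))"
  by (erule dtm_subst1[rotated]) (unfold hfst_def, intro dfn_intro)

lemma dtm_hsnd [dfn_intro]: "dtm t \<Longrightarrow> dtm (\<lambda>e. hsnd (t e))"
  by (erule dtm_subst1[rotated]) (unfold hsnd_def, intro dfn_intro)

lemma dtm_app [dfn_intro]: "dtm t \<Longrightarrow> dtm s \<Longrightarrow> dtm (\<lambda>e. app (t e) (s e))"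
  by (rule dtm_subst2) (unfold app_def, intro dfn_intro)

lemma dtm_restr [dfn_intro]: "dtm t \<Longrightarrow> dtm s \<Longrightarrow> dtm (\<lambda>e. restr (t e) (s e))"
  by (rule dtm_subst2) (unfold restr_def, intro dfn_intro)

lemma dfn_nat_like [dfn_intro]: "dtm t \<Longrightarrow> dfn (\<lambda>e. nat_like (t e))"
  by (erule dfn_subst1[rotated]) (unfold nat_like_def, intro dfn_intro)

lemma opair_M: "a \<in> M \<Longrightarrow> b \<in> M \<Longrightarrow> opair a b \<in> M"
proof -
  assume ab: "a \<in> M" "b \<in> M"
  have "hset {a} \<in> M" using pair_M[OF ab(1,1)] by simp
  from pair_M[OF this pair_M[OF ab]] show "opair a b \<in> M" by (simp only: opair_def)
qed

lemma opair_MD: "opair a b \<in> M \<Longrightarrow> a \<in> M \<and> b \<in> M"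
proof -
  assume "opair a b \<in> M"
  then have "hset {a, b} \<in> M" using trans[of "hset {a, b}" "opair a b"] by simp
  then show ?thesis using trans[of _ "hset {a, b}"] by simp
qed

lemma hins_M: "a \<in> M \<Longrightarrow> b \<in> M \<Longrightarrow> hins a b \<in> M"
  using dtm_closed[OF dtm_hins[OF dtm_var[of 0] dtm_var[of 1]], of "case_nat a (\<lambda>_. b)"]
  by (auto split: nat.splits)

lemma finite_M: "finite A \<Longrightarrow> A \<subseteq> M \<Longrightarrow> hset A \<in> M"
proof (induction rule: finite_induct)
  case (insert x F)
  then have "hins x (hset F) \<in> M" by (intro hins_M) auto
  then show ?case using insert by (simp add: hins_def countable_finite)
qed (simp add: empty_M)

lemma ord_nat_M [simp]: "ord_nat n \<in> M"
  by (induction n) (simp_all add: empty_M ord_nat_Suc hins_M del: ord_nat.simps(2))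

text \<open>The axiom gives some inductive set; the bounded formula \<open>nat_like\<close>
  separates the numbers from it.\<close>

lemma omega_M [simp]: "omega \<in> M"
proof -
  have "M \<Turnstile> ax_infinity" by (intro ax) (simp add: ZFC_def)
  moreover obtain a where "a \<in> M" using M_ne by auto
  ultimately have "sat M (\<lambda>_. a) ax_infinity" unfolding models_def by auto
  then have "\<exists>A\<in>M. (\<exists>x\<in>M. x \<in> elts A \<and> (\<forall>y\<in>M. y \<notin> elts x)) \<and>
      (\<forall>x\<in>M. x \<in> elts A \<longrightarrow> (\<exists>z\<in>M. z \<in> elts A \<and>
        (\<forall>y\<in>M. (y \<in> elts z \<longrightarrow> y \<in> elts x \<or> y = x) \<and> (y \<notin> elts x \<and> y \<noteq> x \<or> y \<in> elts z))))"
    unfolding ax_infinity_def by simp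
  then obtain A where A: "A \<in> M" "\<exists>x\<in>M. x \<in> elts A \<and> (\<forall>y\<in>M. y \<notin> elts x)"
    "\<And>x. x \<in> M \<Longrightarrow> x \<in> elts A \<Longrightarrow> \<exists>z\<in>M. z \<in> elts A \<and>
        (\<forall>y\<in>M. (y \<in> elts z \<longrightarrow> y \<in> elts x \<or> y = x) \<and> (y \<notin> elts x \<and> y \<noteq> x \<or> y \<in> elts z))"
    by blast
  have "ord_nat n \<in> elts A" for n
  proof (induction n)
    case 0
    obtain x where x: "x \<in> M" "x \<in> elts A" "\<forall>y\<in>M. y \<notin> elts x" using A(2) by blast
    then have "elts x = {}" using trans by blast
    then show ?case using x(2) by (metis hset_elts ord_nat.simps(1))
  next
    case (Suc n)
    obtain z where z: "z \<in> M" "z \<in> elts A" "\<forall>y\<in>M. y \<in> elts z \<longleftrightarrow> y \<in> elts (ord_nat n) \<or> y = ord_nat n"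
      using A(3)[OF _ Suc] ord_nat_M by metis
    then have "elts z = insert (ord_nat n) (elts (ord_nat n))"
      using trans ord_nat_M by blast
    then show ?case using z(2) by (metis hset_elts ord_nat.simps(2))
  qed
  then have "{x \<in> elts A. nat_like x} = range ord_nat" by (auto simp: nat_like_iff)
  moreover have "hset {x \<in> elts A. nat_like x} \<in> M"
    by (rule sep_M[OF A(1)]) (intro dfn_intro)
  ultimately show ?thesis by (simp add: omega_def)
qed

lemma dtm_omega [dfn_intro]: "dtm (\<lambda>e. omega)"
  by (rule dtm_const) simp

text \<open>Minimality is tested against elements of \<open>M\<close> only, which makes this
  expressible over \<open>M\<close>; it determines \<open>tc x\<close> once that is known to lie in
  \<open>M\<close>.\<close>

definition is_tc :: "hc \<Rightarrow> hc \<Rightarrow> bool" where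
  "is_tc x y \<longleftrightarrow> (\<forall>u\<in>elts y. elts u \<subseteq> elts y) \<and> elts x \<subseteq> elts y \<and>
     (\<forall>z\<in>M. (\<forall>u\<in>elts z. elts u \<subseteq> elts z) \<and> elts x \<subseteq> elts z \<longrightarrow> elts y \<subseteq> elts z)"

lemma is_tc_iff: "tc x \<in> M \<Longrightarrow> y \<in> M \<Longrightarrow> is_tc x y \<longleftrightarrow> y = tc x"
proof
  assume m: "tc x \<in> M" "y \<in> M"
  have "elts (tc x) \<subseteq> elts z" if "\<forall>u\<in>elts z. elts u \<subseteq> elts z" "elts x \<subseteq> elts z" for z
    by (rule tc_min) (use that in blast)+
  moreover have t: "\<forall>u\<in>elts (tc x). elts u \<subseteq> elts (tc x)" "elts x \<subseteq> elts (tc x)"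
    using tc_elts elts_sub_tc by blast+
  ultimately show "y = tc x \<Longrightarrow> is_tc x y" unfolding is_tc_def by auto
  assume "is_tc x y"
  then have "elts y \<subseteq> elts (tc x)" "elts (tc x) \<subseteq> elts y"
    using t m(1) tc_min[of y x] unfolding is_tc_def by (blast, blast)
  then show "y = tc x" by (auto intro: hc_ext)
qed

lemma dfn_is_tc: "dfn (\<lambda>e. is_tc (e 0) (e 1))"
  unfolding is_tc_def by (intro dfn_intro)

text \<open>A local form of Replacement, for inductions along membership in which the values are
  known to lie in \<open>M\<close> only for the members of \<open>A\<close>.\<close>

lemma image_M:
  assumes "A \<in> M" "dfn (\<lambda>e. R (e 0) (e 1))" "\<And>x. x \<in> elts A \<Longrightarrow> f x \<in> M"
    "\<And>x y. x \<in> elts A \<Longrightarrow> y \<in> M \<Longrightarrow> R x y \<longleftrightarrow> y = f x"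
  shows "hset (f ` elts A) \<in> M"
proof -
  obtain B where B: "B \<in> M" "\<forall>x\<in>elts A. \<exists>y\<in>elts B. R x y"
    using repl_M[OF assms(1,2)] assms(3,4) by blast
  have "hset {y \<in> elts B. \<exists>x\<in>elts A. R x y} \<in> M"
    using assms(1) by (intro sep_M B(1) dfn_bex dtm_const dfn_subst2[OF assms(2)] dtm_var)
  moreover have "{y \<in> elts B. \<exists>x\<in>elts A. R x y} = f ` elts A"
    using B assms(4) trans by (auto simp: image_iff) (metis)+
  ultimately show ?thesis by simp
qed

lemma tc_M: "x \<in> M \<Longrightarrow> tc x \<in> M"
proof (induction x rule: elts_induct)
  case (elts x)
  have "hset (tc ` elts x) \<in> M"
  proof (rule image_M[OF elts.prems dfn_is_tc])
    fix u assume "u \<in> elts x"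
    then show *: "tc u \<in> M" using elts trans by blast
    fix y assume "y \<in> M" then show "is_tc u y \<longleftrightarrow> y = tc u" using * is_tc_iff by blast
  qed
  then have "hUnion (hset {x, hUnion (hset (tc ` elts x))}) \<in> M"
    using elts.prems by (intro Union_M pair_M)
  moreover have "hUnion (hset {x, hUnion (hset (tc ` elts x))}) = tc x"
    by (rule hc_ext) (subst elts_tc[of x], auto)
  ultimately show ?case by simp
qed

lemma dtm_tc [dfn_intro]: assumes "dtm t" shows "dtm (\<lambda>e. tc (t e))"
proof (rule dtm_subst1[OF _ assms])
  have "dfn (\<lambda>e. e 0 = tc (e 1))"
    by (rule dfn_cong[OF dfn_subst2[OF dfn_is_tc dtm_var[of 1] dtm_var[of 0]]])
      (auto simp: is_tc_iff tc_M)
  then show "dtm (\<lambda>e. tc (e 0))"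
    by (auto simp: dtm_def tc_M)
qed

end

section \<open>Recursion, collection and countable choice inside \<open>M\<close>\<close>

lemma elts_trancl_induct [case_names step]:
  "(\<And>x. (\<And>y. y \<in> elts (tc x) \<Longrightarrow> P y) \<Longrightarrow> P x) \<Longrightarrow> P x"
  using wf_induct_rule[OF wf_trancl[OF wf_elts_rel], of P] by (auto simp: elts_tc')

context ctm begin

lemma dtm_M1: "dtm (\<lambda>e. f (e 0)) \<Longrightarrow> x \<in> M \<Longrightarrow> f x \<in> M"
  by (drule dtm_closed[of _ "\<lambda>_. x"]) auto

lemma dtm_M2: "dtm (\<lambda>e. f (e 0) (e 1)) \<Longrightarrow> x \<in> M \<Longrightarrow> y \<in> M \<Longrightarrow> f x y \<in> M"
  by (drule dtm_closed[of _ "case_nat x (\<lambda>_. y)"]) (auto split: nat.split)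

text \<open>The approximations of the recursion theorem: functions on \<open>u\<close> and
  \<open>tc u\<close> that obey the recursion. All quantifiers are bounded, so \<open>M\<close>
  recognizes them, and by \<open>attempt_iff\<close> there is exactly one.\<close>

definition attempt :: "(hc \<Rightarrow> hc \<Rightarrow> hc) \<Rightarrow> hc \<Rightarrow> hc \<Rightarrow> bool" where
  "attempt G u g \<longleftrightarrow> (\<forall>p\<in>elts g. p = opair (hfst p) (hsnd p) \<and> hsnd p = G (hfst p) (restr g (tc (hfst p))))
     \<and> (\<forall>v\<in>elts (hins u (tc u)). \<exists>p\<in>elts g. hfst p = v) \<and> (\<forall>p\<in>elts g. hfst p \<in> elts (hins u (tc u)))"

lemma attempt_iff: "attempt G u g \<longleftrightarrow> g = gr (hrec G) (hins u (tc u))"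
proof
  let ?F = "hrec G"
  have sub: "elts (tc v) \<subseteq> elts (hins u (tc u))" if "v \<in> elts (hins u (tc u))" for v
    using that tc_trans by auto
  have "attempt G u (gr ?F (hins u (tc u)))"
    unfolding attempt_def
  proof (intro conjI ballI)
    fix p assume "p \<in> elts (gr ?F (hins u (tc u)))"
    then obtain v where v: "v \<in> elts (hins u (tc u))" "p = opair v (?F v)" by auto
    then show "p = opair (hfst p) (hsnd p)" by simp
    have "restr (gr ?F (hins u (tc u))) (tc v) = gr ?F (tc v)"
      by (rule hc_ext) (use sub[OF v(1)] in \<open>auto simp del: elts_hins\<close>)
    then show "hsnd p = G (hfst p) (restr (gr ?F (hins u (tc u))) (tc (hfst p)))"
      using hrec[of G v] v(2) by simp
  qed (auto simp del: elts_hins)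
  then show "g = gr ?F (hins u (tc u)) \<Longrightarrow> attempt G u g" by simp
  assume g: "attempt G u g"
  have *: "v \<in> elts (hins u (tc u)) \<Longrightarrow> opair v w \<in> elts g \<Longrightarrow> w = ?F v" for v w
  proof (induction v arbitrary: w rule: elts_trancl_induct)
    case (step v)
    have "restr g (tc v) = gr ?F (tc v)"
    proof (rule hc_ext, safe)
      fix p assume p: "p \<in> elts (restr g (tc v))"
      then have "p = opair (hfst p) (hsnd p)" "hfst p \<in> elts (tc v)" "p \<in> elts g"
        using g unfolding attempt_def by auto
      then show "p \<in> elts (gr ?F (tc v))"
        using step.IH[of "hfst p" "hsnd p"] sub[OF step.prems(1)] by auto
    next
      fix p assume "p \<in> elts (gr ?F (tc v))"
      then obtain y where y: "y \<in> elts (tc v)" "p = opair y (?F y)" by auto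
      then have y': "y \<in> elts (hins u (tc u))" using sub[OF step.prems(1)] by blast
      then obtain q where q: "q \<in> elts g" "hfst q = y" using g unfolding attempt_def by blast
      then have "q = opair y (hsnd q)" using g unfolding attempt_def by metis
      then show "p \<in> elts (restr g (tc v))"
        using step.IH[OF y(1) y', of "hsnd q"] q y by auto
    qed
    then show ?case using step.prems g hrec[of G v] unfolding attempt_def by fastforce
  qed
  show "g = gr ?F (hins u (tc u))"
  proof (rule hc_ext, safe)
    fix p assume "p \<in> elts g"
    moreover from this have "p = opair (hfst p) (hsnd p)" "hfst p \<in> elts (hins u (tc u))"
      using g unfolding attempt_def by blast+
    ultimately show "p \<in> elts (gr ?F (hins u (tc u)))"
      using *[of "hfst p" "hsnd p"] by (metis elts_gr imageI)
  next
    fix p assume "p \<in> elts (gr ?F (hins u (tc u)))"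
    then obtain y where y: "y \<in> elts (hins u (tc u))" "p = opair y (?F y)" by (auto simp del: elts_hins)
    then obtain q where q: "q \<in> elts g" "hfst q = y" using g unfolding attempt_def by blast
    then have "q = opair y (hsnd q)" using g unfolding attempt_def by metis
    then show "p \<in> elts g" using *[OF y(1), of "hsnd q"] q y by auto
  qed
qed

lemma dfn_attempt:
  assumes "dtm (\<lambda>e. G (e 0) (e 1))" shows "dfn (\<lambda>e. attempt G (e 0) (e 1))"
  unfolding attempt_def by (intro dfn_intro dtm_subst2[OF assms])

lemma gr_M:
  assumes "dtm (\<lambda>e. f (e 0))" "A \<in> M" shows "gr f A \<in> M"
proof -
  have "dtm (\<lambda>e. hset ((\<lambda>u. opair u (f u)) ` elts (e 0)))"
    by (intro dfn_intro dtm_subst1[OF assms(1)])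
  then show ?thesis unfolding gr_def by (rule dtm_M1) fact
qed

text \<open>The approximations at the members of \<open>x\<close> form a set by Replacement; their
  union is the graph on \<open>tc x\<close>, to which the value at \<open>x\<close> is
  added.\<close>

lemma hrec_M':
  assumes "dtm (\<lambda>e. G (e 0) (e 1))" "x \<in> M"
  shows "gr (hrec G) (hins x (tc x)) \<in> M"
  using assms(2)
proof (induction x rule: elts_induct)
  case (elts x)
  let ?F = "hrec G"
  let ?f = "\<lambda>u. gr ?F (hins u (tc u))"
  have m: "hset (?f ` elts x) \<in> M"
    by (rule image_M[OF elts.prems dfn_attempt[OF assms(1)]])
      (use elts trans in \<open>auto simp: attempt_iff\<close>)
  have "hUnion (hset (?f ` elts x)) = gr ?F (tc x)"
    by (rule hc_ext) (auto simp: elts_tc[of x] simp del: elts_opair)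
  with Union_M[OF m] have g: "gr ?F (tc x) \<in> M" by simp
  then have "?F x \<in> M" by (subst hrec) (rule dtm_M2[OF assms(1) elts.prems])
  then have "hins (opair x (?F x)) (gr ?F (tc x)) \<in> M"
    using g elts.prems by (intro hins_M opair_M)
  moreover have "hins (opair x (?F x)) (gr ?F (tc x)) = ?f x"
    by (rule hc_ext) (simp del: elts_opair)
  ultimately show ?case by simp
qed

text \<open>The value is read off from the approximation, which is unique and belongs to
  \<open>M\<close>: the recursion theorem for \<open>M\<close>.\<close>

lemma dtm_hrec:
  assumes "dtm (\<lambda>e. G (e 0) (e 1))" "dtm t" shows "dtm (\<lambda>e. hrec G (t e))"
proof (rule dtm_subst1[OF _ assms(2)])
  let ?F = "hrec G"
  have in_gr: "opair x (?F x) \<in> elts (gr ?F (hins x (tc x)))" for x by (simp del: elts_opair)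
  have F: "?F x \<in> M" if "x \<in> M" for x
    using in_gr trans[OF _ hrec_M'[OF assms(1) that]] opair_MD by blast
  have "dfn (\<lambda>e. \<exists>g\<in>M. attempt G (e 1) g \<and> opair (e 1) (e 0) \<in> elts g)"
    by (intro dfn_intro dfn_subst2[OF dfn_attempt[OF assms(1)]])
  then have "dfn (\<lambda>e. e 0 = ?F (e 1))"
    by (rule dfn_cong) (use in_gr hrec_M'[OF assms(1)] in \<open>auto simp: attempt_iff simp del: elts_opair\<close>)
  then show "dtm (\<lambda>e. ?F (e 0))"
    using F by (simp add: dtm_def)
qed

text \<open>\<open>VM x\<close> is the level of the cumulative hierarchy of \<open>M\<close> at the rank of \<open>x\<close>.\<close>

definition VM :: "hc \<Rightarrow> hc" where
  "VM = hrec (\<lambda>x f. hUnion (hset ((\<lambda>u. PM (app f u)) ` elts x)))"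

lemma dtm_VM [dfn_intro]: "dtm t \<Longrightarrow> dtm (\<lambda>e. VM (t e))"
  unfolding VM_def by (rule dtm_hrec) (intro dfn_intro)

lemma elts_VM: "elts (VM x) = (\<Union>u\<in>elts x. {y \<in> M. elts y \<subseteq> elts (VM u)})"
  unfolding VM_def
  by (subst hrec) (auto simp: elts_sub_tc)

lemma VM_elts: "x \<in> M \<Longrightarrow> elts x \<subseteq> elts (VM x)"
proof (induction x rule: elts_induct)
  case (elts x)
  show ?case
  proof
    fix u assume "u \<in> elts x"
    then show "u \<in> elts (VM x)" using elts trans by (subst elts_VM) blast
  qed
qed

text \<open>Levels are compared as ranks are; a double induction on membership takes the place of
  the linear order of the ordinals.\<close>

lemma VM_linear: "elts (VM x) \<subseteq> elts (VM y) \<or> (\<exists>u\<in>elts x. elts (VM y) \<subseteq> elts (VM u))"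
proof -
  let ?L = "\<lambda>x y. elts (VM x) \<subseteq> elts (VM y) \<or> (\<exists>u\<in>elts x. elts (VM y) \<subseteq> elts (VM u))"
  have step: "?L x y" if "\<And>u. u \<in> elts x \<Longrightarrow> ?L y u" for x y
  proof (rule ccontr)
    assume n: "\<not> ?L x y"
    then have "\<exists>v\<in>elts y. elts (VM u) \<subseteq> elts (VM v)" if "u \<in> elts x" for u
      using that \<open>\<And>u. u \<in> elts x \<Longrightarrow> ?L y u\<close>[OF that] by blast
    then have "elts (VM x) \<subseteq> elts (VM y)"
    proof (intro subsetI)
      fix w assume "w \<in> elts (VM x)"
      then obtain u where u: "u \<in> elts x" "w \<in> M" "elts w \<subseteq> elts (VM u)"
        unfolding elts_VM[of x] by blast
      then obtain v where "v \<in> elts y" "elts (VM u) \<subseteq> elts (VM v)"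
        using \<open>\<And>u. u \<in> elts x \<Longrightarrow> \<exists>v\<in>elts y. elts (VM u) \<subseteq> elts (VM v)\<close> by blast
      with u show "w \<in> elts (VM y)" unfolding elts_VM[of y] by blast
    qed
    with n show False by blast
  qed
  have "\<forall>y. ?L x y \<and> ?L y x"
  proof (induction x rule: elts_induct)
    case (elts x)
    have 1: "?L x y" for y using elts step by blast
    have "?L y x" for y
    proof (induction y rule: elts_induct)
      case (elts y)
      show ?case by (rule step) (rule 1)
    qed
    with 1 show ?case by blast
  qed
  then show ?thesis by blast
qed

text \<open>Scott's trick: the least level of the hierarchy that contains a witness is unique, so
  Replacement applies to it.\<close>

lemma collection:
  assumes "A \<in> M" "dfn (\<lambda>e. R (e 0) (e 1))" "\<And>x. x \<in> elts A \<Longrightarrow> \<exists>y\<in>M. R x y"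
  shows "\<exists>B\<in>M. \<forall>x\<in>elts A. \<exists>y\<in>elts B. R x y"
proof -
  define S where "S x v \<longleftrightarrow> (\<exists>z\<in>M. v = VM z) \<and> (\<exists>y\<in>elts v. R x y) \<and>
    (\<forall>z\<in>M. (\<exists>y\<in>elts (VM z). R x y) \<longrightarrow> elts v \<subseteq> elts (VM z))" for x v
  have "dfn (\<lambda>e. S (e 0) (e 1))"
    unfolding S_def by (intro dfn_intro dfn_subst2[OF assms(2)])
  moreover have "\<exists>v\<in>M. \<forall>w\<in>M. S x w \<longleftrightarrow> w = v" if x: "x \<in> elts A" for x
  proof -
    obtain y where y: "y \<in> M" "R x y" using assms(3)[OF x] by blast
    then have "y \<in> elts (VM (hset {y}))" using VM_elts[of "hset {y}"] pair_M[of y y] by auto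
    then have "\<exists>z. z \<in> M \<and> (\<exists>y\<in>elts (VM z). R x y)" using y pair_M[of y y] by auto
    then obtain z where z: "z \<in> M" "\<exists>y\<in>elts (VM z). R x y"
      and min: "\<And>u. u \<in> elts z \<Longrightarrow> \<not> (u \<in> M \<and> (\<exists>y\<in>elts (VM u). R x y))"
      using wfE_min[OF wf_elts_rel, of _ "{z. z \<in> M \<and> (\<exists>y\<in>elts (VM z). R x y)}"]
      unfolding elts_rel_def by auto metis
    have "elts (VM z) \<subseteq> elts (VM z')" if "z' \<in> M" "\<exists>y\<in>elts (VM z'). R x y" for z'
      using VM_linear[of z z'] min that z(1) trans by blast
    then have "S x (VM z)" using z unfolding S_def by blast
    moreover have "w = VM z" if "S x w" for w
      using that \<open>S x (VM z)\<close> unfolding S_def by (metis hc_ext subset_antisym)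
    moreover have "VM z \<in> M" by (rule dtm_M1[of VM]) (intro dfn_intro, rule z(1))
    ultimately show ?thesis by blast
  qed
  ultimately obtain C where C: "C \<in> M" "\<forall>x\<in>elts A. \<exists>v\<in>elts C. S x v"
    using repl_M[of A S] assms(1) by blast
  have "\<exists>y\<in>elts (hUnion C). R x y" if "x \<in> elts A" for x
    using C(2) that unfolding S_def by (auto) (meson)
  then show ?thesis using Union_M[OF C(1)] by blast
qed

text \<open>Collection bounds the witnesses. Tagging those for \<open>n\<close> with
  \<open>n\<close> makes the sets \<open>b n\<close> disjoint, and the transversal from
  \<open>ax_choice\<close>, cut down to their union, is the graph of the sequence.\<close>

lemma choice_M:
  assumes R: "dfn (\<lambda>e. R (e 0) (e 1))" and ex: "\<And>n. \<exists>y\<in>M. R (ord_nat n) y"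
  shows "\<exists>f. (\<forall>n. f n \<in> M \<and> R (ord_nat n) (f n)) \<and> hseq f \<in> M"
proof -
  obtain B where B: "B \<in> M" "\<forall>x\<in>elts omega. \<exists>y\<in>elts B. R x y"
    using collection[OF omega_M R] ex by auto
  define b where "b n = hset ((\<lambda>y. opair n y) ` elts (hset {y \<in> elts B. R n y}))" for n
  have b: "elts (b n) = {opair n y | y. y \<in> elts B \<and> R n y}" for n
    by (auto simp: b_def elts_sep simp del: elts_opair)
  define F where "F = hset (b ` elts omega)"
  have "dtm (\<lambda>e. F)" unfolding F_def b_def
    by (intro dfn_intro dfn_subst2[OF R] dtm_const B(1))
  then have FM: "F \<in> M" by (rule dtm_closed[of _ "\<lambda>_. B"]) (rule B(1))
  have F: "elts F = range (\<lambda>n. b (ord_nat n))" by (auto simp: F_def)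
  have "M \<Turnstile> ax_choice" by (intro ax) (simp add: ZFC_def)
  then have "sat M (\<lambda>_. F) ax_choice" unfolding models_def using FM by auto
  then have "\<forall>a\<in>M. (\<forall>x\<in>M. x \<in> elts a \<longrightarrow> (\<exists>y\<in>M. y \<in> elts x)) \<and>
      (\<forall>x\<in>M. \<forall>y\<in>M. y \<in> elts a \<longrightarrow> x \<in> elts a \<longrightarrow> (\<forall>z\<in>M. z \<in> elts x \<longrightarrow> z \<notin> elts y) \<or> x = y)
      \<longrightarrow> (\<exists>c\<in>M. \<forall>x\<in>M. x \<in> elts a \<longrightarrow> (\<exists>y\<in>M. \<forall>z\<in>M. z \<in> elts c \<and> z \<in> elts x \<longleftrightarrow> z = y))"
    unfolding ax_choice_def by (simp only: sat_Iff sat_Imp sat_Exi sat.simps(5)) (simp cong: conj_cong)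
  from bspec[OF this FM] have "(\<forall>x\<in>M. x \<in> elts F \<longrightarrow> (\<exists>y\<in>M. y \<in> elts x)) \<and>
      (\<forall>x\<in>M. \<forall>y\<in>M. y \<in> elts F \<longrightarrow> x \<in> elts F \<longrightarrow> (\<forall>z\<in>M. z \<in> elts x \<longrightarrow> z \<notin> elts y) \<or> x = y)
      \<longrightarrow> (\<exists>c\<in>M. \<forall>x\<in>M. x \<in> elts F \<longrightarrow> (\<exists>y\<in>M. \<forall>z\<in>M. z \<in> elts c \<and> z \<in> elts x \<longleftrightarrow> z = y))"
    .
  moreover have "\<exists>y\<in>M. y \<in> elts x" if xF: "x \<in> elts F" for x
  proof -
    obtain n where n: "x = b (ord_nat n)" using xF F by auto
    obtain y where "y \<in> elts B" "R (ord_nat n) y" using B(2) by auto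
    then have "opair (ord_nat n) y \<in> elts x" unfolding n b by blast
    then show ?thesis using trans[OF _ trans[OF xF FM]] by blast
  qed
  moreover have "x = y" if "x \<in> elts F" "y \<in> elts F" "z \<in> elts x" "z \<in> elts y" for x y z
    using that unfolding F by (auto simp: b simp del: elts_opair)
  ultimately obtain c where c: "c \<in> M"
    "\<And>x. x \<in> M \<Longrightarrow> x \<in> elts F \<Longrightarrow> \<exists>y\<in>M. \<forall>z\<in>M. z \<in> elts c \<and> z \<in> elts x \<longleftrightarrow> z = y"
    by blast
  have "\<exists>y. y \<in> elts B \<and> R (ord_nat n) y \<and> (\<forall>z. z \<in> elts c \<and> z \<in> elts (b (ord_nat n)) \<longleftrightarrow> z = opair (ord_nat n) y)" for n
  proof -
    have bF: "b (ord_nat n) \<in> elts F" using F by auto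
    obtain y where y: "y \<in> M" "\<forall>z\<in>M. z \<in> elts c \<and> z \<in> elts (b (ord_nat n)) \<longleftrightarrow> z = y"
      using c(2)[OF trans[OF bF FM] bF] by blast
    then have "y \<in> elts (b (ord_nat n))" by blast
    then obtain w where "w \<in> elts B" "R (ord_nat n) w" "y = opair (ord_nat n) w" unfolding b by blast
    moreover have "z \<in> elts c \<and> z \<in> elts (b (ord_nat n)) \<longleftrightarrow> z = y" for z
      using y trans[OF _ c(1), of z] by blast
    ultimately show ?thesis by (intro exI[of _ w]) simp
  qed
  then obtain f where f: "\<And>n. f n \<in> elts B" "\<And>n. R (ord_nat n) (f n)"
    "\<And>n z. z \<in> elts c \<and> z \<in> elts (b (ord_nat n)) \<longleftrightarrow> z = opair (ord_nat n) (f n)"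
    by metis
  have "hset {z \<in> elts c. z \<in> elts (hUnion F)} \<in> M"
    by (rule sep_M[OF c(1)]) (intro dfn_intro dtm_const FM)
  moreover have "{z \<in> elts c. z \<in> elts (hUnion F)} = range (\<lambda>n. opair (ord_nat n) (f n))"
    unfolding elts_hUnion F using f(3) by blast
  ultimately have "hseq f \<in> M" by (simp add: hseq_def)
  then show ?thesis using f trans[OF _ B(1)] by blast
qed

lemma hseq_MD: "hseq f \<in> M \<Longrightarrow> f n \<in> M"
  by (rule conjunct2[OF opair_MD[of "ord_nat n"]], erule trans[rotated]) (simp del: elts_opair)

lemma hseq_M:
  assumes "dtm (\<lambda>e. F (e 0))" "\<And>n. F (ord_nat n) = f n" shows "hseq f \<in> M"
proof -
  have "gr F omega \<in> M" by (rule gr_M[OF assms(1)]) simp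
  moreover have "gr F omega = hseq f" by (rule hc_ext) (simp add: image_image assms(2) del: elts_opair)
  ultimately show ?thesis by simp
qed

lemma hseq_map_M:
  assumes "dtm (\<lambda>e. F (e 0))" "hseq g \<in> M" "\<And>n. F (g n) = f n" shows "hseq f \<in> M"
proof (rule hseq_M[of "\<lambda>x. F (app (hseq g) x)"])
  show "dtm (\<lambda>e. F (app (hseq g) (e 0)))"
    by (intro dtm_subst1[OF assms(1)] dfn_intro dtm_const assms(2))
qed (simp add: assms(3))

text \<open>Indices past \<open>N\<close> are replaced by \<open>N\<close>, so the sequence is
  determined by a finite function, which lies in \<open>M\<close> because its values do.\<close>

lemma hseq_eventually_const_M:
  assumes "\<And>n. f n \<in> M" "\<And>n. n \<ge> N \<Longrightarrow> f n = f N" shows "hseq f \<in> M"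
proof -
  have 1: "hset (f ` {..N}) \<in> M" using assms(1) by (intro finite_M) auto
  define g where "g = hset ((\<lambda>n. opair (ord_nat n) (f n)) ` {..N})"
  have eg: "elts g = (\<lambda>n. opair (ord_nat n) (f n)) ` {..N}" unfolding g_def by (simp add: countable_finite)
  have g: "g \<in> M" unfolding g_def using assms(1) by (intro finite_M) (auto intro!: opair_M)
  define F where "F x = app g (if x \<in> elts (ord_nat N) then x else ord_nat N)" for x
  have "dfn (\<lambda>e. (e 1 \<in> elts (ord_nat N) \<and> e 0 = app g (e 1)) \<or> (\<not> e 1 \<in> elts (ord_nat N) \<and> e 0 = app g (ord_nat N)))"
    by (intro dfn_intro dtm_const g ord_nat_M)
  then have "dfn (\<lambda>e. e 0 = F (e 1))" by (rule dfn_cong) (auto simp: F_def)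
  moreover have "app g x \<in> M" if "x \<in> M" for x
    by (rule dtm_M1[OF dtm_app[OF dtm_const[OF g] dtm_var] that])
  ultimately have "dtm (\<lambda>e. F (e 0))" by (auto simp: dtm_def F_def)
  moreover have "F (ord_nat n) = f n" for n
  proof -
    have a: "app g (ord_nat k) = f k" if "k \<le> N" for k
      by (rule app_eq) (use that in \<open>auto simp: eg simp del: elts_opair\<close>)
    show ?thesis using a[of n] a[of N] assms(2)[of n] by (auto simp: F_def)
  qed
  ultimately show ?thesis by (rule hseq_M)
qed

end

declare elts_opair [simp del] ord_nat.simps [simp del]

section \<open>Reals, strings and Borel codes in the model\<close>

lemma hbit_inj [simp]: "hbit a = hbit b \<longleftrightarrow> a = b"
  by (auto simp: hbit_def)

lemma elts_two: "elts (ord_nat 2) = range hbit"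
proof -
  have "{..<2::nat} = {0, 1}" by auto
  then show ?thesis by (auto simp: elts_ord_nat hbit_def UNIV_bool)
qed

lemma elts_hreal [simp]: "elts (hreal x) = range (\<lambda>n. opair (ord_nat n) (hbit (x n)))"
  by (simp add: hreal_def)

lemma elts_hstring [simp]: "elts (hstring s) = (\<lambda>i. opair (ord_nat i) (hbit (s ! i))) ` {..<length s}"
  by (simp add: hstring_def countable_finite)

lemma hreal_inj [simp]: "hreal x = hreal y \<longleftrightarrow> x = y"
  unfolding hreal_def by (auto simp: fun_eq_iff)

lemma inj_hreal [simp]: "inj_on hreal A"
  by (simp add: inj_on_def)

lemma hstring_sub_hreal: "elts (hstring s) \<subseteq> elts (hreal x) \<longleftrightarrow> x \<in> cyl s"
  by (auto simp: cyl_def image_subset_iff)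

lemma hstring_sub_hstring: "elts (hstring s) \<subseteq> elts (hstring t) \<longleftrightarrow> take (length s) t = s"
proof -
  have "elts (hstring s) \<subseteq> elts (hstring t) \<longleftrightarrow> (\<forall>i<length s. i < length t \<and> t ! i = s ! i)"
    by (auto simp: image_subset_iff)
  also have "\<dots> \<longleftrightarrow> take (length s) t = s"
  proof
    assume *: "\<forall>i<length s. i < length t \<and> t ! i = s ! i"
    then have "length s \<le> length t" by (meson less_irrefl linorder_le_less_linear)
    with * show "take (length s) t = s" by (intro nth_equalityI) auto
  next
    assume *: "take (length s) t = s"
    then have "length s \<le> length t" by (metis length_take min.cobounded1)
    with * show "\<forall>i<length s. i < length t \<and> t ! i = s ! i" by (metis nth_take order.strict_trans2)
  qed
  finally show ?thesis .
qed

lemma hstring_inj [simp]: "hstring s = hstring t \<longleftrightarrow> s = t"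
proof
  assume eq: "hstring s = hstring t"
  have st: "take (length s) t = s" unfolding hstring_sub_hstring[symmetric] eq ..
  have ts: "take (length t) s = t" unfolding hstring_sub_hstring[symmetric] eq ..
  have "length s = length t"
    using arg_cong[OF st, of length] arg_cong[OF ts, of length] by simp
  with st show "s = t" by simp
qed simp

lemma hreals_elts: "countable Y \<Longrightarrow> elts (hreals Y) = hreal ` Y"
  by (simp add: hreals_def)

text \<open>Functions from \<open>N\<close> to 2 in bounded form: reals for
  \<open>N = omega\<close>, strings for \<open>N\<close> a natural number.\<close>

definition fun2 :: "hc \<Rightarrow> hc \<Rightarrow> bool" where
  "fun2 N z \<longleftrightarrow> (\<forall>p\<in>elts z. \<exists>i\<in>elts N. \<exists>b\<in>elts (ord_nat 2). p = opair i b) \<and>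
     (\<forall>i\<in>elts N. \<exists>b\<in>elts (ord_nat 2). \<forall>c\<in>elts (ord_nat 2). opair i c \<in> elts z \<longleftrightarrow> c = b)"

lemma fun2_iff:
  assumes "elts N = ord_nat ` I"
  shows "fun2 N z \<longleftrightarrow> (\<exists>x. elts z = (\<lambda>i. opair (ord_nat i) (hbit (x i))) ` I)"
proof
  assume "fun2 N z"
  then have 1: "p \<in> elts z \<Longrightarrow> \<exists>i\<in>I. \<exists>b. p = opair (ord_nat i) (hbit b)"
    and 2: "i \<in> I \<Longrightarrow> \<exists>b\<in>range hbit. \<forall>c\<in>range hbit. opair (ord_nat i) c \<in> elts z \<longleftrightarrow> c = b" for p i
    unfolding fun2_def assms elts_two by blast+
  have "\<exists>b. \<forall>c. opair (ord_nat i) (hbit c) \<in> elts z \<longleftrightarrow> c = b" if iI: "i \<in> I" for i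
  proof -
    obtain b where "\<forall>c\<in>range hbit. opair (ord_nat i) c \<in> elts z \<longleftrightarrow> c = hbit b"
      using 2[OF iI] by blast
    then show ?thesis by (intro exI[of _ b]) simp
  qed
  then have "\<forall>i\<in>I. \<exists>b. \<forall>c. opair (ord_nat i) (hbit c) \<in> elts z \<longleftrightarrow> c = b" by simp
  from bchoice[OF this] obtain x
    where *: "\<forall>i\<in>I. \<forall>c. opair (ord_nat i) (hbit c) \<in> elts z \<longleftrightarrow> c = x i" by (elim exE)
  have x: "opair (ord_nat i) (hbit c) \<in> elts z \<longleftrightarrow> c = x i" if "i \<in> I" for i c
    using * that by simp
  have "elts z = (\<lambda>i. opair (ord_nat i) (hbit (x i))) ` I"
  proof (intro equalityI subsetI)
    fix p assume p: "p \<in> elts z"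
    from 1[OF p] obtain i b where "i \<in> I" "p = opair (ord_nat i) (hbit b)" by blast
    with x[of i b] p show "p \<in> (\<lambda>i. opair (ord_nat i) (hbit (x i))) ` I" by simp
  qed (use x in auto)
  then show "\<exists>x. elts z = (\<lambda>i. opair (ord_nat i) (hbit (x i))) ` I" by blast
next
  assume "\<exists>x. elts z = (\<lambda>i. opair (ord_nat i) (hbit (x i))) ` I"
  then obtain x where x: "elts z = (\<lambda>i. opair (ord_nat i) (hbit (x i))) ` I" by blast
  then have "opair (ord_nat i) c \<in> elts z \<longleftrightarrow> c = hbit (x i)" if "i \<in> I" for i c
    using that by auto
  then have "\<forall>i\<in>ord_nat ` I. \<exists>b\<in>range hbit. \<forall>c\<in>range hbit. opair i c \<in> elts z \<longleftrightarrow> c = b"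
    by blast
  then show "fun2 N z" unfolding fun2_def assms elts_two x by blast
qed

lemma fun2_omega: "fun2 omega z \<longleftrightarrow> z \<in> range hreal"
proof -
  have "elts omega = ord_nat ` UNIV" by simp
  note * = fun2_iff[OF this, of z]
  have "elts z = range (\<lambda>i. opair (ord_nat i) (hbit (x i))) \<longleftrightarrow> z = hreal x" for x
    unfolding elts_hreal[symmetric] by (auto intro: hc_ext)
  then show ?thesis unfolding * by blast
qed

lemma fun2_ord_nat: "fun2 (ord_nat n) z \<longleftrightarrow> (\<exists>s. length s = n \<and> z = hstring s)"
proof
  assume "fun2 (ord_nat n) z"
  then obtain x where x: "elts z = (\<lambda>i. opair (ord_nat i) (hbit (x i))) ` {..<n}"
    using fun2_iff[OF elts_ord_nat] by blast
  then have "z = hstring (map x [0..<n])" by (intro hc_ext) auto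
  then show "\<exists>s. length s = n \<and> z = hstring s" by (metis diff_zero length_map length_upt)
next
  assume "\<exists>s. length s = n \<and> z = hstring s"
  then show "fun2 (ord_nat n) z" using fun2_iff[OF elts_ord_nat, of n z] by auto
qed

definition hdom :: "hc \<Rightarrow> hc" where "hdom z = hset (hfst ` elts z)"

lemma hdom_hstring [simp]: "hdom (hstring s) = ord_nat (length s)"
  by (rule hc_ext) (simp add: hdom_def image_image elts_ord_nat)

definition is_seq :: "hc \<Rightarrow> bool" where
  "is_seq y \<longleftrightarrow> (\<forall>p\<in>elts y. \<exists>n\<in>elts omega. p = opair n (hsnd p)) \<and>
     (\<forall>n\<in>elts omega. \<exists>p\<in>elts y. hfst p = n \<and> (\<forall>q\<in>elts y. hfst q = n \<longrightarrow> q = p))"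

lemma is_seq_iff: "is_seq y \<longleftrightarrow> y \<in> range hseq"
proof
  assume s: "is_seq y"
  have "\<exists>v. opair (ord_nat n) v \<in> elts y \<and> (\<forall>q\<in>elts y. hfst q = ord_nat n \<longrightarrow> q = opair (ord_nat n) v)" for n
  proof -
    obtain p where p: "p \<in> elts y" "hfst p = ord_nat n" "\<forall>q\<in>elts y. hfst q = ord_nat n \<longrightarrow> q = p"
      using s unfolding is_seq_def elts_omega by blast
    obtain m where "p = opair (ord_nat m) (hsnd p)" using s p(1) unfolding is_seq_def by auto
    then have "p = opair (ord_nat n) (hsnd p)" using p(2) by (metis hfst_opair)
    then have "opair (ord_nat n) (hsnd p) = p" by (rule sym)
    with p(1,3) show ?thesis by (intro exI[of _ "hsnd p"]) metis
  qed
  then obtain f where f: "\<And>n. opair (ord_nat n) (f n) \<in> elts y"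
    "\<And>n q. q \<in> elts y \<Longrightarrow> hfst q = ord_nat n \<Longrightarrow> q = opair (ord_nat n) (f n)" by metis
  have "elts y = range (\<lambda>n. opair (ord_nat n) (f n))"
  proof (intro equalityI subsetI)
    fix p assume p: "p \<in> elts y"
    then obtain n w where "p = opair (ord_nat n) w" using s unfolding is_seq_def elts_omega by blast
    then have "hfst p = ord_nat n" by simp
    from f(2)[OF p this] show "p \<in> range (\<lambda>n. opair (ord_nat n) (f n))" by (rule range_eqI)
  qed (use f(1) in auto)
  then show "y \<in> range hseq" by (intro range_eqI[of _ _ f] hc_ext) simp
next
  assume "y \<in> range hseq"
  then obtain f where f: "y = hseq f" by auto
  have "\<exists>p\<in>elts y. hfst p = ord_nat n \<and> (\<forall>q\<in>elts y. hfst q = ord_nat n \<longrightarrow> q = p)" for n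
    by (rule bexI[of _ "opair (ord_nat n) (f n)"]) (auto simp: f)
  moreover have "\<exists>n\<in>elts omega. p = opair n (hsnd p)" if "p \<in> elts y" for p
    using that by (auto simp: f)
  ultimately show "is_seq y" unfolding is_seq_def by simp
qed

lemma opair_tc2: "a \<in> elts (tc (opair a b))" "b \<in> elts (tc (opair a b))"
proof -
  have *: "hset {a, b} \<in> elts (tc (opair a b))" by (rule elts_sub_tc) (simp add: elts_opair)
  show "a \<in> elts (tc (opair a b))" "b \<in> elts (tc (opair a b))" by (rule tc_elts[OF _ *], simp)+
qed

lemma tc_code:
  "hcode c \<in> elts (tc (hcode (Compl c)))"
  "hcode (f n) \<in> elts (tc (hcode (Union f)))"
proof -
  show "hcode c \<in> elts (tc (hcode (Compl c)))" using opair_tc2 by simp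
  have "opair (ord_nat n) (hcode (f n)) \<in> elts (hseq (\<lambda>n. hcode (f n)))" by simp
  then have "hcode (f n) \<in> elts (tc (hseq (\<lambda>n. hcode (f n))))" using opair_tc by blast
  then show "hcode (f n) \<in> elts (tc (hcode (Union f)))"
    using tc_trans[OF opair_tc2(2)] by auto
qed

lemma interp_subset: "interp X c \<subseteq> X"
  by (induction c) auto

text \<open>Codes offer only complements and unions indexed by all numbers; so \<open>d\<close> is
  repeated at every positive index.\<close>

definition cdiff :: "borel_code \<Rightarrow> borel_code \<Rightarrow> borel_code" where
  "cdiff c d = Compl (Union (\<lambda>n. if n = 0 then Compl c else d))"

lemma interp_cdiff [simp]: "interp X (cdiff c d) = interp X c - interp X d"
proof -
  have "(\<Union>n::nat. interp X (if n = 0 then Compl c else d)) = (X - interp X c) \<union> interp X d"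
  proof (intro equalityI subsetI)
    fix x assume "x \<in> (X - interp X c) \<union> interp X d"
    then consider "x \<in> interp X (if (0::nat) = 0 then Compl c else d)"
      | "x \<in> interp X (if (1::nat) = 0 then Compl c else d)" by auto
    then show "x \<in> (\<Union>n::nat. interp X (if n = 0 then Compl c else d))" by cases blast+
  qed (auto split: if_splits)
  then show ?thesis using interp_subset[of X c] by (auto simp: cdiff_def)
qed

context ctm begin

abbreviation "RM \<equiv> reals_of M"
abbreviation "RMh \<equiv> hreals RM"

lemma countable_RM [simp]: "Y \<subseteq> RM \<Longrightarrow> countable Y"
proof (rule countable_image_inj_on[of hreal])
  assume "Y \<subseteq> RM"
  then have "hreal ` Y \<subseteq> M" by (auto simp: reals_of_def)
  then show "countable (hreal ` Y)" by simp
qed simp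

lemma elts_hreals [simp]: "Y \<subseteq> RM \<Longrightarrow> elts (hreals Y) = hreal ` Y"
  by (simp add: hreals_elts)

lemma hreals_inj: "Y \<subseteq> RM \<Longrightarrow> Z \<subseteq> RM \<Longrightarrow> hreals Y = hreals Z \<longleftrightarrow> Y = Z"
  by (metis elts_hreals inj_hreal inj_image_eq_iff)

lemma dfn_fun2 [dfn_intro]: "dtm t \<Longrightarrow> dtm s \<Longrightarrow> dfn (\<lambda>e. fun2 (t e) (s e))"
  by (rule dfn_subst2) (unfold fun2_def, intro dfn_intro ord_nat_M)

lemma dfn_is_seq [dfn_intro]: "dtm t \<Longrightarrow> dfn (\<lambda>e. is_seq (t e))"
  by (erule dfn_subst1[rotated]) (unfold is_seq_def, intro dfn_intro)

lemma dtm_hdom [dfn_intro]: "dtm t \<Longrightarrow> dtm (\<lambda>e. hdom (t e))"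
  by (erule dtm_subst1[rotated]) (unfold hdom_def, intro dfn_intro)

text \<open>Pairs of numbers lie in the second power set of \<open>omega\<close>, hence sets of such
  pairs in the third. This supplies the bound for separating the reals and the strings.\<close>

lemma fun2_sub:
  assumes "z \<in> M" "fun2 N z" "elts N \<subseteq> range ord_nat" shows "z \<in> elts (PM (PM (PM omega)))"
proof -
  have "p \<in> elts (PM (PM omega))" if p: "p \<in> elts z" for p
  proof -
    obtain i b where "p = opair i b" "i \<in> elts N" "b \<in> elts (ord_nat 2)"
      using assms(2) p unfolding fun2_def by blast
    then have ib: "p = opair i b" "i \<in> elts omega" "b \<in> elts omega"
      using assms(3) by (auto simp: elts_ord_nat)
    then have "i \<in> M" "b \<in> M" by auto
    then have "hset {i} \<in> M" "hset {i, b} \<in> M" "p \<in> M"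
      using pair_M[of i i] pair_M[of i b] p trans assms(1) by auto
    then show ?thesis using ib by (auto simp: elts_opair)
  qed
  then show ?thesis using assms(1) by auto
qed

lemma elts_RMh: "elts RMh = {z \<in> M. fun2 omega z}"
  by (auto simp: fun2_omega reals_of_def)

lemma RMh_M [simp]: "RMh \<in> M"
proof -
  have "hset {z \<in> elts (PM (PM (PM omega))). fun2 omega z} \<in> M"
    by (intro sep_M PM_M omega_M dfn_intro)
  moreover have "hset {z \<in> elts (PM (PM (PM omega))). fun2 omega z} = RMh"
    using fun2_sub[of _ omega] trans[OF _ PM_M[OF PM_M[OF PM_M[OF omega_M]]]]
    by (intro hc_ext) (unfold elts_sep elts_RMh elts_omega, blast)
  ultimately show ?thesis by simp
qed

definition Str :: hc where "Str = hset (range hstring)"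

lemma elts_Str [simp]: "elts Str = range hstring"
  by (simp add: Str_def)

lemma hstring_M [simp]: "hstring s \<in> M"
  unfolding hstring_def by (rule finite_M) (auto intro!: opair_M simp: hbit_def)

lemma Str_M [simp]: "Str \<in> M"
proof -
  have "hset {z \<in> elts (PM (PM (PM omega))). \<exists>n\<in>elts omega. fun2 n z} \<in> M"
    by (intro sep_M PM_M omega_M dfn_intro)
  moreover have "hset {z \<in> elts (PM (PM (PM omega))). \<exists>n\<in>elts omega. fun2 n z} = Str"
  proof (rule hc_ext, unfold elts_sep, intro equalityI subsetI)
    fix z assume "z \<in> elts Str"
    then obtain s where s: "z = hstring s" by auto
    then have "fun2 (ord_nat (length s)) z" using fun2_ord_nat by blast
    moreover from this have "z \<in> elts (PM (PM (PM omega)))"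
      by (rule fun2_sub[rotated]) (auto simp: s elts_ord_nat simp del: elts_hstring)
    ultimately show "z \<in> {z \<in> elts (PM (PM (PM omega))). \<exists>n\<in>elts omega. fun2 n z}" by auto
  next
    fix z assume "z \<in> {z \<in> elts (PM (PM (PM omega))). \<exists>n\<in>elts omega. fun2 n z}"
    then show "z \<in> elts Str" by (auto simp: fun2_ord_nat simp del: elts_PM)
  qed
  ultimately show ?thesis by simp
qed

lemma dtm_consts [dfn_intro]: "dtm (\<lambda>e. RMh)" "dtm (\<lambda>e. Str)" "dtm (\<lambda>e. ord_nat n)" "dtm (\<lambda>e. hstring s)"
  by (auto intro: dtm_const)

text \<open>The interpretation of codes as a recursion on sets that \<open>M\<close> can carry out;
  it makes \<open>interp RM\<close> available in formulas over \<open>M\<close>.\<close>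

definition Iop :: "hc \<Rightarrow> hc" where
  "Iop = hrec (\<lambda>c f. hset {x \<in> elts RMh.
     (hfst c = ord_nat 0 \<and> elts (hsnd c) \<subseteq> elts x) \<or>
     (hfst c = ord_nat 1 \<and> x \<notin> elts (app f (hsnd c))) \<or>
     (hfst c = ord_nat 2 \<and> (\<exists>p\<in>elts (hsnd c). x \<in> elts (app f (hsnd p))))})"

lemma dtm_Iop [dfn_intro]: "dtm t \<Longrightarrow> dtm (\<lambda>e. Iop (t e))"
  unfolding Iop_def by (rule dtm_hrec) (intro dfn_intro)

lemma Iop_M: "c \<in> M \<Longrightarrow> Iop c \<in> M"
  by (rule dtm_M1[OF dtm_Iop[OF dtm_var]])

lemma elts_Iop: "elts (Iop c) = {x \<in> elts RMh.
     (hfst c = ord_nat 0 \<and> elts (hsnd c) \<subseteq> elts x) \<or>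
     (hfst c = ord_nat 1 \<and> x \<notin> elts (app (gr Iop (tc c)) (hsnd c))) \<or>
     (hfst c = ord_nat 2 \<and> (\<exists>p\<in>elts (hsnd c). x \<in> elts (app (gr Iop (tc c)) (hsnd p))))}"
  unfolding Iop_def by (subst hrec) (rule elts_sep)

lemma Iop_hcode: "Iop (hcode c) = hreals (interp RM c)"
proof (induction c)
  case (Basic s)
  show ?case
    by (rule hc_ext) (auto simp: elts_Iop hstring_sub_hreal[symmetric] image_iff simp del: elts_hreal elts_hstring)
next
  case (Compl c)
  have "app (gr Iop (tc (hcode (Compl c)))) (hcode c) = hreals (interp RM c)"
    using tc_code(1)[of c] Compl by simp
  then show ?case
    using interp_subset[of RM c]
    by (intro hc_ext) (subst elts_Iop, auto simp del: elts_hreal)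
next
  case (Union f)
  have 1: "app (gr Iop (tc (hcode (Union f)))) (hcode (f n)) = hreals (interp RM (f n))" for n
    using tc_code(2)[of f n] Union by simp
  have 2: "interp RM (f n) \<subseteq> RM" for n by (rule interp_subset)
  have "elts (hreals (interp RM (Union f))) = hreal ` (\<Union>n. interp RM (f n))"
    using 2 by (simp add: UN_subset_iff)
  moreover have "elts (Iop (hcode (Union f))) = {x \<in> elts RMh. \<exists>n. x \<in> elts (hreals (interp RM (f n)))}"
    by (subst elts_Iop) (use 1 in \<open>simp del: elts_hreals\<close>)
  moreover have "hreal ` (\<Union>n. interp RM (f n)) = {x \<in> elts RMh. \<exists>n. x \<in> elts (hreals (interp RM (f n)))}"
    using 2 by fastforce
  ultimately show ?case by (intro hc_ext) simp
qed

text \<open>The characteristic function of the codes, with values 0 and 1: \<open>hrec\<close>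
  defines operations, so the recursive predicate is encoded by its truth values.\<close>

definition Cop :: "hc \<Rightarrow> hc" where
  "Cop = hrec (\<lambda>c f. hset {x \<in> elts (ord_nat 1). c = opair (hfst c) (hsnd c) \<and> (
     (hfst c = ord_nat 0 \<and> hsnd c \<in> elts Str) \<or>
     (hfst c = ord_nat 1 \<and> app f (hsnd c) \<noteq> ord_nat 0) \<or>
     (hfst c = ord_nat 2 \<and> is_seq (hsnd c) \<and> (\<forall>p\<in>elts (hsnd c). app f (hsnd p) \<noteq> ord_nat 0)))})"

lemma Cop_nonempty: "Cop c \<noteq> ord_nat 0 \<longleftrightarrow> c = opair (hfst c) (hsnd c) \<and> (
     (hfst c = ord_nat 0 \<and> hsnd c \<in> elts Str) \<or>
     (hfst c = ord_nat 1 \<and> app (gr Cop (tc c)) (hsnd c) \<noteq> ord_nat 0) \<or>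
     (hfst c = ord_nat 2 \<and> is_seq (hsnd c) \<and> (\<forall>p\<in>elts (hsnd c). app (gr Cop (tc c)) (hsnd p) \<noteq> ord_nat 0)))"
  (is "_ \<longleftrightarrow> ?P")
proof -
  have "elts (Cop c) = {x \<in> elts (ord_nat 1). ?P}"
    unfolding Cop_def by (subst hrec) (rule elts_sep)
  moreover have "elts (ord_nat 1) = {ord_nat 0}" "elts (ord_nat 0) = {}"
    by (auto simp: elts_ord_nat lessThan_Suc)
  ultimately show ?thesis using hc_ext[of "Cop c" "ord_nat 0"] by fastforce
qed

lemma Cop_hcode: "Cop (hcode c) \<noteq> ord_nat 0"
proof (induction c)
  case (Basic s)
  show ?case by (subst Cop_nonempty) (simp)
next
  case (Compl c)
  then show ?case using tc_code(1)[of c] by (subst Cop_nonempty) (simp)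
next
  case (Union f)
  then show ?case using tc_code(2)[of f]
    by (subst Cop_nonempty) (simp add: is_seq_iff)
qed

text \<open>Well-foundedness lets the induction rebuild the datatype element from the set. Being a
  code thereby becomes definable over \<open>M\<close>.\<close>

lemma Cop_iff: "Cop c \<noteq> ord_nat 0 \<longleftrightarrow> c \<in> range hcode"
proof
  show "Cop c \<noteq> ord_nat 0 \<Longrightarrow> c \<in> range hcode"
  proof (induction c rule: elts_trancl_induct)
    case (step c)
    define a b where "a = hfst c" "b = hsnd c"
    from step.prems have c: "c = opair a b" and cs:
      "(a = ord_nat 0 \<and> b \<in> elts Str) \<or>
       (a = ord_nat 1 \<and> app (gr Cop (tc c)) b \<noteq> ord_nat 0) \<or>
       (a = ord_nat 2 \<and> is_seq b \<and> (\<forall>p\<in>elts b. app (gr Cop (tc c)) (hsnd p) \<noteq> ord_nat 0))"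
      unfolding Cop_nonempty[of c] a_b_def by blast+
    from cs show ?case
    proof (elim disjE conjE)
      assume "a = ord_nat 0" "b \<in> elts Str"
      then obtain s where "c = hcode (Basic s)" using c by auto
      then show ?thesis by blast
    next
      assume a: "a = ord_nat 1" "app (gr Cop (tc c)) b \<noteq> ord_nat 0"
      have b: "b \<in> elts (tc c)" using c opair_tc2 by blast
      then obtain d where "b = hcode d" using step.IH[of b] a(2) by auto
      then have "c = hcode (Compl d)" using a c by simp
      then show ?thesis by blast
    next
      assume a: "a = ord_nat 2" "is_seq b" "\<forall>p\<in>elts b. app (gr Cop (tc c)) (hsnd p) \<noteq> ord_nat 0"
      obtain g where g: "b = hseq g" using a(2) is_seq_iff by blast
      have "g n \<in> range hcode" for n
      proof -
        have p: "opair (ord_nat n) (g n) \<in> elts b" by (simp add: g)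
        then have "g n \<in> elts (tc b)" using opair_tc by blast
        then have gn: "g n \<in> elts (tc c)" using tc_trans[of b c] opair_tc2 c by blast
        moreover have "app (gr Cop (tc c)) (g n) \<noteq> ord_nat 0" using a(3) p by (metis hsnd_opair)
        ultimately show ?thesis using step.IH[OF gn] by simp
      qed
      then obtain h where "g = (\<lambda>n. hcode (h n))" by (metis (no_types) image_iff rangeE)
      then have "c = hcode (Union h)" using a(1) c g by simp
      then show ?thesis by blast
    qed
  qed
qed (use Cop_hcode in auto)

lemma dfn_code [dfn_intro]: assumes "dtm t" shows "dfn (\<lambda>e. t e \<in> range hcode)"
proof -
  have "dtm (\<lambda>e. Cop (t e))"
    unfolding Cop_def by (rule dtm_hrec[OF _ assms]) (intro dfn_intro)
  then show ?thesis unfolding Cop_iff[symmetric] by (intro dfn_intro)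
qed

definition codes :: "borel_code set" where "codes = {c. hcode c \<in> M}"

lemma codes_iff [simp]: "Basic s \<in> codes" "Compl c \<in> codes \<longleftrightarrow> c \<in> codes"
  "Union f \<in> codes \<longleftrightarrow> hseq (\<lambda>n. hcode (f n)) \<in> M"
  by (auto simp: codes_def intro!: opair_M dest: opair_MD)

lemma codesD: "c \<in> codes \<Longrightarrow> hcode c \<in> M"
  by (simp add: codes_def)

lemma codes_UnionD: "Union f \<in> codes \<Longrightarrow> f n \<in> codes"
  using hseq_MD[of "\<lambda>n. hcode (f n)" n] by (auto simp: codes_def dest: opair_MD)

lemma codes_finite_Union:
  assumes "\<And>n. f n \<in> codes" "\<And>n. n \<ge> N \<Longrightarrow> f n = f N" shows "Union f \<in> codes"
  unfolding codes_iff
proof (rule hseq_eventually_const_M[of _ N])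
  show "hcode (f n) \<in> M" for n using assms(1) by (rule codesD)
  show "hcode (f n) = hcode (f N)" if "n \<ge> N" for n using assms(2)[OF that] by (rule arg_cong)
qed

lemma codes_cdiff: "c \<in> codes \<Longrightarrow> d \<in> codes \<Longrightarrow> cdiff c d \<in> codes"
  unfolding cdiff_def codes_iff(2) by (rule codes_finite_Union[of _ 1]) auto

lemma sigma_algebra_in_Union:
  assumes "sigma_algebra_in M S" "\<And>n. Y n \<subseteq> RM \<and> hreals (Y n) \<in> elts S"
    "hseq (\<lambda>n. hreals (Y n)) \<in> M"
  shows "hreals (\<Union>n. Y n) \<in> elts S"
proof -
  have "\<forall>Y. (\<forall>n. Y n \<subseteq> RM \<and> hreals (Y n) \<in> elts S) \<and> hseq (\<lambda>n. hreals (Y n)) \<in> M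
      \<longrightarrow> hreals (\<Union>n::nat. Y n) \<in> elts S"
    using assms(1) unfolding sigma_algebra_in_def by (elim conjE)
  from this[rule_format, of Y] assms(2,3) show ?thesis by simp
qed

lemma borel_in_interp: "c \<in> codes \<Longrightarrow> borel_in M (interp RM c)"
proof -
  assume c: "c \<in> codes"
  have "hreals (interp RM c) \<in> elts S" if S: "sigma_algebra_in M S" for S
    using c
  proof (induction c)
    case (Compl c)
    then have "hreals (interp RM c) \<in> elts S" by simp
    then show ?case using S interp_subset[of RM c] unfolding sigma_algebra_in_def interp.simps(2) by blast
  next
    case (Union f)
    have "hseq (\<lambda>n. hreals (interp RM (f n))) \<in> M"
      by (rule hseq_map_M[OF dtm_Iop[OF dtm_var], of "\<lambda>n. hcode (f n)"])
        (use Union.prems in \<open>simp_all add: Iop_hcode\<close>)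
    then have "hreals (\<Union>n. interp RM (f n)) \<in> elts S"
      using Union.IH[OF rangeI] codes_UnionD[OF Union.prems] interp_subset[of RM]
      by (intro sigma_algebra_in_Union[OF S]) auto
    then show ?case by simp
  qed (use S in \<open>simp add: sigma_algebra_in_def\<close>)
  then show ?thesis
    unfolding borel_in_def using interp_subset Iop_M[OF codesD[OF c]] by (simp add: Iop_hcode)
qed

text \<open>The sets with codes in \<open>M\<close> form a \<open>\<sigma>\<close>-algebra in the
  sense of \<open>M\<close>: for a sequence of such sets that lies in \<open>M\<close>, choice
  inside \<open>M\<close> provides a sequence of codes.\<close>

lemma borel_in_code: assumes "borel_in M Y" shows "\<exists>c. c \<in> codes \<and> Y = interp RM c"
proof -
  define S where "S = hset {Z \<in> elts (PM RMh). \<exists>c\<in>M. c \<in> range hcode \<and> Z = Iop c}"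
  have S_iff: "hreals Y \<in> elts S \<longleftrightarrow> (\<exists>c. c \<in> codes \<and> Y = interp RM c)" if "Y \<subseteq> RM" for Y
  proof
    assume "hreals Y \<in> elts S"
    then obtain c where "c \<in> codes" "hreals Y = Iop (hcode c)" unfolding S_def elts_sep codes_def by auto
    then show "\<exists>c. c \<in> codes \<and> Y = interp RM c"
      using that hreals_inj interp_subset by (auto simp: Iop_hcode)
  next
    assume "\<exists>c. c \<in> codes \<and> Y = interp RM c"
    then obtain c where c: "c \<in> codes" "Y = interp RM c" by blast
    then have "hreals Y = Iop (hcode c)" by (simp add: Iop_hcode)
    moreover have "elts (hreals Y) \<subseteq> elts RMh" using that by auto
    ultimately show "hreals Y \<in> elts S" unfolding S_def elts_sep using codesD[OF c(1)] Iop_M[OF codesD[OF c(1)]] by auto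
  qed
  have "S \<in> M"
    unfolding S_def by (intro sep_M PM_M RMh_M dfn_intro)
  moreover have "elts S \<subseteq> hreals ` Pow RM"
    unfolding S_def elts_sep using interp_subset by (auto simp: Iop_hcode simp del: elts_PM)
  moreover have "hreals (cyl s \<inter> RM) \<in> elts S" for s
    by (subst S_iff) (auto intro!: exI[of _ "Basic s"])
  moreover have "hreals (RM - Y) \<in> elts S" if Y: "Y \<subseteq> RM" "hreals Y \<in> elts S" for Y
  proof -
    obtain c where "c \<in> codes" "Y = interp RM c" using Y S_iff by blast
    then show ?thesis by (subst S_iff) (auto intro!: exI[of _ "Compl c"])
  qed
  moreover have "hreals (\<Union>n. Y n) \<in> elts S"
    if Y: "\<And>n. Y n \<subseteq> RM \<and> hreals (Y n) \<in> elts S" "hseq (\<lambda>n. hreals (Y n)) \<in> M" for Y :: "nat \<Rightarrow> _"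
  proof -
    define R where "R n y \<longleftrightarrow> y \<in> range hcode \<and> Iop y = app (hseq (\<lambda>n. hreals (Y n))) n" for n y
    have "dfn (\<lambda>e. R (e 0) (e 1))"
      unfolding R_def by (intro dfn_intro dtm_const Y(2))
    moreover have "\<exists>y\<in>M. R (ord_nat n) y" for n
    proof -
      obtain c where "c \<in> codes" "Y n = interp RM c" using Y(1)[of n] S_iff by blast
      then show ?thesis unfolding R_def by (intro bexI[of _ "hcode c"]) (auto simp: Iop_hcode codesD)
    qed
    ultimately obtain g where g: "\<And>n. g n \<in> M" "\<And>n. R (ord_nat n) (g n)" "hseq g \<in> M"
      using choice_M[of R] by blast
    then have "\<forall>n. \<exists>c. g n = hcode c" unfolding R_def by auto
    then obtain f where f: "\<And>n. g n = hcode (f n)" by metis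
    then have "Union f \<in> codes" using g(3) by (simp flip: f)
    moreover have "interp RM (f n) = Y n" for n
      using g(2)[of n] Y(1)[of n] hreals_inj[OF interp_subset] by (simp add: R_def f Iop_hcode)
    ultimately show ?thesis using Y(1) by (subst S_iff) (auto intro!: exI[of _ "Union f"])
  qed
  ultimately have "sigma_algebra_in M S"
    unfolding sigma_algebra_in_def by auto
  then show ?thesis using assms S_iff unfolding borel_in_def by blast
qed

end

section \<open>Coin-tossing measure\<close>

text \<open>Makes the Borel sets of Cantor space coincide with the product
  \<open>\<sigma>\<close>-algebra, on which \<open>coin\<close> lives.\<close>

instance bool :: second_countable_topology
proof
  show "\<exists>B :: bool set set. countable B \<and> open = generate_topology B"
    by (intro exI[of _ "range (\<lambda>a. {..< a}) \<union> range (\<lambda>a. {a <..})"]) (auto simp: open_bool_def fun_eq_iff)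
qed

definition coin :: "(nat \<Rightarrow> bool) measure" where
  "coin = PiM UNIV (\<lambda>_. measure_pmf (bernoulli_pmf (1/2)))"

interpretation coinP: product_prob_space "\<lambda>_. measure_pmf (bernoulli_pmf (1/2))" "UNIV :: nat set"
  by standard

interpretation coin: prob_space coin
  unfolding coin_def by (rule coinP.P.prob_space_axioms)

lemma space_coin [simp]: "space coin = UNIV"
  by (simp add: coin_def space_PiM)

lemma sets_coin [simp, measurable_cong]: "sets coin = sets borel"
proof -
  have "A \<in> sets borel" for A :: "bool set"
    by (rule borel_open, rule discrete_topology_class.open_discrete)
  then have "sets (measure_pmf (bernoulli_pmf (1/2))) = sets (borel :: bool measure)"
    by (simp add: set_eq_iff)
  then have "sets coin = sets (PiM UNIV (\<lambda>i::nat. borel :: bool measure))"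
    unfolding coin_def by (intro sets_PiM_cong) auto
  then show ?thesis by (simp add: sets_PiM_equal_borel)
qed

lemma emeasure_cyl: "emeasure coin (cyl s) = ennreal ((1/2) ^ length s)"
proof -
  have "cyl s = {x \<in> space coin. \<forall>i\<in>{..<length s}. x i \<in> {s ! i}}"
    by (auto simp: cyl_def)
  then have "emeasure coin (cyl s) = (\<Prod>i<length s. emeasure (measure_pmf (bernoulli_pmf (1/2))) {s ! i})"
    unfolding coin_def by (simp only:) (subst coinP.emeasure_PiM_Collect, auto)
  also have "\<dots> = (\<Prod>i<length s. ennreal (1/2))"
    by (intro prod.cong) (auto simp: emeasure_pmf_single pmf_bernoulli_half)
  also have "\<dots> = ennreal ((1/2) ^ length s)"
    unfolding prod_constant by (subst ennreal_power) auto
  finally show ?thesis .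
qed

lemma coord_sets [measurable, simp]: "{x :: nat \<Rightarrow> bool. x i = b} \<in> sets borel"
proof -
  have "(\<lambda>x. x i) \<in> measurable coin (measure_pmf (bernoulli_pmf (1/2)))"
    unfolding coin_def by (rule measurable_component_singleton) simp
  from measurable_sets[OF this, of "{b}"] show ?thesis
    by (simp add: vimage_def)
qed

lemma cyl_sets [measurable, simp]: "cyl s \<in> sets borel"
proof (cases "length s = 0")
  case False
  have "cyl s = (\<Inter>i\<in>{..<length s}. {x. x i = s ! i})" by (auto simp: cyl_def)
  moreover have "\<dots> \<in> sets borel" using False by (intro sets.finite_INT) auto
  ultimately show ?thesis by simp
qed (simp add: cyl_def)

lemma measure_cyl: "measure coin (cyl s) = (1/2) ^ length s"
  using emeasure_cyl[of s] by (simp add: measure_def)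

lemma interp_sets [measurable, simp]: "interp UNIV c \<in> sets borel"
proof (induction c)
  case (Compl c)
  then have "space borel - interp UNIV c \<in> sets borel" by (rule sets.compl_sets)
  then show ?case by simp
next
  case (Union f)
  then show ?case by auto
qed simp

lemma cyl_map: "x \<in> cyl s \<longleftrightarrow> map x [0..<length s] = s"
proof
  show "x \<in> cyl s \<Longrightarrow> map x [0..<length s] = s"
    by (intro nth_equalityI) (auto simp: cyl_def)
  assume *: "map x [0..<length s] = s"
  have "x i = s ! i" if "i < length s" for i
    using that arg_cong[OF *, of "\<lambda>t. t ! i"] by simp
  then show "x \<in> cyl s" by (simp add: cyl_def)
qed

lemma cyl_disjoint: "length s = length t \<Longrightarrow> s \<noteq> t \<Longrightarrow> cyl s \<inter> cyl t = {}"
  by (metis cyl_map disjoint_iff)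

lemma cyl_take: "take (length s) t = s \<Longrightarrow> cyl t \<subseteq> cyl s"
proof
  fix x assume t: "take (length s) t = s" and x: "x \<in> cyl t"
  have "length s \<le> length t" using t by (metis length_take min.cobounded1)
  moreover have "s ! i = t ! i" if "i < length s" for i using t that by (metis nth_take)
  ultimately show "x \<in> cyl s" using x by (auto simp: cyl_def)
qed

text \<open>A set of strings stands for the open set that it generates; \<open>lev A L\<close> approximates this
  open set by strings of length \<open>L\<close>.\<close>

definition U :: "bool list set \<Rightarrow> (nat \<Rightarrow> bool) set" where
  "U A = (\<Union>s\<in>A. cyl s)"

definition lev :: "bool list set \<Rightarrow> nat \<Rightarrow> bool list set" where
  "lev A L = {t. length t = L \<and> (\<exists>s\<in>A. take (length s) t = s)}"

lemma U_sets [measurable, simp]: "U A \<in> sets borel"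
  unfolding U_def by auto

lemma finite_length [simp]: "finite {t :: bool list. length t = L}" "card {t :: bool list. length t = L} = 2 ^ L"
  using card_lists_length_eq[of "UNIV :: bool set" L] finite_lists_length_eq[of "UNIV :: bool set" L] by auto

lemma finite_lev [simp]: "finite (lev A L)"
  by (rule finite_subset[of _ "{t. length t = L}"]) (auto simp: lev_def)

lemma lev_prefix:
  "map x [0..<L] \<in> lev A L \<longleftrightarrow> (\<exists>s\<in>A. length s \<le> L \<and> x \<in> cyl s)"
proof -
  have "take (length s) (map x [0..<L]) = s \<longleftrightarrow> length s \<le> L \<and> x \<in> cyl s" for s
  proof (cases "length s \<le> L")
    case True
    then show ?thesis by (simp add: take_map take_upt cyl_map)
  next
    case False
    then have "length (take (length s) (map x [0..<L])) \<noteq> length s" by simp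
    then show ?thesis using False by metis
  qed
  then show ?thesis by (simp add: lev_def)
qed

lemma U_lev: "U A = (\<Union>L. {x. map x [0..<L] \<in> lev A L})"
  by (auto simp: U_def lev_prefix)

lemma measure_level:
  assumes "F \<subseteq> {t. length t = L}"
  shows "{x. map x [0..<L] \<in> F} \<in> sets borel" "measure coin {x. map x [0..<L] \<in> F} = card F * (1/2) ^ L"
proof -
  have eq: "{x. map x [0..<L] \<in> F} = (\<Union>t\<in>F. cyl t)"
    using assms by (force simp: cyl_map)
  have fin: "finite F" using assms finite_length(1) finite_subset by blast
  show "{x. map x [0..<L] \<in> F} \<in> sets borel" unfolding eq using fin by auto
  have "measure coin (\<Union>t\<in>F. cyl t) = (\<Sum>t\<in>F. measure coin (cyl t))"
    using assms by (intro coin.finite_measure_finite_Union fin)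
      (auto simp: disjoint_family_on_def intro!: cyl_disjoint)
  also have "\<dots> = (\<Sum>t\<in>F. (1/2) ^ L)" using assms by (intro sum.cong) (auto simp: measure_cyl)
  finally show "measure coin {x. map x [0..<L] \<in> F} = card F * (1/2) ^ L" unfolding eq by simp
qed

lemma lev_sub: "lev A L \<subseteq> {t. length t = L}"
  by (auto simp: lev_def)

text \<open>The levels increase to \<open>U A\<close>, and level \<open>L\<close> splits into
  cylinders of measure \<open>(1/2) ^ L\<close>. Counting strings replaces real numbers, so that
  \<open>M\<close> can express bounds on measure.\<close>

lemma measure_U_le:
  "measure coin (U A) \<le> (1/2) ^ k \<longleftrightarrow> (\<forall>L\<ge>k. card (lev A L) \<le> 2 ^ (L - k))"
proof -
  let ?V = "\<lambda>L. {x. map x [0..<L] \<in> lev A L}"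
  have c: "card (lev A L) * (1/2) ^ L \<le> (1/2 :: real) ^ k \<longleftrightarrow> card (lev A L) \<le> 2 ^ (L - k)" if "L \<ge> k" for L
  proof -
    have "card (lev A L) * (1/2) ^ L \<le> (1/2 :: real) ^ k \<longleftrightarrow> real (card (lev A L)) \<le> 2 ^ (L - k)"
      using that by (simp add: power_diff field_simps)
    then show ?thesis by (metis of_nat_le_iff of_nat_numeral of_nat_power)
  qed
  have inc: "incseq ?V" by (auto simp: incseq_def lev_prefix) (meson order_trans)
  have lim: "(\<lambda>L. measure coin (?V L)) \<longlonglongrightarrow> measure coin (U A)"
    unfolding U_lev using measure_level(1)[OF lev_sub] inc
    by (intro coin.finite_Lim_measure_incseq) (auto simp del: UN_simps)
  show ?thesis
  proof
    assume le: "measure coin (U A) \<le> (1/2) ^ k"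
    have "measure coin (?V L) \<le> measure coin (U A)" for L
      by (intro coin.finite_measure_mono) (simp_all, auto simp: U_lev)
    with le c show "\<forall>L\<ge>k. card (lev A L) \<le> 2 ^ (L - k)"
      unfolding measure_level(2)[OF lev_sub] by (meson order_trans)
  next
    assume "\<forall>L\<ge>k. card (lev A L) \<le> 2 ^ (L - k)"
    then have "\<exists>N. \<forall>L\<ge>N. measure coin (?V L) \<le> (1/2) ^ k"
      using c unfolding measure_level(2)[OF lev_sub] by blast
    then show "measure coin (U A) \<le> (1/2) ^ k" by (rule LIMSEQ_le_const2[OF lim])
  qed
qed

text \<open>The minimal strings of \<open>A\<close> generate the same open set, and their cylinders are disjoint.\<close>

definition minimal :: "bool list set \<Rightarrow> bool list set" where
  "minimal A = {t \<in> A. \<forall>s\<in>A. take (length s) t = s \<longrightarrow> s = t}"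

lemma U_minimal: "U (minimal A) = U A"
proof
  show "U A \<subseteq> U (minimal A)"
  proof
    fix x assume "x \<in> U A"
    then obtain s0 where "s0 \<in> A \<and> x \<in> cyl s0" by (auto simp: U_def)
    from ex_has_least_nat[of "\<lambda>s. s \<in> A \<and> x \<in> cyl s", OF this, of length]
    obtain s where s: "s \<in> A" "x \<in> cyl s" and min: "\<And>t. t \<in> A \<Longrightarrow> x \<in> cyl t \<Longrightarrow> length s \<le> length t"
      by blast
    have "t = s" if t: "t \<in> A" "take (length t) s = t" for t
    proof -
      have "x \<in> cyl t" using cyl_take[OF t(2)] s by blast
      then have "length s \<le> length t" using min t(1) by blast
      then show ?thesis using t(2) by simp
    qed
    then show "x \<in> U (minimal A)" using s by (auto simp: U_def minimal_def)
  qed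
qed (auto simp: U_def minimal_def)

lemma minimal_disjoint:
  assumes "s \<in> minimal A" "t \<in> minimal A" "s \<noteq> t" shows "cyl s \<inter> cyl t = {}"
proof -
  have *: "cyl s \<inter> cyl t = {}" if "s \<in> minimal A" "t \<in> minimal A" "s \<noteq> t" "length s \<le> length t" for s t
  proof -
    have "take (length s) t \<noteq> s" using that by (auto simp: minimal_def)
    moreover have "take (length s) t = s" if "x \<in> cyl t" "x \<in> cyl s" for x
    proof -
      have "take (length s) (map x [0..<length t]) = map x [0..<length s]"
        using \<open>length s \<le> length t\<close> by (simp add: take_map take_upt)
      then show ?thesis using that by (simp add: cyl_map)
    qed
    ultimately show ?thesis by blast
  qed
  show ?thesis using *[of s t] *[of t s] assms linear[of "length s" "length t"] by blast
qed

lemma suminf_minimal: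
  assumes "inj e"
  shows "(\<Sum>n. if e n \<in> minimal A then ennreal ((1/2) ^ length (e n)) else 0) \<le> emeasure coin (U A)"
proof -
  let ?C = "\<lambda>n. if e n \<in> minimal A then cyl (e n) else {}"
  have "(\<Sum>n. if e n \<in> minimal A then ennreal ((1/2) ^ length (e n)) else 0) = (\<Sum>n. emeasure coin (?C n))"
    by (intro suminf_cong) (auto simp: emeasure_cyl)
  also have "\<dots> = emeasure coin (\<Union>n. ?C n)"
  proof (rule suminf_emeasure)
    show "disjoint_family ?C"
      using minimal_disjoint injD[OF assms] by (fastforce simp: disjoint_family_on_def)
  qed auto
  also have "\<dots> \<le> emeasure coin (U A)"
    unfolding U_minimal[of A, symmetric] by (intro emeasure_mono) (auto simp: U_def split: if_splits)
  finally show ?thesis .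
qed

definition meet :: "bool list set \<Rightarrow> bool list set \<Rightarrow> bool list set" where
  "meet A B = {t. (\<exists>s\<in>A. take (length s) t = s) \<and> (\<exists>s\<in>B. take (length s) t = s)}"

lemma U_meet: "U (meet A B) = U A \<inter> U B"
proof
  show "U (meet A B) \<subseteq> U A \<inter> U B"
    using cyl_take by (auto simp: U_def meet_def)
  show "U A \<inter> U B \<subseteq> U (meet A B)"
  proof
    fix x assume "x \<in> U A \<inter> U B"
    then obtain s t where st: "s \<in> A" "x \<in> cyl s" "t \<in> B" "x \<in> cyl t" by (auto simp: U_def)
    define L where "L = max (length s) (length t)"
    have "map x [0..<L] \<in> lev A L" "map x [0..<L] \<in> lev B L"
      unfolding lev_prefix using st by (auto simp: L_def intro: bexI[of _ s] bexI[of _ t])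
    then have "map x [0..<L] \<in> meet A B" by (simp add: meet_def lev_def)
    moreover have "x \<in> cyl (map x [0..<L])" by (simp add: cyl_map)
    ultimately show "x \<in> U (meet A B)" unfolding U_def by blast
  qed
qed

lemma U_Un: "U (A \<union> B) = U A \<union> U B" and U_UN: "U (\<Union>n. C n) = (\<Union>n. U (C n))"
  by (auto simp: U_def)

section \<open>Compactness of Cantor space for covers in \<open>M\<close>\<close>

lemma hstring_snoc: "hstring (u @ [b]) = hins (opair (ord_nat (length u)) (hbit b)) (hstring u)"
proof (rule hc_ext)
  have "(\<lambda>i. opair (ord_nat i) (hbit ((u @ [b]) ! i))) ` {..<length u} =
    (\<lambda>i. opair (ord_nat i) (hbit (u ! i))) ` {..<length u}"
    by (rule image_cong) (auto simp: nth_append)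
  then show "elts (hstring (u @ [b])) = elts (hins (opair (ord_nat (length u)) (hbit b)) (hstring u))"
    by (simp add: lessThan_Suc)
qed

text \<open>\<open>A\<close> bars \<open>t\<close> at a finite level. Only finite strings occur, so
  this means the same in \<open>M\<close> and in the universe.\<close>

definition bcov :: "bool list set \<Rightarrow> bool list \<Rightarrow> bool" where
  "bcov A t \<longleftrightarrow> (\<exists>L\<ge>length t. \<forall>u. length u = L \<and> take (length t) u = t \<longrightarrow> (\<exists>s\<in>A. take (length s) u = s))"

lemma bcov_mono:
  assumes "\<forall>u. length u = L \<and> take (length t) u = t \<longrightarrow> (\<exists>s\<in>A. take (length s) u = s)"
    "length t \<le> L" "L \<le> L'" "length u = L'" "take (length t) u = t"
  shows "\<exists>s\<in>A. take (length s) u = s"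
proof -
  have "length (take L u) = L" "take (length t) (take L u) = t" using assms by (auto simp: min_def)
  then obtain s where s: "s \<in> A" "take (length s) (take L u) = s" using assms(1) by blast
  then have "length s \<le> L" by (metis length_take min.bounded_iff min.cobounded2 nle_le take_take)
  then have "take (length s) u = s" using s by (simp add: min_def)
  then show ?thesis using s(1) by blast
qed

lemma bcov_snoc: assumes "bcov A (t @ [False])" "bcov A (t @ [True])" shows "bcov A t"
proof -
  obtain L0 where L0: "L0 \<ge> Suc (length t)"
    "\<forall>u. length u = L0 \<and> take (length (t @ [False])) u = t @ [False] \<longrightarrow> (\<exists>s\<in>A. take (length s) u = s)"
    using assms(1) unfolding bcov_def by auto
  obtain L1 where L1: "L1 \<ge> Suc (length t)"
    "\<forall>u. length u = L1 \<and> take (length (t @ [True])) u = t @ [True] \<longrightarrow> (\<exists>s\<in>A. take (length s) u = s)"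
    using assms(2) unfolding bcov_def by auto
  have "\<exists>s\<in>A. take (length s) u = s" if u: "length u = max L0 L1" "take (length t) u = t" for u
  proof -
    have lt: "length t < length u" using L0(1) u(1) by auto
    then have "take (Suc (length t)) u = t @ [u ! length t]"
      using u(2) by (simp add: take_Suc_conv_app_nth)
    then show ?thesis
      using bcov_mono[OF L0(2) _ _ u(1)] bcov_mono[OF L1(2) _ _ u(1)] L0(1) L1(1)
      by (cases "u ! length t") auto
  qed
  then show ?thesis unfolding bcov_def using L0(1) by (intro exI[of _ "max L0 L1"]) auto
qed

lemma bcov_prefix: assumes "bcov A t" shows "bcov A (t @ [b])"
proof -
  obtain L where L: "L \<ge> length t"
    "\<forall>u. length u = L \<and> take (length t) u = t \<longrightarrow> (\<exists>s\<in>A. take (length s) u = s)"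
    using assms unfolding bcov_def by auto
  have "\<exists>s\<in>A. take (length s) u = s" if u: "length u = Suc L" "take (length (t @ [b])) u = t @ [b]" for u
  proof -
    have "take (length t) (take (length (t @ [b])) u) = t" unfolding u(2) by simp
    then have "take (length t) u = t" by (simp add: min_def)
    then show ?thesis using bcov_mono[OF L(2,1) _ u(1)] by simp
  qed
  then show ?thesis unfolding bcov_def using L(1) by (intro exI[of _ "Suc L"]) auto
qed

text \<open>The leftmost path through the strings \<open>t\<close> without \<open>bcov A t\<close>.\<close>

primrec lpath :: "bool list set \<Rightarrow> nat \<Rightarrow> bool list" where
  "lpath A 0 = []"
| "lpath A (Suc n) = lpath A n @ [bcov A (lpath A n @ [False])]"

lemma length_lpath [simp]: "length (lpath A n) = n"
  by (induction n) auto

lemma lpath_not_bcov: "\<not> bcov A [] \<Longrightarrow> \<not> bcov A (lpath A n)"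
proof (induction n)
  case (Suc n)
  then have "\<not> bcov A (lpath A n)" by blast
  then show ?case using bcov_snoc[of A "lpath A n"]
    by (cases "bcov A (lpath A n @ [False])") auto
qed simp

text \<open>A condition on a single string. By \<open>lpath_unique\<close> it pins down the leftmost
  unbarred path without recursion, so that one instance of Separation produces the path in
  \<open>M\<close>.\<close>

definition leftmost :: "bool list set \<Rightarrow> bool list \<Rightarrow> bool" where
  "leftmost A t \<longleftrightarrow> (\<forall>u. take (Suc (length u)) t = u @ [True] \<longrightarrow> bcov A (u @ [False]))"

lemma take_lpath: "m \<le> n \<Longrightarrow> take m (lpath A n) = lpath A m"
  by (induction n) (auto simp: le_Suc_eq)

lemma lpath_unique:
  assumes "\<not> bcov A []"
  shows "\<not> bcov A t \<and> leftmost A t \<longleftrightarrow> t = lpath A (length t)"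
proof
  assume "\<not> bcov A t \<and> leftmost A t"
  then show "t = lpath A (length t)"
  proof (induction t rule: rev_induct)
    case (snoc b t)
    have "leftmost A t" unfolding leftmost_def
    proof (intro allI impI)
      fix u assume u: "take (Suc (length u)) t = u @ [True]"
      then have "Suc (length u) \<le> length t"
        by (metis length_append_singleton length_take min.absorb_iff2 min.commute)
      then have "take (Suc (length u)) (t @ [b]) = u @ [True]" using u by simp
      then show "bcov A (u @ [False])" using snoc.prems unfolding leftmost_def by blast
    qed
    moreover have "\<not> bcov A t" using snoc.prems bcov_prefix by blast
    ultimately have t: "t = lpath A (length t)" using snoc.IH by blast
    have "b = bcov A (t @ [False])"
    proof (cases b)
      case True
      then have "take (Suc (length t)) (t @ [b]) = t @ [True]" by simp
      then show ?thesis using snoc.prems True unfolding leftmost_def by blast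
    qed (use snoc.prems in auto)
    then show ?case using t by simp
  qed simp
next
  assume t: "t = lpath A (length t)"
  have "leftmost A t" unfolding leftmost_def
  proof (intro allI impI)
    fix u assume u: "take (Suc (length u)) t = u @ [True]"
    then have "Suc (length u) \<le> length t"
      by (metis length_append_singleton length_take min.absorb_iff2 min.commute)
    then have "lpath A (Suc (length u)) = u @ [True]" using take_lpath t u by metis
    then show "bcov A (u @ [False])" by auto
  qed
  then show "\<not> bcov A t \<and> leftmost A t" using lpath_not_bcov[OF assms] t by metis
qed

lemma bcov_Nil_U: "bcov A [] \<Longrightarrow> U A = UNIV"
proof -
  assume "bcov A []"
  then obtain L where L: "\<And>u. length u = L \<Longrightarrow> \<exists>s\<in>A. take (length s) u = s"
    unfolding bcov_def by auto
  have "x \<in> U A" for x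
  proof -
    have "map x [0..<L] \<in> lev A L" using L[of "map x [0..<L]"] by (simp add: lev_def)
    then show ?thesis unfolding lev_prefix by (auto simp: U_def)
  qed
  then show ?thesis by blast
qed

context ctm begin

definition hs :: "bool list set \<Rightarrow> hc" where "hs A = hset (hstring ` A)"

lemma elts_hs [simp]: "elts (hs A) = hstring ` A"
  by (simp add: hs_def)

definition sset :: "bool list set set" where "sset = {A. hs A \<in> M}"

lemma hs_cases: assumes "a \<in> M" "elts a \<subseteq> elts Str" obtains A where "a = hs A" "A \<in> sset"
proof -
  have "elts a = hstring ` {s. hstring s \<in> elts a}" using assms(2) unfolding elts_Str by blast
  then have eq: "a = hs {s. hstring s \<in> elts a}" by (intro hc_ext) (simp only: elts_hs)
  have "{s. hstring s \<in> elts a} \<in> sset"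
    unfolding sset_def mem_Collect_eq eq[symmetric] by (rule assms(1))
  from that[OF eq this] show ?thesis .
qed

definition hcov :: "hc \<Rightarrow> hc \<Rightarrow> bool" where
  "hcov a t \<longleftrightarrow> (\<exists>L\<in>elts omega. elts (hdom t) \<subseteq> elts L \<and>
     (\<forall>u\<in>elts Str. hdom u = L \<and> elts t \<subseteq> elts u \<longrightarrow> (\<exists>s\<in>elts a. elts s \<subseteq> elts u)))"

lemma ord_nat_sub [simp]: "elts (ord_nat m) \<subseteq> elts (ord_nat n) \<longleftrightarrow> m \<le> n"
proof -
  have "ord_nat ` {..<m} \<subseteq> ord_nat ` {..<n} \<longleftrightarrow> {..<m} \<subseteq> {..<n}"
    by (rule inj_image_subset_iff) (simp add: inj_on_def)
  then show ?thesis by (simp add: elts_ord_nat)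
qed

lemma hcov_iff: "hcov (hs A) (hstring t) \<longleftrightarrow> bcov A t"
  unfolding hcov_def bcov_def by (auto simp: hstring_sub_hstring simp del: elts_hstring)

definition hleft :: "hc \<Rightarrow> hc \<Rightarrow> bool" where
  "hleft a t \<longleftrightarrow> (\<forall>u\<in>elts Str. elts (hins (opair (hdom u) (ord_nat 1)) u) \<subseteq> elts t
     \<longrightarrow> hcov a (hins (opair (hdom u) (ord_nat 0)) u))"

lemma hleft_iff: "hleft (hs A) (hstring t) \<longleftrightarrow> leftmost A t"
proof -
  have *: "hins (opair (ord_nat (length u)) (ord_nat (Suc 0))) (hstring u) = hstring (u @ [True])"
    "hins (opair (ord_nat (length u)) (ord_nat 0)) (hstring u) = hstring (u @ [False])" for u
    by (simp_all add: hstring_snoc hbit_def)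
  have "hleft (hs A) (hstring t) \<longleftrightarrow>
      (\<forall>u. elts (hstring (u @ [True])) \<subseteq> elts (hstring t) \<longrightarrow> hcov (hs A) (hstring (u @ [False])))"
    unfolding hleft_def by (simp add: * del: elts_hstring elts_hins)
  then show ?thesis unfolding hstring_sub_hstring leftmost_def hcov_iff by simp
qed

text \<open>Otherwise the root has no bar, and the leftmost unbarred path is definable from
  \<open>A\<close>: a real of \<open>M\<close> outside \<open>U A\<close>.\<close>

lemma konig: assumes "A \<in> sset" "RM \<subseteq> U A" shows "U A = UNIV"
proof (rule ccontr)
  assume "U A \<noteq> UNIV"
  then have nb: "\<not> bcov A []" using bcov_Nil_U by blast
  define x where "x n = lpath A (Suc n) ! n" for n
  have lp: "lpath A n = map x [0..<n]" for n
  proof (rule nth_equalityI)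
    fix i assume "i < length (lpath A n)"
    then show "lpath A n ! i = map x [0..<n] ! i"
      using arg_cong[OF take_lpath[of "Suc i" n A], of "\<lambda>t. t ! i"] by (simp add: x_def del: lpath.simps)
  qed simp
  have "hset {p \<in> elts (hUnion Str). \<exists>t\<in>elts Str. \<not> hcov (hs A) t \<and> hleft (hs A) t \<and> p \<in> elts t} \<in> M"
    unfolding hleft_def hcov_def using assms(1) unfolding sset_def
    by (intro sep_M Union_M Str_M dfn_intro) auto
  moreover have "hset {p \<in> elts (hUnion Str). \<exists>t\<in>elts Str. \<not> hcov (hs A) t \<and> hleft (hs A) t \<and> p \<in> elts t} = hreal x"
  proof (rule hc_ext, unfold elts_sep, intro equalityI subsetI)
    fix p assume "p \<in> {p \<in> elts (hUnion Str). \<exists>t\<in>elts Str. \<not> hcov (hs A) t \<and> hleft (hs A) t \<and> p \<in> elts t}"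
    then obtain t where t: "\<not> bcov A t" "leftmost A t" "p \<in> elts (hstring t)"
      by (auto simp: hcov_iff hleft_iff simp del: elts_hstring)
    then have "t = map x [0..<length t]" using lpath_unique[OF nb, of t] lp by metis
    then have "x \<in> cyl t" by (simp add: cyl_map)
    then show "p \<in> elts (hreal x)" using t(3) hstring_sub_hreal by blast
  next
    fix p assume "p \<in> elts (hreal x)"
    then obtain n where n: "p = opair (ord_nat n) (hbit (x n))" by auto
    define t where "t = lpath A (Suc n)"
    have "p \<in> elts (hstring t)" unfolding n t_def lp by (auto intro!: image_eqI[of _ _ n] simp del: upt_Suc)
    moreover have "\<not> hcov (hs A) (hstring t) \<and> hleft (hs A) (hstring t)"
      unfolding hcov_iff hleft_iff lpath_unique[OF nb] by (simp add: t_def del: lpath.simps)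
    ultimately show "p \<in> {p \<in> elts (hUnion Str). \<exists>t\<in>elts Str. \<not> hcov (hs A) t \<and> hleft (hs A) t \<and> p \<in> elts t}"
      unfolding elts_hUnion elts_Str by blast
  qed
  ultimately have "x \<in> RM" by (simp add: reals_of_def)
  then obtain s where s: "s \<in> A" "x \<in> cyl s" using assms(2) by (auto simp: U_def)
  then have "lpath A (length s) = s" by (simp add: lp cyl_map)
  moreover have "bcov A s" unfolding bcov_def using s(1) by (intro exI[of _ "length s"]) auto
  ultimately show False using lpath_not_bcov[OF nb, of "length s"] by simp
qed

definition hmeet :: "hc \<Rightarrow> hc \<Rightarrow> hc" where
  "hmeet a b = hset {t \<in> elts Str. (\<exists>s\<in>elts a. elts s \<subseteq> elts t) \<and> (\<exists>s\<in>elts b. elts s \<subseteq> elts t)}"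

lemma dtm_hmeet [dfn_intro]: "dtm t \<Longrightarrow> dtm s \<Longrightarrow> dtm (\<lambda>e. hmeet (t e) (s e))"
  by (rule dtm_subst2) (unfold hmeet_def, intro dfn_intro)

lemma hmeet_hs: "hmeet (hs A) (hs B) = hs (meet A B)"
  unfolding hmeet_def by (rule hc_ext, unfold elts_sep)
    (force simp: meet_def hstring_sub_hstring simp del: elts_hstring)

lemma meet_sset: "A \<in> sset \<Longrightarrow> B \<in> sset \<Longrightarrow> meet A B \<in> sset"
  unfolding sset_def mem_Collect_eq hmeet_hs[symmetric]
  by (rule dtm_M2[of hmeet, OF dtm_hmeet[OF dtm_var dtm_var]])

lemma Un_sset: "A \<in> sset \<Longrightarrow> B \<in> sset \<Longrightarrow> A \<union> B \<in> sset"
proof -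
  assume "A \<in> sset" "B \<in> sset"
  then have "hUnion (hset {hs A, hs B}) \<in> M" by (intro Union_M pair_M) (auto simp: sset_def)
  moreover have "hUnion (hset {hs A, hs B}) = hs (A \<union> B)" by (rule hc_ext) auto
  ultimately show ?thesis by (simp add: sset_def)
qed

lemma UN_sset: assumes "hseq (\<lambda>n. hs (A n)) \<in> M" shows "(\<Union>n. A n) \<in> sset"
proof -
  have "dtm (\<lambda>e. hUnion (hset (hsnd ` elts (e 0))))" by (intro dfn_intro)
  from dtm_M1[OF this assms] have "hUnion (hset (hsnd ` elts (hseq (\<lambda>n. hs (A n))))) \<in> M" .
  moreover have "hUnion (hset (hsnd ` elts (hseq (\<lambda>n. hs (A n))))) = hs (\<Union>n. A n)"
    by (rule hc_ext) auto
  ultimately show ?thesis by (simp add: sset_def)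
qed

definition hlev :: "hc \<Rightarrow> hc \<Rightarrow> hc" where
  "hlev a L = hset {t \<in> elts Str. hdom t = L \<and> (\<exists>s\<in>elts a. elts s \<subseteq> elts t)}"

lemma dtm_hlev [dfn_intro]: "dtm t \<Longrightarrow> dtm s \<Longrightarrow> dtm (\<lambda>e. hlev (t e) (s e))"
  by (rule dtm_subst2) (unfold hlev_def, intro dfn_intro)

lemma elts_hlev [simp]: "elts (hlev (hs A) (ord_nat L)) = hstring ` lev A L"
  unfolding hlev_def elts_sep by (force simp: lev_def hstring_sub_hstring simp del: elts_hstring)

text \<open>For a string \<open>z\<close> of length \<open>k\<close>: the open set coded by \<open>a\<close> has measure at most \<open>2\<^sup>-\<^sup>k\<close>,
  because each level of \<open>a\<close> injects into the extensions of \<open>z\<close>.\<close>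

definition small :: "hc \<Rightarrow> hc \<Rightarrow> bool" where
  "small z a \<longleftrightarrow> (\<forall>L\<in>elts omega. elts (hdom z) \<subseteq> elts L \<longrightarrow>
     (\<exists>g\<in>M. \<forall>t\<in>elts (hlev a L). \<exists>u\<in>elts (hlev (hset {z}) L).
        opair t u \<in> elts g \<and> (\<forall>t'\<in>elts (hlev a L). opair t' u \<in> elts g \<longrightarrow> t' = t)))"

lemma dfn_small [dfn_intro]: "dtm t \<Longrightarrow> dtm s \<Longrightarrow> dfn (\<lambda>e. small (t e) (s e))"
  by (rule dfn_subst2) (unfold small_def, intro dfn_intro)

lemma card_lev_sing: assumes "length z \<le> L" shows "card (lev {z} L) = 2 ^ (L - length z)"
proof -
  have "bij_betw (\<lambda>u. z @ u) {u. length u = L - length z} (lev {z} L)"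
  proof (rule bij_betwI[of _ _ _ "drop (length z)"])
    show "z @ drop (length z) t = t" if "t \<in> lev {z} L" for t
      using that by (auto simp: lev_def) (metis append_take_drop_id)
  qed (use assms in \<open>auto simp: lev_def\<close>)
  then show ?thesis using bij_betw_same_card finite_length(2) by metis
qed

text \<open>Injections between levels are finite, hence can be taken in \<open>M\<close>, so
  \<open>M\<close> compares the sizes of levels correctly and \<open>measure_U_le\<close>
  applies.\<close>

lemma small_iff: "small (hstring z) (hs A) \<longleftrightarrow> measure coin (U A) \<le> (1/2) ^ length z"
proof -
  have sing: "hset {hstring z} = hs {z}" by (simp add: hs_def)
  have "(\<exists>g\<in>M. \<forall>t\<in>hstring ` lev A L. \<exists>u\<in>hstring ` lev {z} L.
        opair t u \<in> elts g \<and> (\<forall>t'\<in>hstring ` lev A L. opair t' u \<in> elts g \<longrightarrow> t' = t))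
      \<longleftrightarrow> card (lev A L) \<le> 2 ^ (L - length z)" if L: "length z \<le> L" for L
  proof
    assume "\<exists>g\<in>M. \<forall>t\<in>hstring ` lev A L. \<exists>u\<in>hstring ` lev {z} L.
        opair t u \<in> elts g \<and> (\<forall>t'\<in>hstring ` lev A L. opair t' u \<in> elts g \<longrightarrow> t' = t)"
    then obtain g where "\<forall>t\<in>lev A L. \<exists>u\<in>lev {z} L.
        opair (hstring t) (hstring u) \<in> elts g \<and> (\<forall>t'\<in>lev A L. opair (hstring t') (hstring u) \<in> elts g \<longrightarrow> t' = t)"
      by auto
    then have "\<forall>t\<in>lev A L. \<exists>u. u \<in> lev {z} L \<and>
        opair (hstring t) (hstring u) \<in> elts g \<and> (\<forall>t'\<in>lev A L. opair (hstring t') (hstring u) \<in> elts g \<longrightarrow> t' = t)"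
      by blast
    from bchoice[OF this] obtain h where h: "\<forall>t\<in>lev A L. h t \<in> lev {z} L \<and>
        opair (hstring t) (hstring (h t)) \<in> elts g \<and> (\<forall>t'\<in>lev A L. opair (hstring t') (hstring (h t)) \<in> elts g \<longrightarrow> t' = t)"
      by blast
    then have "inj_on h (lev A L)" by (intro inj_onI) metis
    moreover have "h ` lev A L \<subseteq> lev {z} L" using h by blast
    ultimately have "card (lev A L) \<le> card (lev {z} L)" by (intro card_inj_on_le) auto
    then show "card (lev A L) \<le> 2 ^ (L - length z)" by (simp add: card_lev_sing[OF L])
  next
    assume "card (lev A L) \<le> 2 ^ (L - length z)"
    then have "card (lev A L) \<le> card (lev {z} L)" by (simp add: card_lev_sing[OF L])
    then obtain h where h: "h ` lev A L \<subseteq> lev {z} L" "inj_on h (lev A L)"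
      using card_le_inj[of "lev A L" "lev {z} L"] by auto
    define g where "g = hset ((\<lambda>t. opair (hstring t) (hstring (h t))) ` lev A L)"
    have eg: "elts g = (\<lambda>t. opair (hstring t) (hstring (h t))) ` lev A L" by (simp add: g_def countable_finite)
    have "g \<in> M" unfolding g_def by (intro finite_M) (auto intro: opair_M)
    moreover have "\<forall>t\<in>lev A L. h t \<in> lev {z} L \<and>
        opair (hstring t) (hstring (h t)) \<in> elts g \<and> (\<forall>t'\<in>lev A L. opair (hstring t') (hstring (h t)) \<in> elts g \<longrightarrow> t' = t)"
      using h unfolding eg by (auto simp: inj_on_eq_iff)
    ultimately show "\<exists>g\<in>M. \<forall>t\<in>hstring ` lev A L. \<exists>u\<in>hstring ` lev {z} L.
        opair t u \<in> elts g \<and> (\<forall>t'\<in>hstring ` lev A L. opair t' u \<in> elts g \<longrightarrow> t' = t)"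
      by (intro bexI[of _ g]) auto
  qed
  then show ?thesis
    unfolding small_def measure_U_le sing by (auto simp del: elts_hstring)
qed

end

section \<open>Absoluteness of the measure of Borel codes\<close>

lemma minus_sets [simp]: "A \<in> sets borel \<Longrightarrow> - A \<in> sets (borel :: (nat \<Rightarrow> bool) measure)"
  using sets.compl_sets[of A borel] by (simp add: Compl_eq_Diff_UNIV)

context ctm begin

lemma dtm_funpow_hins: "dtm t \<Longrightarrow> dtm (\<lambda>e. ((\<lambda>x. hins x x) ^^ m) (t e))"
  by (induction m) (auto intro: dtm_hins)

lemma funpow_hins [simp]: "((\<lambda>x. hins x x) ^^ m) (ord_nat n) = ord_nat (m + n)"
  by (induction m) (simp_all add: ord_nat_Suc)

text \<open>Outer approximations in \<open>M\<close> of a coded set and of its complement, valid for both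
  interpretations of the code up to null sets.\<close>

definition approx :: "borel_code \<Rightarrow> bool" where
  "approx c \<longleftrightarrow> (\<forall>k. \<exists>A\<in>sset. \<exists>B\<in>sset. interp RM c \<subseteq> U A \<and> RM - interp RM c \<subseteq> U B \<and>
     measure coin (U A \<inter> U B) \<le> (1/2) ^ k \<and>
     measure coin (interp UNIV c - U A) = 0 \<and> measure coin (- interp UNIV c - U B) = 0)"

lemma approxD:
  assumes "approx c"
  obtains A B where "A \<in> sset" "B \<in> sset" "interp RM c \<subseteq> U A" "RM - interp RM c \<subseteq> U B"
    "measure coin (U A \<inter> U B) \<le> (1/2) ^ k"
    "measure coin (interp UNIV c - U A) = 0" "measure coin (- interp UNIV c - U B) = 0"
  using assms unfolding approx_def by metis

lemma coin_null_subset: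
  assumes "A \<subseteq> B" "measure coin B = 0" "B \<in> sets borel" shows "measure coin A = 0"
  using coin.finite_measure_mono[of A B] assms by (simp add: measure_le_0_iff)

lemma le_power_half_0: assumes "\<And>k. x \<le> (1/2 :: real) ^ k" shows "x \<le> 0"
proof -
  have "(\<lambda>k. (1/2 :: real) ^ k) \<longlonglongrightarrow> 0" by (rule LIMSEQ_power_zero) simp
  then show ?thesis by (rule LIMSEQ_le_const) (use assms in auto)
qed

text \<open>By compactness, an open cover in \<open>M\<close> of \<open>c\<close> together with an open cover in \<open>M\<close> of its
  complement covers the whole space also outside \<open>M\<close>.\<close>

lemma approx_cover:
  assumes c: "approx c" and A: "A \<in> sset" "interp RM c \<subseteq> U A"
  shows "measure coin (interp UNIV c - U A) = 0"
proof -
  have "measure coin (interp UNIV c - U A) \<le> (1/2) ^ k" for k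
  proof -
    obtain C B where CB: "C \<in> sset" "B \<in> sset" "interp RM c \<subseteq> U C" "RM - interp RM c \<subseteq> U B"
      "measure coin (U C \<inter> U B) \<le> (1/2) ^ k" "measure coin (interp UNIV c - U C) = 0"
      using approxD[OF c, of k] by metis
    have "RM \<subseteq> U (A \<union> B)" using A(2) CB(4) by (auto simp: U_Un)
    then have "U A \<union> U B = UNIV" using konig[OF Un_sset[OF A(1) CB(2)]] by (simp add: U_Un)
    then have "interp UNIV c - U A \<subseteq> (interp UNIV c - U C) \<union> (U C \<inter> U B)" by blast
    then have "measure coin (interp UNIV c - U A) \<le> measure coin ((interp UNIV c - U C) \<union> (U C \<inter> U B))"
      by (intro coin.finite_measure_mono) auto
    also have "\<dots> \<le> measure coin (interp UNIV c - U C) + measure coin (U C \<inter> U B)"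
      by (intro measure_Un_le) auto
    finally show ?thesis using CB by simp
  qed
  then have "measure coin (interp UNIV c - U A) \<le> 0" by (rule le_power_half_0)
  then show ?thesis by (simp add: measure_le_0_iff)
qed

lemma approx_Compl: assumes "approx c" shows "approx (Compl c)"
  unfolding approx_def
proof
  fix k
  obtain A B where AB: "A \<in> sset" "B \<in> sset" "interp RM c \<subseteq> U A" "RM - interp RM c \<subseteq> U B"
    "measure coin (U A \<inter> U B) \<le> (1/2) ^ k"
    "measure coin (interp UNIV c - U A) = 0" "measure coin (- interp UNIV c - U B) = 0"
    using approxD[OF assms, of k] by metis
  then show "\<exists>A\<in>sset. \<exists>B\<in>sset. interp RM (Compl c) \<subseteq> U A \<and> RM - interp RM (Compl c) \<subseteq> U B \<and>
     measure coin (U A \<inter> U B) \<le> (1/2) ^ k \<and>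
     measure coin (interp UNIV (Compl c) - U A) = 0 \<and> measure coin (- interp UNIV (Compl c) - U B) = 0"
    using interp_subset[of RM c]
    by (intro bexI[of _ B] bexI[of _ A]) (auto simp: Int_commute Compl_eq_Diff_UNIV Diff_Diff_Int)
qed

lemma sset_sing: "{s} \<in> sset" and sset_level: "{t. length t = n \<and> t \<noteq> s} \<in> sset"
proof -
  have "finite A \<Longrightarrow> A \<in> sset" for A
    unfolding sset_def hs_def mem_Collect_eq by (rule finite_M) auto
  then show "{s} \<in> sset" "{t. length t = n \<and> t \<noteq> s} \<in> sset"
    by (auto intro: finite_subset[OF _ finite_length(1)])
qed

lemma approx_Basic: "approx (Basic s)"
  unfolding approx_def
proof
  fix k
  have "U {t. length t = length s \<and> t \<noteq> s} = - cyl s"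
  proof
    show "- cyl s \<subseteq> U {t. length t = length s \<and> t \<noteq> s}"
    proof
      fix x assume "x \<in> - cyl s"
      then have "map x [0..<length s] \<noteq> s" by (simp add: cyl_map)
      then show "x \<in> U {t. length t = length s \<and> t \<noteq> s}"
        unfolding U_def by (intro UN_I[of "map x [0..<length s]"]) (auto simp: cyl_map)
    qed
  qed (auto simp: U_def cyl_map)
  then show "\<exists>A\<in>sset. \<exists>B\<in>sset. interp RM (Basic s) \<subseteq> U A \<and> RM - interp RM (Basic s) \<subseteq> U B \<and>
     measure coin (U A \<inter> U B) \<le> (1/2) ^ k \<and>
     measure coin (interp UNIV (Basic s) - U A) = 0 \<and> measure coin (- interp UNIV (Basic s) - U B) = 0"
    by (intro bexI[OF _ sset_sing[of s]] bexI[OF _ sset_level[of "length s" s]]) (auto simp: U_def)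
qed

text \<open>The covers asked for in \<open>approx\<close> as a relation over \<open>M\<close>, with
  \<open>y\<close> the pair of them, so that choice in \<open>M\<close> can pick them for countably
  many sets at once. The precision \<open>m + n\<close> improves with the index.\<close>

definition cover_pair :: "nat \<Rightarrow> hc \<Rightarrow> hc \<Rightarrow> hc \<Rightarrow> bool" where
  "cover_pair m X n y \<longleftrightarrow> (\<exists>a\<in>M. \<exists>b\<in>M. y = opair a b \<and> elts a \<subseteq> elts Str \<and> elts b \<subseteq> elts Str \<and>
     (\<forall>x\<in>elts X. \<exists>s\<in>elts a. elts s \<subseteq> elts x) \<and>
     (\<forall>x\<in>elts RMh. x \<notin> elts X \<longrightarrow> (\<exists>s\<in>elts b. elts s \<subseteq> elts x)) \<and>
     (\<exists>z\<in>elts Str. hdom z = ((\<lambda>x. hins x x) ^^ m) n \<and> small z (hmeet a b)))"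

lemma hs_cover: "Y \<subseteq> RM \<Longrightarrow> (\<forall>x\<in>elts (hreals Y). \<exists>s\<in>elts (hs A). elts s \<subseteq> elts x) \<longleftrightarrow> Y \<subseteq> U A"
  by (auto simp: hstring_sub_hreal U_def simp del: elts_hreal elts_hstring)

lemma hs_cover': "Y \<subseteq> RM \<Longrightarrow> (\<forall>x\<in>elts RMh. x \<notin> elts (hreals Y) \<longrightarrow> (\<exists>s\<in>elts (hs A). elts s \<subseteq> elts x)) \<longleftrightarrow> RM - Y \<subseteq> U A"
  by (auto simp: hstring_sub_hreal U_def image_iff simp del: elts_hreal elts_hstring)

lemma cover_pair_iff:
  assumes "Y \<subseteq> RM"
  shows "cover_pair m (hreals Y) (ord_nat n) y \<longleftrightarrow> (\<exists>A\<in>sset. \<exists>B\<in>sset. y = opair (hs A) (hs B) \<and>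
     Y \<subseteq> U A \<and> RM - Y \<subseteq> U B \<and> measure coin (U A \<inter> U B) \<le> (1/2) ^ (m + n))"
proof -
  have z: "(\<exists>z\<in>elts Str. hdom z = ((\<lambda>x. hins x x) ^^ m) (ord_nat n) \<and> small z (hmeet (hs A) (hs B)))
      \<longleftrightarrow> measure coin (U A \<inter> U B) \<le> (1/2) ^ (m + n)" for A B
  proof -
    have "\<exists>z :: bool list. length z = m + n" by (intro exI[of _ "replicate (m + n) False"]) simp
    then show ?thesis by (auto simp: hmeet_hs small_iff U_meet)
  qed
  show ?thesis
  proof
    assume "cover_pair m (hreals Y) (ord_nat n) y"
    then obtain a b where ab: "a \<in> M" "b \<in> M" "y = opair a b" "elts a \<subseteq> elts Str" "elts b \<subseteq> elts Str"
      "\<forall>x\<in>elts (hreals Y). \<exists>s\<in>elts a. elts s \<subseteq> elts x"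
      "\<forall>x\<in>elts RMh. x \<notin> elts (hreals Y) \<longrightarrow> (\<exists>s\<in>elts b. elts s \<subseteq> elts x)"
      "\<exists>z\<in>elts Str. hdom z = ((\<lambda>x. hins x x) ^^ m) (ord_nat n) \<and> small z (hmeet a b)"
      unfolding cover_pair_def by blast
    obtain A B where AB: "a = hs A" "A \<in> sset" "b = hs B" "B \<in> sset"
      using hs_cases[OF ab(1,4)] hs_cases[OF ab(2,5)] by metis
    show "\<exists>A\<in>sset. \<exists>B\<in>sset. y = opair (hs A) (hs B) \<and>
     Y \<subseteq> U A \<and> RM - Y \<subseteq> U B \<and> measure coin (U A \<inter> U B) \<le> (1/2) ^ (m + n)"
      using ab(6-8) AB(2,4) unfolding AB(1,3) hs_cover[OF assms] hs_cover'[OF assms] z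
      by (intro bexI[of _ A] bexI[of _ B]) (use ab(3) AB in auto)
  next
    assume "\<exists>A\<in>sset. \<exists>B\<in>sset. y = opair (hs A) (hs B) \<and>
     Y \<subseteq> U A \<and> RM - Y \<subseteq> U B \<and> measure coin (U A \<inter> U B) \<le> (1/2) ^ (m + n)"
    then obtain A B where AB: "A \<in> sset" "B \<in> sset" "y = opair (hs A) (hs B)"
     "Y \<subseteq> U A" "RM - Y \<subseteq> U B" "measure coin (U A \<inter> U B) \<le> (1/2) ^ (m + n)" by blast
    then show "cover_pair m (hreals Y) (ord_nat n) y"
      unfolding cover_pair_def using hs_cover[OF assms, of A] hs_cover'[OF assms, of B] z[of A B]
      by (rule_tac bexI[of _ "hs A"], rule_tac bexI[of _ "hs B"])
        (auto simp: sset_def simp del: elts_hstring)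
  qed
qed

lemma dfn_cover_pair: "dtm X \<Longrightarrow> dtm n \<Longrightarrow> dtm y \<Longrightarrow> dfn (\<lambda>e. cover_pair m (X e) (n e) (y e))"
  by (rule dfn_subst3[of "cover_pair m"]) (unfold cover_pair_def, intro dfn_intro dtm_funpow_hins)

lemma meet_upto:
  fixes N :: nat
  assumes "\<And>n. B n \<in> sset" shows "\<exists>C\<in>sset. U C = (\<Inter>n\<le>N. U (B n))"
proof (induction N)
  case (Suc N)
  then obtain C where "C \<in> sset" "U C = (\<Inter>n\<le>N. U (B n))" by blast
  then show ?case using assms
    by (intro bexI[OF _ meet_sset[of C "B (Suc N)"]]) (auto simp: U_meet atMost_Suc)
qed (use assms in auto)

text \<open>The covers \<open>A n\<close> are united, but an infinite intersection of the open sets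
  \<open>U (B n)\<close> need not be open; only \<open>n \<le> N\<close> are used. The bound
  \<open>N\<close> is found in the universe, which is harmless for a number. What
  \<open>U (\<Union>n. A n)\<close> and \<open>U C\<close> share lies in the overlaps of the pairs,
  the tail \<open>?D N\<close> and null sets.\<close>

lemma approx_Union:
  assumes f: "Union f \<in> codes" and ap: "\<And>n. approx (f n)" shows "approx (Union f)"
  unfolding approx_def
proof
  fix k
  let ?V = "\<lambda>n. interp UNIV (f n)" and ?Y = "\<lambda>n. interp RM (f n)"
  define F where "F = hseq (\<lambda>n. hcode (f n))"
  have F: "F \<in> M" using f by (simp add: F_def)
  \<comment> \<open>The precisions \<open>k + 2 + n\<close> allow errors with sum
    \<open>(1/2) ^ (k + 1)\<close>, which leaves the other half for the tail.\<close>
  have "dfn (\<lambda>e. cover_pair (k + 2) (Iop (app F (e 0))) (e 0) (e 1))"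
    by (intro dfn_cover_pair dfn_intro dtm_const F)
  moreover have "\<exists>y\<in>M. cover_pair (k + 2) (Iop (app F (ord_nat n))) (ord_nat n) y" for n
  proof -
    obtain A B where "A \<in> sset" "B \<in> sset" "?Y n \<subseteq> U A" "RM - ?Y n \<subseteq> U B"
      "measure coin (U A \<inter> U B) \<le> (1/2) ^ (k + 2 + n)"
      using approxD[OF ap[of n], of "k + 2 + n"] by metis
    then have "cover_pair (k + 2) (hreals (?Y n)) (ord_nat n) (opair (hs A) (hs B))"
      unfolding cover_pair_iff[OF interp_subset] by blast
    moreover have "opair (hs A) (hs B) \<in> M"
      using \<open>A \<in> sset\<close> \<open>B \<in> sset\<close> by (auto simp: sset_def intro: opair_M)
    ultimately show ?thesis by (auto simp: F_def Iop_hcode)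
  qed
  ultimately obtain g where g: "\<And>n. cover_pair (k + 2) (hreals (?Y n)) (ord_nat n) (g n)" "hseq g \<in> M"
    using choice_M[of "\<lambda>n y. cover_pair (k + 2) (Iop (app F n)) n y"] by (auto simp: F_def Iop_hcode)
  then have "\<forall>n. \<exists>A B. A \<in> sset \<and> B \<in> sset \<and> g n = opair (hs A) (hs B) \<and> ?Y n \<subseteq> U A \<and>
      RM - ?Y n \<subseteq> U B \<and> measure coin (U A \<inter> U B) \<le> (1/2) ^ (k + 2 + n)"
    unfolding cover_pair_iff[OF interp_subset] by blast
  then obtain A B where AB: "\<And>n. A n \<in> sset" "\<And>n. B n \<in> sset" "\<And>n. g n = opair (hs (A n)) (hs (B n))"
    "\<And>n. ?Y n \<subseteq> U (A n)" "\<And>n. RM - ?Y n \<subseteq> U (B n)"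
    "\<And>n. measure coin (U (A n) \<inter> U (B n)) \<le> (1/2) ^ (k + 2 + n)" by metis
  have nullA: "measure coin (?V n - U (A n)) = 0" for n
    using approx_cover[OF ap AB(1) AB(4)] .
  have nullB: "measure coin (- ?V n - U (B n)) = 0" for n
    using approx_cover[OF approx_Compl[OF ap[of n]] AB(2)[of n]] AB(5)[of n] by (simp add: Compl_eq_Diff_UNIV)
  have "hseq (\<lambda>n. hs (A n)) \<in> M"
    by (rule hseq_map_M[OF dtm_hfst[OF dtm_var] g(2)]) (simp add: AB(3))
  then have A: "(\<Union>n. A n) \<in> sset" by (rule UN_sset)
  let ?D = "\<lambda>N. (\<Union>n. ?V n) - (\<Union>n\<le>N. ?V n)"
  have "(\<lambda>N. measure coin (?D N)) \<longlonglongrightarrow> measure coin (\<Inter>N. ?D N)"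
  proof (rule coin.finite_Lim_measure_decseq)
    show "range ?D \<subseteq> coin.events" by auto
    show "decseq ?D" unfolding decseq_def by (intro allI impI Diff_mono UN_mono) auto
  qed
  moreover have "(\<Inter>N. ?D N) = {}" by auto
  ultimately have "(\<lambda>N. measure coin (?D N)) \<longlonglongrightarrow> 0" by (simp only: measure_empty)
  then have "\<forall>\<^sub>F N in sequentially. measure coin (?D N) < (1/2) ^ (k + 1)"
    by (rule order_tendstoD) simp
  from eventually_happens'[OF sequentially_bot this]
  obtain N where N: "measure coin (?D N) < (1/2) ^ (k + 1)" by (elim exE)
  from meet_upto[of B N, OF AB(2)]
  obtain C where C: "C \<in> sset" "U C = (\<Inter>n\<le>N. U (B n))" by (elim bexE)
  let ?E = "\<Union>n. U (A n) \<inter> U (B n)"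
  let ?N = "(\<Union>n. - ?V n - U (B n)) \<union> (\<Union>n. ?V n - U (A n))"
  have nullN: "measure coin ?N = 0"
  proof -
    have "(\<Union>n. - ?V n - U (B n)) \<in> null_sets coin" "(\<Union>n. ?V n - U (A n)) \<in> null_sets coin"
      using nullA nullB by (auto intro!: null_sets_UN null_setsI simp: coin.emeasure_eq_measure)
    then have "?N \<in> null_sets coin" by (rule null_sets.Un)
    then show ?thesis by (simp add: measure_def null_setsD1)
  qed
  have sums: "(\<lambda>n. (1/2 :: real) ^ (k + 2 + n)) sums (1/2) ^ (k + 1)"
    using sums_mult[OF geometric_sums[of "1/2 :: real"], of "(1/2) ^ (k + 2)"] by (simp add: power_add)
  have E: "measure coin ?E \<le> (1/2) ^ (k + 1)"
  proof -
    have "measure coin ?E \<le> (\<Sum>n. measure coin (U (A n) \<inter> U (B n)))"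
      by (intro coin.finite_measure_subadditive_countably summable_comparison_test[OF _ sums_summable[OF sums]])
        (use AB(6) in auto)
    also have "\<dots> \<le> (\<Sum>n. (1/2) ^ (k + 2 + n))"
      by (intro suminf_le summable_comparison_test[OF _ sums_summable[OF sums]] sums_summable[OF sums])
        (use AB(6) in auto)
    finally show ?thesis using sums_unique[OF sums] by simp
  qed
  have "U (\<Union>n. A n) \<inter> U C \<subseteq> ?E \<union> (?D N \<union> ?N)"
    unfolding C(2) U_UN by blast
  then have "measure coin (U (\<Union>n. A n) \<inter> U C) \<le> measure coin (?E \<union> (?D N \<union> ?N))"
    by (intro coin.finite_measure_mono) auto
  also have "\<dots> \<le> measure coin ?E + (measure coin (?D N) + measure coin ?N)"
    by (intro order_trans[OF measure_Un_le] add_left_mono measure_Un_le) auto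
  also have "\<dots> \<le> (1/2) ^ k" using E N nullN by simp
  finally have "measure coin (U (\<Union>n. A n) \<inter> U C) \<le> (1/2) ^ k" .
  moreover have "interp RM (Union f) \<subseteq> U (\<Union>n. A n)" using AB(4) by (auto simp: U_UN)
  moreover have "RM - interp RM (Union f) \<subseteq> U C" using AB(5) unfolding C(2) by auto
  moreover have "measure coin (interp UNIV (Union f) - U (\<Union>n. A n)) = 0"
    by (rule coin_null_subset[OF _ nullN]) (auto simp: U_UN)
  moreover have "measure coin (- interp UNIV (Union f) - U C) = 0"
    by (rule coin_null_subset[OF _ nullN]) (auto simp: C(2))
  ultimately show "\<exists>A\<in>sset. \<exists>B\<in>sset. interp RM (Union f) \<subseteq> U A \<and> RM - interp RM (Union f) \<subseteq> U B \<and>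
     measure coin (U A \<inter> U B) \<le> (1/2) ^ k \<and>
     measure coin (interp UNIV (Union f) - U A) = 0 \<and> measure coin (- interp UNIV (Union f) - U B) = 0"
    using A C(1) by blast
qed

lemma approx: "c \<in> codes \<Longrightarrow> approx c"
proof (induction c)
  case (Union f)
  show ?case
    by (rule approx_Union[OF Union.prems]) (rule Union.IH[OF rangeI codes_UnionD[OF Union.prems]])
qed (auto intro: approx_Basic approx_Compl)

end

text \<open>Successor in the enumeration of all strings that reads them as numerals in bijective base 2.\<close>

fun nx :: "bool list \<Rightarrow> bool list" where
  "nx [] = [False]"
| "nx (False # s) = True # s"
| "nx (True # s) = False # nx s"

fun sval :: "bool list \<Rightarrow> nat" where
  "sval [] = 0"
| "sval (b # s) = (if b then 2 else 1) + 2 * sval s"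

lemma sval_nx: "sval (nx s) = Suc (sval s)"
  by (induction s rule: nx.induct) auto

lemma sval_inj: "sval s = sval t \<Longrightarrow> s = t"
proof (induction s arbitrary: t)
  case Nil
  then show ?case by (cases t) (auto split: if_splits)
next
  case (Cons b s)
  then obtain c t' where t: "t = c # t'" by (cases t) (auto split: if_splits)
  have "b = c \<and> sval s = sval t'" using Cons.prems unfolding t sval.simps by (cases b; cases c; simp; presburger)
  then show ?case using Cons.IH t by blast
qed

lemma bij_nx: "inj (\<lambda>n. (nx ^^ n) [])" "\<exists>n. (nx ^^ n) [] = s"
proof -
  have v: "sval ((nx ^^ n) []) = n" for n by (induction n) (auto simp: sval_nx)
  show "inj (\<lambda>n. (nx ^^ n) [])" by (rule inj_on_inverseI[of _ sval]) (rule v)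
  show "\<exists>n. (nx ^^ n) [] = s" using v[of "sval s"] sval_inj by blast
qed

lemma nx_eq:
  "nx s = (let i = length (takeWhile id s) in replicate i False @ (if i < length s then True # drop (Suc i) s else [False]))"
proof (induction s rule: nx.induct)
  case (3 s)
  then show ?case by (simp add: Let_def)
qed simp_all

section \<open>The measure of \<open>M\<close> compared with the coin-tossing measure\<close>

context ctm begin

lemma dtm_if [dfn_intro]: assumes "dfn P" "dtm t" "dtm s" shows "dtm (\<lambda>e. if P e then t e else s e)"
  unfolding dtm_def
proof safe
  show "(if P e then t e else s e) \<in> M" if "\<forall>i. e i \<in> M" for e
    using assms that by (auto simp: dtm_def)
  have "dfn (\<lambda>e. (P (\<lambda>n. e (Suc n)) \<and> e 0 = t (\<lambda>n. e (Suc n))) \<or> (\<not> P (\<lambda>n. e (Suc n)) \<and> e 0 = s (\<lambda>n. e (Suc n))))"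
    using dfn_shift[OF assms(1)] assms(2,3) unfolding dtm_def
    by (rule_tac dfn_disj[OF dfn_conj dfn_conj[OF dfn_neg]]) auto
  then show "dfn (\<lambda>e. e 0 = (if P (\<lambda>n. e (Suc n)) then t (\<lambda>n. e (Suc n)) else s (\<lambda>n. e (Suc n))))"
    by (rule dfn_cong) auto
qed

lemma hUnion_ord_nat: "hUnion (ord_nat (Suc n)) = ord_nat n"
proof -
  have "(\<Union>i<Suc n. {..<i}) = {..<n}" by (auto intro: bexI[of _ n])
  then have "ord_nat ` (\<Union>i<Suc n. {..<i}) = ord_nat ` {..<n}" by simp
  then show ?thesis by (intro hc_ext) (simp add: elts_ord_nat image_UN)
qed

text \<open>\<open>hUnion\<close> is the predecessor of a nonzero number, so iteration is an
  instance of \<open>hrec\<close>.\<close>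

lemma funpow_seq_M:
  assumes "dtm (\<lambda>e. h (e 0))" "a \<in> M" shows "hseq (\<lambda>n. (h ^^ n) a) \<in> M"
proof -
  define F where "F = hrec (\<lambda>x f. if x = ord_nat 0 then a else h (app f (hUnion x)))"
  have F: "F (ord_nat n) = (h ^^ n) a" for n
  proof (induction n)
    case (Suc n)
    have "ord_nat n \<in> elts (tc (ord_nat (Suc n)))" by (rule elts_sub_tc) simp
    then show ?case unfolding F_def
      by (subst hrec) (simp add: hUnion_ord_nat Suc[unfolded F_def])
  qed (simp add: F_def hrec)
  have "dtm (\<lambda>e. F (e 0))"
    unfolding F_def by (rule dtm_hrec) (intro dfn_intro dtm_subst1[OF assms(1)] dtm_const assms(2))+
  then show ?thesis by (rule hseq_M) (rule F)
qed

definition zstr :: "hc \<Rightarrow> hc" where "zstr k = hset ((\<lambda>i. opair i (ord_nat 0)) ` elts k)"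

lemma dtm_zstr [dfn_intro]: "dtm t \<Longrightarrow> dtm (\<lambda>e. zstr (t e))"
  by (erule dtm_subst1[rotated]) (unfold zstr_def, intro dfn_intro)

lemma zstr_ord_nat [simp]: "zstr (ord_nat n) = hstring (replicate n False)"
  by (rule hc_ext) (auto simp: zstr_def elts_ord_nat hbit_def image_image)

text \<open>The place where the carry stops: the positions up to which all bits are
  \<open>True\<close> form an initial segment, and that set is itself the number of leading
  \<open>True\<close> bits.\<close>

definition hpivot :: "hc \<Rightarrow> hc" where
  "hpivot s = hset {j \<in> elts (hdom s). \<forall>k\<in>elts (hins j j). opair k (ord_nat 1) \<in> elts s}"

definition hnx :: "hc \<Rightarrow> hc" where
  "hnx s = hUnion (hset {hset {p \<in> elts s. hfst p \<notin> elts (hins (hpivot s) (hpivot s))},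
     hins (opair (hpivot s) (if hpivot s \<in> elts (hdom s) then ord_nat 1 else ord_nat 0)) (zstr (hpivot s))})"

lemma hpivot: "hpivot (hstring s) = ord_nat (length (takeWhile id s))"
proof -
  have "(j < length s \<and> (\<forall>k\<le>j. s ! k)) \<longleftrightarrow> j < length (takeWhile id s)" for j
  proof
    assume j: "j < length s \<and> (\<forall>k\<le>j. s ! k)"
    show "j < length (takeWhile id s)"
    proof (rule ccontr)
      assume n: "\<not> j < length (takeWhile id s)"
      then have "length (takeWhile id s) < length s" using j by simp
      then have "\<not> s ! length (takeWhile id s)" using nth_length_takeWhile by fastforce
      then show False using j n by simp
    qed
  next
    assume j: "j < length (takeWhile id s)"
    then have "s ! k" if "k \<le> j" for k
      using that nth_mem[of k "takeWhile id s"] set_takeWhileD[of _ id s] takeWhile_nth[of k id s] by fastforce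
    then show "j < length s \<and> (\<forall>k\<le>j. s ! k)"
      using j length_takeWhile_le[of id s] by auto
  qed
  note P1 = this
  have "(\<forall>k\<in>elts (hins (ord_nat j) (ord_nat j)). opair k (ord_nat 1) \<in> elts (hstring s)) \<longleftrightarrow> (\<forall>k\<le>j. s ! k)"
    if "j < length s" for j
    using that by (auto simp: elts_ord_nat hbit_def image_iff le_less)
  note P2 = this
  have "elts (hpivot (hstring s)) = ord_nat ` {j. j < length s \<and> (\<forall>k\<le>j. s ! k)}"
    unfolding hpivot_def elts_sep unfolding hdom_hstring elts_ord_nat[of "length s"] using P2 by blast
  also have "{j. j < length s \<and> (\<forall>k\<le>j. s ! k)} = {..<length (takeWhile id s)}"
    using P1 by blast
  finally show ?thesis by (intro hc_ext) (simp add: elts_ord_nat)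
qed

lemma hnx: "hnx (hstring s) = hstring (nx s)"
proof -
  define i where "i = length (takeWhile id s)"
  have i: "i \<le> length s" by (simp add: i_def length_takeWhile_le)
  have n: "nx s = replicate i False @ (if i < length s then True # drop (Suc i) s else [False])"
    by (simp add: nx_eq i_def Let_def)
  have len: "length (nx s) = (if i < length s then length s else Suc i)" using i by (auto simp: n)
  have nth: "nx s ! j = (if j < i then False else if j = i then i < length s else s ! j)" if "j < length (nx s)" for j
    using that i by (auto simp: n nth_append nth_Cons' split: if_splits)
  let ?p = "\<lambda>j. opair (ord_nat j) (hbit (nx s ! j))"
  have "elts (hset {p \<in> elts (hstring s). hfst p \<notin> elts (hins (ord_nat i) (ord_nat i))}) = ?p ` {i<..<length (nx s)}"
    unfolding elts_sep using len i by (auto simp: elts_ord_nat nth image_iff)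
  moreover have "opair (ord_nat i) (if ord_nat i \<in> elts (hdom (hstring s)) then ord_nat 1 else ord_nat 0) = ?p i"
    using len i by (simp add: nth hbit_def)
  moreover have "elts (zstr (ord_nat i)) = ?p ` {..<i}"
    using len i by (auto simp: nth)
  moreover have "{..<length (nx s)} = {i<..<length (nx s)} \<union> insert i {..<i}" using len i by auto
  ultimately show ?thesis
    unfolding hnx_def hpivot i_def[symmetric] by (intro hc_ext) (simp add: image_Un Un_commute)
qed

lemma dtm_hnx: "dtm (\<lambda>e. hnx (e 0))"
  unfolding hnx_def hpivot_def by (intro dfn_intro)

lemma enum_M: "hseq (\<lambda>n. hstring ((nx ^^ n) [])) \<in> M"
proof -
  have "(hnx ^^ n) (hstring []) = hstring ((nx ^^ n) [])" for n
    by (induction n) (auto simp: hnx)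
  then show ?thesis using funpow_seq_M[OF dtm_hnx, of "hstring []"] by simp
qed

lemma minimal_sset: assumes "A \<in> sset" shows "minimal A \<in> sset"
proof -
  have "hset {t \<in> elts (hs A). \<forall>s\<in>elts (hs A). elts s \<subseteq> elts t \<longrightarrow> s = t} \<in> M"
    using assms by (intro sep_M dfn_intro) (auto simp: sset_def)
  moreover have "hset {t \<in> elts (hs A). \<forall>s\<in>elts (hs A). elts s \<subseteq> elts t \<longrightarrow> s = t} = hs (minimal A)"
    by (rule hc_ext) (auto simp: elts_sep minimal_def hstring_sub_hstring simp del: elts_hstring)
  ultimately show ?thesis by (simp add: sset_def)
qed

text \<open>\<open>measure_in\<close> admits only sequences of \<open>M\<close>, so the strings of
  \<open>minimal A\<close> are listed along an enumeration of all strings that lies in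
  \<open>M\<close>; as their cylinders are disjoint, they contribute at most the measure of
  \<open>U A\<close>.\<close>

lemma measure_in_le_U:
  assumes "A \<in> sset" "Y \<subseteq> U A"
  shows "measure_in M Y \<le> emeasure coin (U A) + ennreal ((1/2) ^ k)"
proof -
  let ?e = "\<lambda>n. (nx ^^ n) []"
  \<comment> \<open>A cover needs a string at every index; the fillers contribute at most
    \<open>(1/2) ^ k\<close> altogether.\<close>
  define s where "s n = (if ?e n \<in> minimal A then ?e n else replicate (k + 1 + n) False)" for n
  define E where "E = hseq (\<lambda>n. hstring (?e n))"
  have E: "E \<in> M" unfolding E_def by (rule enum_M)
  have "hseq (\<lambda>n. hstring (s n)) \<in> M"
  proof (rule hseq_M)
    show "dtm (\<lambda>e. if app E (e 0) \<in> elts (hs (minimal A)) then app E (e 0) else zstr (((\<lambda>x. hins x x) ^^ (k + 1)) (e 0)))"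
      using minimal_sset[OF assms(1)] unfolding sset_def
      by (intro dfn_intro dtm_funpow_hins dtm_const E) auto
    show "(if app E (ord_nat n) \<in> elts (hs (minimal A)) then app E (ord_nat n) else zstr (((\<lambda>x. hins x x) ^^ (k + 1)) (ord_nat n))) = hstring (s n)" for n
      unfolding funpow_hins zstr_ord_nat by (auto simp: E_def s_def)
  qed
  moreover have "Y \<subseteq> (\<Union>n. cyl (s n))"
  proof
    fix x assume "x \<in> Y"
    then have "x \<in> U (minimal A)" using assms(2) by (auto simp: U_minimal)
    then obtain t where t: "t \<in> minimal A" "x \<in> cyl t" by (auto simp: U_def)
    obtain n where "?e n = t" using bij_nx(2) by blast
    then have "s n = t" using t by (simp add: s_def)
    then show "x \<in> (\<Union>n. cyl (s n))" using t by blast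
  qed
  ultimately have "measure_in M Y \<le> (\<Sum>n. ennreal ((1/2) ^ length (s n)))"
    unfolding measure_in_def by (intro INF_lower) auto
  also have "\<dots> \<le> (\<Sum>n. (if ?e n \<in> minimal A then ennreal ((1/2) ^ length (?e n)) else 0) + ennreal ((1/2) ^ (k + 1 + n)))"
    by (intro suminf_le) (auto simp: s_def)
  also have "\<dots> = (\<Sum>n. if ?e n \<in> minimal A then ennreal ((1/2) ^ length (?e n)) else 0) + (\<Sum>n. ennreal ((1/2) ^ (k + 1 + n)))"
    by (rule suminf_add[symmetric]) auto
  also have "\<dots> \<le> emeasure coin (U A) + ennreal ((1/2) ^ k)"
  proof (intro add_mono suminf_minimal bij_nx)
    have "(\<lambda>n. (1/2 :: real) ^ (k + 1 + n)) sums (1/2) ^ k"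
      using sums_mult[OF geometric_sums[of "1/2 :: real"], of "(1/2) ^ (k + 1)"] by (simp add: power_add)
    then have "(\<Sum>n. ennreal ((1/2) ^ (k + 1 + n))) = ennreal ((1/2) ^ k)"
      by (subst suminf_ennreal2) (auto simp: sums_iff)
    then show "(\<Sum>n. ennreal ((1/2) ^ (k + 1 + n))) \<le> ennreal ((1/2) ^ k)" by simp
  qed
  finally show ?thesis .
qed

lemma measure_U_approx:
  assumes "A \<in> sset" "B \<in> sset" "measure coin (U A \<inter> U B) \<le> (1/2) ^ k"
    "measure coin (- interp UNIV c - U B) = 0"
  shows "measure coin (U A) \<le> measure coin (interp UNIV c) + (1/2) ^ k"
proof -
  have "U A \<subseteq> interp UNIV c \<union> ((U A \<inter> U B) \<union> (- interp UNIV c - U B))" by blast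
  then have "measure coin (U A) \<le> measure coin (interp UNIV c \<union> ((U A \<inter> U B) \<union> (- interp UNIV c - U B)))"
    by (intro coin.finite_measure_mono) auto
  also have "\<dots> \<le> measure coin (interp UNIV c) + (measure coin (U A \<inter> U B) + measure coin (- interp UNIV c - U B))"
    by (intro order_trans[OF measure_Un_le] add_left_mono measure_Un_le) auto
  finally show ?thesis using assms by simp
qed

text \<open>A cover in \<open>M\<close> of \<open>interp RM c\<close> also covers
  \<open>interp UNIV c\<close> up to a null set, by \<open>approx_cover\<close>; conversely the
  approximations of \<open>c\<close> provide covers in \<open>M\<close> hardly larger than
  \<open>interp UNIV c\<close>. Positivity, the only thing that the poset refers to, is thus
  absolute.\<close>

lemma measure_in_0_iff:
  assumes c: "c \<in> codes"
  shows "measure_in M (interp RM c) = 0 \<longleftrightarrow> measure coin (interp UNIV c) = 0"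
proof
  assume 0: "measure_in M (interp RM c) = 0"
  have "measure coin (interp UNIV c) \<le> (1/2) ^ k" for k
  proof -
    have "measure_in M (interp RM c) < ennreal ((1/2) ^ k)" unfolding 0 by simp
    then obtain s where s: "hseq (\<lambda>n. hstring (s n)) \<in> M" "interp RM c \<subseteq> (\<Union>n. cyl (s n))"
      "(\<Sum>n. ennreal ((1/2) ^ length (s n))) < ennreal ((1/2) ^ k)"
      unfolding measure_in_def INF_less_iff by blast
    have "hseq (\<lambda>n. hs {s n}) \<in> M"
    proof (rule hseq_map_M[OF _ s(1)])
      show "dtm (\<lambda>e. hset {e 0})" by (intro dfn_intro)
    qed (simp add: hs_def)
    from UN_sset[OF this] have A: "range s \<in> sset" by (simp add: UNION_singleton_eq_range)
    have US: "U (range s) = (\<Union>n. cyl (s n))" by (simp add: U_def)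
    have "measure coin (interp UNIV c - U (range s)) = 0"
      by (rule approx_cover[OF approx[OF c] A]) (use s(2) US in simp)
    then have "emeasure coin (interp UNIV c) \<le> emeasure coin (U (range s))"
      using coin.finite_measure_mono[of "interp UNIV c" "(interp UNIV c - U (range s)) \<union> U (range s)"]
        measure_Un_le[of "interp UNIV c - U (range s)" coin "U (range s)"]
      by (auto simp: coin.emeasure_eq_measure)
    also have "\<dots> \<le> (\<Sum>n. emeasure coin (cyl (s n)))"
      unfolding US by (rule emeasure_subadditive_countably) auto
    also have "\<dots> = (\<Sum>n. ennreal ((1/2) ^ length (s n)))" by (simp add: emeasure_cyl)
    also note s(3)
    finally show ?thesis by (simp add: coin.emeasure_eq_measure ennreal_less_iff)
  qed
  then have "measure coin (interp UNIV c) \<le> 0" by (rule le_power_half_0)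
  then show "measure coin (interp UNIV c) = 0" by (simp add: measure_le_0_iff)
next
  assume 0: "measure coin (interp UNIV c) = 0"
  have "measure_in M (interp RM c) \<le> ennreal ((1/2) ^ k)" for k
  proof -
    obtain A B where AB: "A \<in> sset" "B \<in> sset" "interp RM c \<subseteq> U A"
      "measure coin (U A \<inter> U B) \<le> (1/2) ^ (k + 1)" "measure coin (- interp UNIV c - U B) = 0"
      using approxD[OF approx[OF c], of "k + 1"] by metis
    have "measure coin (U A) \<le> (1/2) ^ (k + 1)"
      using measure_U_approx[OF AB(1,2,4,5)] 0 by simp
    then have "emeasure coin (U A) + ennreal ((1/2) ^ (k + 1)) \<le> ennreal ((1/2) ^ (k + 1)) + ennreal ((1/2) ^ (k + 1))"
      by (intro add_right_mono) (simp add: coin.emeasure_eq_measure ennreal_leI)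
    also have "\<dots> = ennreal ((1/2) ^ k)" by (subst ennreal_plus[symmetric]) auto
    finally show ?thesis using measure_in_le_U[OF AB(1,3), of "k + 1"] by (rule order_trans[rotated])
  qed
  then have "measure_in M (interp RM c) \<le> 0"
  proof (rule_tac ennreal_le_epsilon)
    fix e :: real assume le: "\<And>k. measure_in M (interp RM c) \<le> ennreal ((1/2) ^ k)" and e: "0 < e"
    obtain k where "(1/2 :: real) ^ k < e" using real_arch_pow_inv[OF e, of "1/2"] by auto
    then have "ennreal ((1/2) ^ k) \<le> ennreal e" by (simp add: ennreal_leI)
    then show "measure_in M (interp RM c) \<le> 0 + ennreal e" using le[of k] by simp
  qed
  then show "measure_in M (interp RM c) = 0" by simp
qed

end

section \<open>Random reals\<close>

lemma hcode_inj: "hcode c = hcode d \<Longrightarrow> c = d"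
proof (induction c arbitrary: d)
  case (Basic s)
  then show ?case by (cases d) auto
next
  case (Compl c)
  then show ?case by (cases d) auto
next
  case (Union f)
  show ?case
  proof (cases d)
    case (Union g)
    then have "hcode (f n) = hcode (g n)" for n using Union.prems by (auto simp: fun_eq_iff)
    then show ?thesis using Union.IH \<open>d = Union g\<close> by auto
  qed (use Union.prems in auto)
qed

context ctm begin

abbreviation "PP \<equiv> random_poset M"

lemma countable_codes: "countable codes"
proof (rule countable_image_inj_on[of hcode])
  show "countable (hcode ` codes)" by (rule countable_M) (auto dest: codesD)
  show "inj_on hcode codes" using hcode_inj by (auto intro: inj_onI)
qed

lemma PP_iff: "c \<in> codes \<Longrightarrow> hreals (interp RM c) \<in> PP \<longleftrightarrow> measure coin (interp UNIV c) \<noteq> 0"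
proof -
  assume c: "c \<in> codes"
  have "hreals (interp RM c) \<in> PP \<longleftrightarrow> measure_in M (interp RM c) \<noteq> 0"
  proof
    assume "hreals (interp RM c) \<in> PP"
    then obtain Y where "hreals (interp RM c) = hreals Y" "borel_in M Y" "measure_in M Y > 0"
      unfolding random_poset_def by blast
    moreover from this have "Y = interp RM c" using hreals_inj interp_subset unfolding borel_in_def by metis
    ultimately show "measure_in M (interp RM c) \<noteq> 0" by auto
  next
    assume "measure_in M (interp RM c) \<noteq> 0"
    then show "hreals (interp RM c) \<in> PP"
      unfolding random_poset_def using borel_in_interp[OF c] by (auto simp: zero_less_iff_neq_zero)
  qed
  then show ?thesis using measure_in_0_iff[OF c] by simp
qed

lemma PP_cases: assumes "p \<in> PP" obtains c where "c \<in> codes" "p = hreals (interp RM c)" "measure coin (interp UNIV c) \<noteq> 0"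
proof -
  obtain Y where "p = hreals Y" "borel_in M Y" using assms unfolding random_poset_def by blast
  moreover obtain c where "c \<in> codes" "Y = interp RM c" using borel_in_code \<open>borel_in M Y\<close> by blast
  ultimately show ?thesis using that PP_iff assms by blast
qed

lemma PP_M: "p \<in> PP \<Longrightarrow> p \<in> M"
  by (auto simp: random_poset_def borel_in_def)

lemma incl_iff: "Y \<subseteq> RM \<Longrightarrow> Z \<subseteq> RM \<Longrightarrow> incl (hreals Y) (hreals Z) \<longleftrightarrow> Y \<subseteq> Z"
  unfolding incl_def by (auto simp: image_subset_iff simp del: elts_hreal)

lemma empty_sset: "{} \<in> sset"
  using empty_M by (simp add: sset_def hs_def)

lemma interp_empty_null: "c \<in> codes \<Longrightarrow> interp RM c = {} \<Longrightarrow> measure coin (interp UNIV c) = 0"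
  using approx_cover[OF approx _ , of c "{}"] empty_sset by (simp add: U_def)

text \<open>The difference has a code whose interpretation in \<open>M\<close> is empty and so is
  covered by the empty set of strings.\<close>

lemma interp_mono_null:
  assumes "c \<in> codes" "d \<in> codes" "interp RM c \<subseteq> interp RM d"
  shows "measure coin (interp UNIV c - interp UNIV d) = 0"
  using interp_empty_null[OF codes_cdiff[OF assms(1,2)]] assms(3) by simp

text \<open>The part of randomness that does not involve dense sets.\<close>

definition avoids_null :: "(nat \<Rightarrow> bool) \<Rightarrow> bool" where
  "avoids_null x \<longleftrightarrow> (\<forall>c\<in>codes. measure coin (interp UNIV c) = 0 \<longrightarrow> x \<notin> interp UNIV c)"

lemma AE_avoids_null: "AE x in coin. avoids_null x"
  unfolding avoids_null_def
proof (subst AE_ball_countable[OF countable_codes], intro ballI)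
  fix c
  show "AE x in coin. measure coin (interp UNIV c) = 0 \<longrightarrow> x \<notin> interp UNIV c"
  proof (cases "measure coin (interp UNIV c) = 0")
    case True
    then have "interp UNIV c \<in> null_sets coin" by (auto intro!: null_setsI simp: coin.emeasure_eq_measure)
    then show ?thesis by (auto dest: AE_not_in)
  qed simp
qed

text \<open>The filter refers to some code of the given set of \<open>M\<close>. Any two such codes
  differ in the universe by a null set coded in \<open>M\<close>, which \<open>x\<close>
  avoids.\<close>

lemma avoids_null_filter:
  assumes "avoids_null x" "c \<in> codes"
  shows "hreals (interp RM c) \<in> random_filter M x \<longleftrightarrow> x \<in> interp UNIV c"
proof
  assume "hreals (interp RM c) \<in> random_filter M x"
  then obtain d where d: "hreals (interp RM c) = hreals (interp RM d)" "d \<in> codes" "x \<in> interp UNIV d"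
    unfolding random_filter_def codes_def by blast
  then have "interp RM d \<subseteq> interp RM c"
    using hreals_inj[of "interp RM c" "interp RM d"] interp_subset[of RM] by simp
  then have "measure coin (interp UNIV (cdiff d c)) = 0"
    using interp_mono_null d(2) assms(2) by simp
  then have "x \<notin> interp UNIV (cdiff d c)"
    using assms codes_cdiff d(2) unfolding avoids_null_def by blast
  then show "x \<in> interp UNIV c" using d(3) by simp
next
  assume x: "x \<in> interp UNIV c"
  then have "measure coin (interp UNIV c) \<noteq> 0" using assms unfolding avoids_null_def by blast
  then have "hreals (interp RM c) \<in> PP" using PP_iff assms(2) by blast
  then show "hreals (interp RM c) \<in> random_filter M x"
    unfolding random_filter_def using x codesD[OF assms(2)] by blast
qed

lemma avoids_null_filter_on:
  assumes x: "avoids_null x" shows "filter_on PP incl (random_filter M x)"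
  unfolding filter_on_def
proof (intro conjI ballI impI)
  show "random_filter M x \<subseteq> PP" by (simp add: random_filter_def)
  have "hreals (interp RM (Basic [])) \<in> random_filter M x"
    using avoids_null_filter[OF x, of "Basic []"] by (simp add: cyl_def)
  then show "random_filter M x \<noteq> {}" by blast
next
  fix p q assume p: "p \<in> random_filter M x" and q: "q \<in> PP" and le: "incl p q"
  obtain c where c: "c \<in> codes" "p = hreals (interp RM c)"
    using p PP_cases unfolding random_filter_def by blast
  obtain d where d: "d \<in> codes" "q = hreals (interp RM d)" using q PP_cases by blast
  have "measure coin (interp UNIV (cdiff c d)) = 0"
    using interp_mono_null[OF c(1) d(1)] le unfolding c d by (simp add: incl_iff interp_subset)
  then have "x \<notin> interp UNIV (cdiff c d)"
    using x codes_cdiff[OF c(1) d(1)] unfolding avoids_null_def by blast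
  then show "q \<in> random_filter M x"
    using p unfolding c d avoids_null_filter[OF x c(1)] avoids_null_filter[OF x d(1)] by simp
next
  fix p q assume p: "p \<in> random_filter M x" and q: "q \<in> random_filter M x"
  obtain c where c: "c \<in> codes" "p = hreals (interp RM c)"
    using p PP_cases unfolding random_filter_def by blast
  obtain d where d: "d \<in> codes" "q = hreals (interp RM d)"
    using q PP_cases unfolding random_filter_def by blast
  define r where "r = cdiff c (cdiff c d)"
  have r: "r \<in> codes" "interp X r = interp X c \<inter> interp X d" for X
    unfolding r_def by (auto intro!: codes_cdiff c d)
  have "x \<in> interp UNIV r"
    using p q unfolding c d avoids_null_filter[OF x c(1)] avoids_null_filter[OF x d(1)] r(2) by simp
  then have "hreals (interp RM r) \<in> random_filter M x" using avoids_null_filter[OF x r(1)] by blast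
  moreover have "incl (hreals (interp RM r)) p" "incl (hreals (interp RM r)) q"
    unfolding c d by (subst incl_iff[OF interp_subset interp_subset], simp add: r(2))+
  ultimately show "\<exists>r\<in>random_filter M x. incl r p \<and> incl r q" by blast
qed

text \<open>\<open>y\<close> is a sequence of codes for members of \<open>D\<close> whose union contains every member of \<open>D\<close> up
  to a set of measure \<open>2\<^sup>-\<^sup>j\<close>.\<close>

definition exhausts :: "hc \<Rightarrow> hc \<Rightarrow> hc \<Rightarrow> bool" where
  "exhausts D j y \<longleftrightarrow> opair (ord_nat 2) y \<in> range hcode \<and> (\<forall>p\<in>elts y. Iop (hsnd p) \<in> elts D) \<and>
     (\<forall>d\<in>M. d \<in> range hcode \<and> Iop d \<in> elts D \<longrightarrow>
       (\<exists>a\<in>M. elts a \<subseteq> elts Str \<and> (\<exists>z\<in>elts Str. hdom z = j \<and> small z a) \<and>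
         (\<forall>x\<in>elts (Iop d). x \<in> elts (Iop (opair (ord_nat 2) y)) \<or> (\<exists>s\<in>elts a. elts s \<subseteq> elts x))))"

lemma dfn_exhausts: "D \<in> M \<Longrightarrow> dfn (\<lambda>e. exhausts D (e 0) (e 1))"
  unfolding exhausts_def by (intro dfn_intro dtm_const)

lemma exhausts_iff:
  "exhausts D (ord_nat j) (hseq (\<lambda>n. hcode (f n))) \<longleftrightarrow> (\<forall>n. hreals (interp RM (f n)) \<in> elts D) \<and>
     (\<forall>d\<in>codes. hreals (interp RM d) \<in> elts D \<longrightarrow>
       (\<exists>A\<in>sset. measure coin (U A) \<le> (1/2) ^ j \<and> interp RM d \<subseteq> interp RM (Union f) \<union> U A))"
proof -
  have o: "opair (ord_nat 2) (hseq (\<lambda>n. hcode (f n))) = hcode (Union f)" by simp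
  have 1: "(\<exists>a\<in>M. elts a \<subseteq> elts Str \<and> (\<exists>z\<in>elts Str. hdom z = ord_nat j \<and> small z a) \<and>
         (\<forall>x\<in>elts (hreals (interp RM d)). x \<in> elts (hreals (interp RM (Union f))) \<or> (\<exists>s\<in>elts a. elts s \<subseteq> elts x)))
     \<longleftrightarrow> (\<exists>A\<in>sset. measure coin (U A) \<le> (1/2) ^ j \<and> interp RM d \<subseteq> interp RM (Union f) \<union> U A)" for d
  proof -
    have "(\<forall>x\<in>elts (hreals (interp RM d)). x \<in> elts (hreals (interp RM (Union f))) \<or> (\<exists>s\<in>elts (hs A). elts s \<subseteq> elts x))
       \<longleftrightarrow> interp RM d \<subseteq> interp RM (Union f) \<union> U A" for A
      unfolding elts_hreals[OF interp_subset]
      by (auto simp: hstring_sub_hreal U_def image_iff simp del: elts_hreal elts_hstring) blast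
    moreover have "(\<exists>z\<in>elts Str. hdom z = ord_nat j \<and> small z (hs A)) \<longleftrightarrow> measure coin (U A) \<le> (1/2) ^ j" for A
    proof -
      have "\<exists>z :: bool list. length z = j" by (intro exI[of _ "replicate j False"]) simp
      then show ?thesis by (auto simp: small_iff)
    qed
    ultimately have *: "elts (hs A) \<subseteq> elts Str \<and> (\<exists>z\<in>elts Str. hdom z = ord_nat j \<and> small z (hs A)) \<and>
         (\<forall>x\<in>elts (hreals (interp RM d)). x \<in> elts (hreals (interp RM (Union f))) \<or> (\<exists>s\<in>elts (hs A). elts s \<subseteq> elts x))
      \<longleftrightarrow> measure coin (U A) \<le> (1/2) ^ j \<and> interp RM d \<subseteq> interp RM (Union f) \<union> U A" for A
      by auto
    show ?thesis
    proof
      assume "\<exists>a\<in>M. elts a \<subseteq> elts Str \<and> (\<exists>z\<in>elts Str. hdom z = ord_nat j \<and> small z a) \<and>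
         (\<forall>x\<in>elts (hreals (interp RM d)). x \<in> elts (hreals (interp RM (Union f))) \<or> (\<exists>s\<in>elts a. elts s \<subseteq> elts x))"
      then obtain a where a: "a \<in> M" "elts a \<subseteq> elts Str" "(\<exists>z\<in>elts Str. hdom z = ord_nat j \<and> small z a) \<and>
         (\<forall>x\<in>elts (hreals (interp RM d)). x \<in> elts (hreals (interp RM (Union f))) \<or> (\<exists>s\<in>elts a. elts s \<subseteq> elts x))"
        by blast
      obtain A where A: "a = hs A" "A \<in> sset" using hs_cases[OF a(1,2)] by blast
      show "\<exists>A\<in>sset. measure coin (U A) \<le> (1/2) ^ j \<and> interp RM d \<subseteq> interp RM (Union f) \<union> U A"
        using *[of A] a(2,3) A by blast
    next
      assume "\<exists>A\<in>sset. measure coin (U A) \<le> (1/2) ^ j \<and> interp RM d \<subseteq> interp RM (Union f) \<union> U A"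
      then obtain A where A: "A \<in> sset" "measure coin (U A) \<le> (1/2) ^ j \<and> interp RM d \<subseteq> interp RM (Union f) \<union> U A" by blast
      then show "\<exists>a\<in>M. elts a \<subseteq> elts Str \<and> (\<exists>z\<in>elts Str. hdom z = ord_nat j \<and> small z a) \<and>
         (\<forall>x\<in>elts (hreals (interp RM d)). x \<in> elts (hreals (interp RM (Union f))) \<or> (\<exists>s\<in>elts a. elts s \<subseteq> elts x))"
        using *[of A] unfolding sset_def by blast
    qed
  qed
  have 2: "(\<forall>p\<in>elts (hseq (\<lambda>n. hcode (f n))). Iop (hsnd p) \<in> elts D) \<longleftrightarrow> (\<forall>n. hreals (interp RM (f n)) \<in> elts D)"
    by (simp add: Iop_hcode)
  have 3: "(\<forall>d\<in>M. d \<in> range hcode \<and> Iop d \<in> elts D \<longrightarrow> Q (Iop d)) \<longleftrightarrow>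
      (\<forall>d\<in>codes. hreals (interp RM d) \<in> elts D \<longrightarrow> Q (hreals (interp RM d)))" for Q
    by (auto simp: codes_def Iop_hcode)
  show ?thesis
    unfolding exhausts_def o 2 Iop_hcode
    by (subst 3) (simp only: 1 rangeI simp_thms)
qed

text \<open>In the universe \<open>D\<close> is countable, so finitely many members exhaust it up to
  measure \<open>(1/2) ^ (j + 1)\<close>; a finite family lies in \<open>M\<close>, hence
  \<open>M\<close> knows that such families exist for every \<open>j\<close> and can choose a
  sequence of them. Its union \<open>K\<close> has a code in \<open>M\<close> and contains each
  member of \<open>D\<close> up to a null set: the countable chain condition in effect.\<close>

lemma dense_AE:
  assumes D: "D \<in> M" "dense_in PP incl (elts D)"
  shows "AE x in coin. \<exists>c\<in>codes. hreals (interp RM c) \<in> elts D \<and> x \<in> interp UNIV c"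
proof -
  define DD where "DD = {c \<in> codes. hreals (interp RM c) \<in> elts D}"
  have DDc: "countable DD" by (rule countable_subset[OF _ countable_codes]) (auto simp: DD_def)
  have below: "\<exists>d\<in>DD. interp RM d \<subseteq> interp RM c" if c: "c \<in> codes" "measure coin (interp UNIV c) \<noteq> 0" for c
  proof -
    have "hreals (interp RM c) \<in> PP" using PP_iff c by blast
    then obtain q where q: "q \<in> elts D" "incl q (hreals (interp RM c))" using D(2) unfolding dense_in_def by blast
    then obtain d where "d \<in> codes" "q = hreals (interp RM d)" using D(2) PP_cases unfolding dense_in_def by blast
    then show ?thesis using q by (auto simp: DD_def incl_iff interp_subset)
  qed
  have "measure coin (interp UNIV (Basic [])) \<noteq> 0" by (simp add: measure_cyl)
  then have "DD \<noteq> {}" using below[of "Basic []"] by auto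
  define g where "g = from_nat_into DD"
  have g: "range g = DD" unfolding g_def by (rule range_from_nat_into) fact+
  let ?V = "interp UNIV" and ?W = "\<Union>n. interp UNIV (g n)"
  have W: "?V d \<subseteq> ?W" if "d \<in> DD" for d using that g by blast
  have "\<exists>y\<in>M. exhausts D (ord_nat j) y" for j
  proof -
    let ?F = "\<lambda>N. ?W - (\<Union>n\<le>N. ?V (g n))"
    have "(\<lambda>N. measure coin (?F N)) \<longlonglongrightarrow> measure coin (\<Inter>N. ?F N)"
    proof (rule coin.finite_Lim_measure_decseq)
      show "range ?F \<subseteq> coin.events" by auto
      show "decseq ?F" unfolding decseq_def by (intro allI impI Diff_mono UN_mono) auto
    qed
    moreover have "(\<Inter>N. ?F N) = {}" by auto
    ultimately have "(\<lambda>N. measure coin (?F N)) \<longlonglongrightarrow> 0" by (simp only: measure_empty)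
    then have "\<forall>\<^sub>F N in sequentially. measure coin (?F N) < (1/2) ^ (j + 1)"
      by (rule order_tendstoD) simp
    from eventually_happens'[OF sequentially_bot this]
    obtain N where N: "measure coin (?F N) < (1/2) ^ (j + 1)" by (elim exE)
    \<comment> \<open>Capping the index turns the finite family into an eventually constant
      sequence, which lies in \<open>M\<close>.\<close>
    define f where "f n = g (min n N)" for n
    have fD: "f n \<in> DD" for n using g by (auto simp: f_def)
    have f: "Union f \<in> codes"
      by (rule codes_finite_Union[of _ N]) (use fD in \<open>auto simp: DD_def f_def\<close>)
    have Vf: "?V (Union f) = (\<Union>n\<le>N. ?V (g n))"
    proof -
      have "?V (g m) \<subseteq> (\<Union>n. ?V (f n))" if "m \<le> N" for m
        using that by (intro SUP_upper2[of m]) (auto simp: f_def)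
      moreover have "?V (f n) \<subseteq> (\<Union>m\<le>N. ?V (g m))" for n
        by (intro SUP_upper2[of "min n N"]) (auto simp: f_def)
      ultimately show ?thesis unfolding interp.simps by blast
    qed
    have "exhausts D (ord_nat j) (hseq (\<lambda>n. hcode (f n)))"
      unfolding exhausts_iff
    proof (intro conjI allI ballI impI)
      show "hreals (interp RM (f n)) \<in> elts D" for n using fD by (simp add: DD_def)
      fix d assume d: "d \<in> codes" "hreals (interp RM d) \<in> elts D"
      let ?c = "cdiff d (Union f)"
      have c: "?c \<in> codes" using d(1) f by (rule codes_cdiff)
      have "?V ?c \<subseteq> ?F N" using W[of d] d by (auto simp: Vf[unfolded interp.simps] DD_def)
      then have m: "measure coin (?V ?c) \<le> (1/2) ^ (j + 1)"
        using N coin.finite_measure_mono[of "?V ?c" "?F N"] by auto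
      obtain A B where AB: "A \<in> sset" "B \<in> sset" "interp RM ?c \<subseteq> U A"
        "measure coin (U A \<inter> U B) \<le> (1/2) ^ (j + 1)" "measure coin (- ?V ?c - U B) = 0"
        using approxD[OF approx[OF c], of "j + 1"] by metis
      have "measure coin (U A) \<le> (1/2) ^ j"
        using measure_U_approx[OF AB(1,2,4,5)] m by simp
      then show "\<exists>A\<in>sset. measure coin (U A) \<le> (1/2) ^ j \<and> interp RM d \<subseteq> interp RM (Union f) \<union> U A"
        using AB(1,3) by (intro bexI[of _ A]) auto
    qed
    moreover have "hseq (\<lambda>n. hcode (f n)) \<in> M" using f by simp
    ultimately show ?thesis by blast
  qed
  then obtain y where y: "\<And>j. exhausts D (ord_nat j) (y j)" "hseq y \<in> M"
    using choice_M[OF dfn_exhausts[OF D(1)]] by blast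
  have "\<exists>f. y j = hseq (\<lambda>n. hcode (f n))" for j
  proof -
    obtain c where c: "opair (ord_nat 2) (y j) = hcode c" using y(1)[of j] unfolding exhausts_def by blast
    then show ?thesis by (cases c) auto
  qed
  then obtain f where f: "\<And>j. y j = hseq (\<lambda>n. hcode (f j n))" by metis
  define K where "K = Union (\<lambda>j. Union (f j))"
  have "hseq (\<lambda>j. hcode (Union (f j))) \<in> M"
    by (rule hseq_map_M[of "\<lambda>x. opair (ord_nat 2) x", OF _ y(2)]) (auto simp: f intro!: dfn_intro)
  then have K: "K \<in> codes" by (simp add: K_def)
  then have fc: "Union (f j) \<in> codes" for j unfolding K_def by (rule codes_UnionD)
  have fD: "f j n \<in> DD" for j n
    using y(1)[of j] codes_UnionD[OF fc] unfolding f exhausts_iff DD_def by blast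
  have null: "measure coin (?V d - ?V K) = 0" if d: "d \<in> DD" for d
  proof -
    have "measure coin (?V d - ?V K) \<le> (1/2) ^ j" for j
    proof -
      obtain A where A: "A \<in> sset" "measure coin (U A) \<le> (1/2) ^ j" "interp RM d \<subseteq> interp RM (Union (f j)) \<union> U A"
        using y(1)[of j] d unfolding f exhausts_iff DD_def by blast
      let ?c = "cdiff d (Union (f j))"
      have c: "?c \<in> codes" using d fc by (auto simp: DD_def intro: codes_cdiff)
      have "measure coin (?V ?c - U A) = 0"
        by (rule approx_cover[OF approx[OF c] A(1)]) (use A(3) in auto)
      moreover have "?V d - ?V K \<subseteq> (?V ?c - U A) \<union> U A" by (auto simp: K_def)
      then have "measure coin (?V d - ?V K) \<le> measure coin ((?V ?c - U A) \<union> U A)"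
        by (intro coin.finite_measure_mono) auto
      moreover have "measure coin ((?V ?c - U A) \<union> U A) \<le> measure coin (?V ?c - U A) + measure coin (U A)"
        by (intro measure_Un_le) auto
      ultimately show ?thesis using A(2) by simp
    qed
    then have "measure coin (?V d - ?V K) \<le> 0" by (rule le_power_half_0)
    then show ?thesis by (simp add: measure_le_0_iff)
  qed
  \<comment> \<open>Otherwise density puts a member of \<open>D\<close> below the complement of
    \<open>K\<close>; almost contained in \<open>K\<close> as well, it would be null and no
    condition.\<close>
  have "measure coin (?V (Compl K)) = 0"
  proof (rule ccontr)
    assume "measure coin (?V (Compl K)) \<noteq> 0"
    then obtain d where d: "d \<in> DD" "interp RM d \<subseteq> interp RM (Compl K)"
      using below[of "Compl K"] K by auto
    then have dc: "d \<in> codes" "hreals (interp RM d) \<in> PP" using D(2) unfolding DD_def dense_in_def by blast+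
    have "measure coin (?V d - ?V (Compl K)) = 0"
      using interp_mono_null[OF dc(1) _ d(2)] K by simp
    then have "measure coin ((?V d - ?V (Compl K)) \<union> (?V d - ?V K)) = 0"
      using null[OF d(1)] measure_Un_le[of "?V d - ?V (Compl K)" coin "?V d - ?V K"]
      by (simp add: measure_le_0_iff)
    then have "measure coin (?V d) = 0"
      by (rule coin_null_subset[rotated]) auto
    then show False using PP_iff dc by blast
  qed
  then have "?V (Compl K) \<in> null_sets coin" by (auto intro!: null_setsI simp: coin.emeasure_eq_measure)
  then have "AE x in coin. x \<notin> ?V (Compl K)" by (rule AE_not_in)
  then show ?thesis
    by (rule AE_mp) (use fD in \<open>auto intro!: AE_I2 simp: K_def DD_def\<close>)
qed

lemma AE_random: "AE x in coin. x \<in> random_reals M"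
proof -
  have "AE x in coin. \<forall>D\<in>{D \<in> M. dense_in PP incl (elts D)}. \<exists>c\<in>codes. hreals (interp RM c) \<in> elts D \<and> x \<in> interp UNIV c"
    by (subst AE_ball_countable) (auto intro: dense_AE)
  then show ?thesis
    using AE_avoids_null
  proof eventually_elim
    case (elim x)
    have "random_filter M x \<inter> elts D \<noteq> {}" if D: "D \<in> M" "dense_in PP incl (elts D)" for D
    proof -
      obtain c where "c \<in> codes" "hreals (interp RM c) \<in> elts D" "x \<in> interp UNIV c"
        using elim(1) D by blast
      then show ?thesis using avoids_null_filter[OF elim(2)] by blast
    qed
    then show ?case
      using avoids_null_filter_on[OF elim(2)] by (simp add: random_reals_def generic_def)
  qed
qed

end

section \<open>Names and their values at random reals\<close>

lemma val_eq: "val G t = hset (val G ` {s. \<exists>p\<in>G. opair s p \<in> elts t})"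
  by (rule val.simps)

lemma countable_val: "countable {s. \<exists>p\<in>G. opair s p \<in> elts t}"
  by (rule countable_subset[of _ "hfst ` elts t"]) (auto simp: image_iff intro!: bexI[of _ "opair _ _"])

lemma elts_val: "elts (val G t) = val G ` {s. \<exists>p\<in>G. opair s p \<in> elts t}"
  by (subst val_eq) (simp add: countable_val)

lemma measurable_coordinates:
  fixes f :: "(nat \<Rightarrow> bool) \<Rightarrow> nat \<Rightarrow> bool"
  assumes "\<And>n. {x. f x n} \<in> sets borel" shows "f \<in> borel_measurable borel"
proof (rule measurable_coordinatewise_then_product)
  fix n
  have *: "{x. \<not> f x n} \<in> sets borel" using minus_sets[OF assms[of n]] by (simp add: Compl_eq)
  show "(\<lambda>x. f x n) \<in> borel_measurable borel"
  proof (rule measurableI)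
    fix A :: "bool set"
    have "(\<lambda>x. f x n) -` A = (if True \<in> A then {x. f x n} else {}) \<union> (if False \<in> A then {x. \<not> f x n} else {})"
      by (rule set_eqI, case_tac "f x n") auto
    then show "(\<lambda>x. f x n) -` A \<inter> space borel \<in> sets borel"
      using * assms[of n] by auto
  qed simp
qed

definition pairs :: "hc \<Rightarrow> hc set" where
  "pairs t = {z \<in> elts t. z = opair (hfst z) (hsnd z)}"

lemma elts_val_pairs: "elts (val G t) = (\<lambda>z. val G (hfst z)) ` {z \<in> pairs t. hsnd z \<in> G}"
proof -
  have "{s. \<exists>p\<in>G. opair s p \<in> elts t} = hfst ` {z \<in> pairs t. hsnd z \<in> G}"
  proof (intro equalityI subsetI)
    fix s assume "s \<in> {s. \<exists>p\<in>G. opair s p \<in> elts t}"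
    then obtain p where "p \<in> G" "opair s p \<in> elts t" by blast
    then show "s \<in> hfst ` {z \<in> pairs t. hsnd z \<in> G}"
      by (intro image_eqI[of _ _ "opair s p"]) (auto simp: pairs_def)
  next
    fix s assume "s \<in> hfst ` {z \<in> pairs t. hsnd z \<in> G}"
    then obtain z where z: "z \<in> pairs t" "hsnd z \<in> G" "s = hfst z" by blast
    then have "opair s (hsnd z) \<in> elts t" unfolding pairs_def by (metis (mono_tags, lifting) mem_Collect_eq)
    then show "s \<in> {s. \<exists>p\<in>G. opair s p \<in> elts t}" using z(2) by blast
  qed
  then show ?thesis by (simp only: elts_val image_image)
qed

text \<open>Reduces the value of a name to countable Boolean combinations of conditions on the names
  inside it, as the induction in \<open>val_sets\<close> requires.\<close>

lemma val_eq_iff: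
  "val G t = w \<longleftrightarrow> (\<forall>z\<in>pairs t. hsnd z \<notin> G \<or> (\<exists>v\<in>elts w. val G (hfst z) = v)) \<and>
    (\<forall>v\<in>elts w. \<exists>z\<in>pairs t. hsnd z \<in> G \<and> val G (hfst z) = v)"
proof -
  have "val G t = w \<longleftrightarrow> elts (val G t) = elts w" using hc_ext by blast
  also have "\<dots> \<longleftrightarrow> elts (val G t) \<subseteq> elts w \<and> elts w \<subseteq> elts (val G t)" by (rule set_eq_subset)
  finally have *: "val G t = w \<longleftrightarrow> elts (val G t) \<subseteq> elts w \<and> elts w \<subseteq> elts (val G t)" .
  have 1: "f ` {z \<in> P. Q z} \<subseteq> W \<longleftrightarrow> (\<forall>z\<in>P. \<not> Q z \<or> (\<exists>v\<in>W. f z = v))"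
    for f :: "hc \<Rightarrow> hc" and P W Q by blast
  have 2: "W \<subseteq> f ` {z \<in> P. Q z} \<longleftrightarrow> (\<forall>v\<in>W. \<exists>z\<in>P. Q z \<and> f z = v)"
    for f :: "hc \<Rightarrow> hc" and P W Q by (rule iffI; fastforce)
  show ?thesis unfolding * elts_val_pairs 1 2 ..
qed

lemma countable_pairs [simp]: "countable (pairs t)"
  unfolding pairs_def by (rule countable_subset[of _ "elts t"]) auto

context ctm begin

lemma RMh_PP [simp]: "RMh \<in> PP" and cyl_PP [simp]: "hreals (cyl s \<inter> RM) \<in> PP"
  using PP_iff[of "Basic []"] PP_iff[of "Basic s"] coin.prob_space by (simp_all add: cyl_def[of "[]"] measure_cyl)

text \<open>The canonical names for the elements of \<open>M\<close>; \<open>RMh\<close>, the whole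
  space of \<open>M\<close>, is the largest condition.\<close>

definition check :: "hc \<Rightarrow> hc" where
  "check = hrec (\<lambda>x f. hset ((\<lambda>u. opair (app f u) RMh) ` elts x))"

lemma dtm_check [dfn_intro]: "dtm t \<Longrightarrow> dtm (\<lambda>e. check (t e))"
  unfolding check_def by (rule dtm_hrec) (intro dfn_intro)

lemma elts_check: "elts (check x) = (\<lambda>u. opair (check u) RMh) ` elts x"
  unfolding check_def by (subst hrec) (simp add: elts_sub_tc cong: image_cong)

lemma name_check: "is_name PP (check x)"
proof (induction x rule: elts_induct)
  case (elts x)
  then show ?case by (intro is_name.intros) (auto simp: elts_check)
qed

lemma val_check: "RMh \<in> G \<Longrightarrow> val G (check x) = x"
proof (induction x rule: elts_induct)
  case (elts x)
  have "{s. \<exists>p\<in>G. opair s p \<in> elts (check x)} = check ` elts x"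
    using elts.prems by (auto simp: elts_check)
  then have "elts (val G (check x)) = (\<lambda>u. val G (check u)) ` elts x"
    by (simp add: elts_val image_image)
  also have "\<dots> = elts x" using elts by (simp cong: image_cong)
  finally show ?case by (rule hc_ext)
qed

text \<open>The canonical name of the random real: each string contributes its entries under the
  condition given by its cylinder, and the filter of \<open>y\<close> activates just the initial
  segments of \<open>y\<close>.\<close>

definition real_name :: hc where
  "real_name = hUnion (hset ((\<lambda>s. hset ((\<lambda>z. opair (check z) (hset {x \<in> elts RMh. elts s \<subseteq> elts x})) ` elts s)) ` elts Str))"

lemma cyl_cond: "hset {x \<in> elts RMh. elts (hstring s) \<subseteq> elts x} = hreals (cyl s \<inter> RM)"
proof (rule hc_ext)
  have *: "{z \<in> hreal ` Y. Q z} = hreal ` {x \<in> Y. Q (hreal x)}" for Y Q by auto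
  show "elts (hset {x \<in> elts RMh. elts (hstring s) \<subseteq> elts x}) = elts (hreals (cyl s \<inter> RM))"
    unfolding elts_sep elts_hreals[OF Int_lower2] elts_hreals[OF subset_refl] * hstring_sub_hreal
    by (subst elts_hset) (auto intro!: countable_image countable_RM)
qed

lemma elts_real_name: "elts real_name = {opair (check z) (hreals (cyl s \<inter> RM)) | s z. z \<in> elts (hstring s)}"
proof -
  have "real_name = hUnion (hset (range (\<lambda>s. hset ((\<lambda>z. opair (check z) (hreals (cyl s \<inter> RM))) ` elts (hstring s)))))"
    unfolding real_name_def elts_Str image_image cyl_cond ..
  then show ?thesis by (auto simp del: elts_hstring)
qed

lemma real_name_M: "real_name \<in> M"
proof -
  have "dtm (\<lambda>e. real_name)" unfolding real_name_def by (intro dfn_intro)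
  from dtm_closed[OF this, of "\<lambda>_. RMh"] show ?thesis by simp
qed

lemma name_real_name: "is_name PP real_name"
  by (intro is_name.intros) (auto simp: elts_real_name name_check simp del: elts_hstring)

text \<open>Genericity is all that is known of \<open>y\<close> here. If the cylinder of
  \<open>s\<close> and that of the initial segment of \<open>y\<close> of the same length were
  disjoint, a common lower bound in the filter would be empty in \<open>M\<close>, hence of measure
  zero.\<close>

lemma random_cyl:
  assumes y: "y \<in> random_reals M"
  shows "hreals (cyl s \<inter> RM) \<in> random_filter M y \<longleftrightarrow> y \<in> cyl s"
proof
  have *: "y \<in> cyl s \<Longrightarrow> hreals (cyl s \<inter> RM) \<in> random_filter M y" for s
    unfolding random_filter_def using codesD[of "Basic s"] by (auto intro!: exI[of _ "Basic s"])
  then show "y \<in> cyl s \<Longrightarrow> hreals (cyl s \<inter> RM) \<in> random_filter M y" .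
  assume s: "hreals (cyl s \<inter> RM) \<in> random_filter M y"
  show "y \<in> cyl s"
  proof (rule ccontr)
    assume n: "y \<notin> cyl s"
    define t where "t = map y [0..<length s]"
    have t: "length t = length s" "t \<noteq> s" "y \<in> cyl t" using n by (auto simp: t_def cyl_map)
    then obtain r where r: "r \<in> random_filter M y" "incl r (hreals (cyl s \<inter> RM))" "incl r (hreals (cyl t \<inter> RM))"
      using y s *[of t] unfolding random_reals_def generic_def filter_on_def by blast
    then obtain c where c: "c \<in> codes" "r = hreals (interp RM c)" "measure coin (interp UNIV c) \<noteq> 0"
      using PP_cases unfolding random_filter_def by blast
    have "interp RM c \<subseteq> cyl s \<inter> cyl t" using r(2,3) unfolding c(2) by (simp add: incl_iff interp_subset)
    then have "interp RM c = {}" using cyl_disjoint[of s t] t by auto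
    then show False using interp_empty_null c by blast
  qed
qed

lemma val_real_name:
  assumes y: "y \<in> random_reals M" shows "val (random_filter M y) real_name = hreal y"
proof -
  let ?G = "random_filter M y"
  have top: "RMh \<in> ?G" using random_cyl[OF y, of "[]"] by (simp add: cyl_def)
  have "{s. \<exists>p\<in>?G. opair s p \<in> elts real_name} = check ` (\<Union>s\<in>{s. y \<in> cyl s}. elts (hstring s))"
    using random_cyl[OF y] by (auto simp: elts_real_name simp del: elts_hstring)
  then have "elts (val ?G real_name) = (\<Union>s\<in>{s. y \<in> cyl s}. elts (hstring s))"
    by (simp add: elts_val image_image val_check[OF top] del: elts_hstring)
  also have "\<dots> = elts (hreal y)"
  proof (intro equalityI subsetI)
    fix p assume "p \<in> elts (hreal y)"
    then obtain n where "p = opair (ord_nat n) (hbit (y n))" by auto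
    then have "p \<in> elts (hstring (map y [0..<Suc n]))"
      by (auto intro!: image_eqI[of _ _ n] simp del: upt_Suc)
    then show "p \<in> (\<Union>s\<in>{s. y \<in> cyl s}. elts (hstring s))"
      by (intro UN_I[of "map y [0..<Suc n]"]) (auto simp: cyl_map simp del: upt_Suc elts_hstring)
  qed (use hstring_sub_hreal in blast)
  finally show ?thesis by (rule hc_ext)
qed

lemma hreal_in_random_ext: "y \<in> random_reals M \<Longrightarrow> hreal y \<in> random_ext M y"
  unfolding random_ext_def generic_ext_def
  using val_real_name real_name_M name_real_name by (auto intro!: exI[of _ real_name])

subsection \<open>Borel enumeration of the equivalence classes\<close>

lemma filter_sets [measurable]: "{x. p \<in> random_filter M x} \<in> sets borel"
proof (cases "p \<in> PP")
  case True
  then have "{x. p \<in> random_filter M x} = (\<Union>c\<in>{c \<in> codes. hreals (interp RM c) = p}. interp UNIV c)"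
    unfolding random_filter_def codes_def by auto
  also have "\<dots> \<in> sets borel"
    by (rule sets.countable_UN') (auto intro: countable_subset[OF _ countable_codes])
  finally show ?thesis .
qed (simp add: random_filter_def)

text \<open>Induction along names; hereditary countability keeps every union and intersection in
  \<open>val_eq_iff\<close> countable.\<close>

lemma val_sets: "{x. val (random_filter M x) t = w} \<in> sets borel"
proof (induction t arbitrary: w rule: elts_trancl_induct)
  case (step t)
  note Z = countable_pairs[of t]
  have IH: "{x. val (random_filter M x) (hfst z) = v} \<in> sets borel" if "z \<in> pairs t" for z v
  proof (rule step.IH)
    have "opair (hfst z) (hsnd z) \<in> elts t" using that by (simp add: pairs_def)
    then show "hfst z \<in> elts (tc t)" using opair_tc by blast
  qed
  have "{x. val (random_filter M x) t = w} =
     (\<Inter>z\<in>pairs t. - {x. hsnd z \<in> random_filter M x} \<union> (\<Union>v\<in>elts w. {x. val (random_filter M x) (hfst z) = v})) \<inter>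
     (\<Inter>v\<in>elts w. \<Union>z\<in>pairs t. {x. hsnd z \<in> random_filter M x} \<inter> {x. val (random_filter M x) (hfst z) = v})"
    unfolding val_eq_iff[of _ t w] by (rule set_eqI) simp
  also have "\<dots> \<in> sets borel"
  proof (rule sets.Int)
    show "(\<Inter>z\<in>pairs t. - {x. hsnd z \<in> random_filter M x} \<union> (\<Union>v\<in>elts w. {x. val (random_filter M x) (hfst z) = v})) \<in> sets borel"
      by (cases "pairs t = {}") (auto intro!: sets.countable_INT' sets.Un sets.countable_UN' Z IH)
    show "(\<Inter>v\<in>elts w. \<Union>z\<in>pairs t. {x. hsnd z \<in> random_filter M x} \<inter> {x. val (random_filter M x) (hfst z) = v}) \<in> sets borel"
      by (cases "elts w = {}") (auto intro!: sets.countable_INT' sets.Int sets.countable_UN' Z IH)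
  qed
  finally show ?case .
qed

text \<open>Each element of the class of \<open>x\<close> is the value of a name in the countable
  set \<open>M\<close>, so these functions enumerate classes in a Borel way. Where the value is not
  a real, \<open>x\<close> serves as default.\<close>

definition real_of_name :: "hc \<Rightarrow> (nat \<Rightarrow> bool) \<Rightarrow> nat \<Rightarrow> bool" where
  "real_of_name t x = (if val (random_filter M x) t \<in> range hreal
     then inv hreal (val (random_filter M x) t) else x)"

lemma random_equiv_name:
  assumes "(x, y) \<in> random_equiv M" shows "\<exists>t\<in>M. real_of_name t x = y"
proof -
  have "hreal y \<in> random_ext M x"
    using assms hreal_in_random_ext unfolding random_equiv_def by auto
  then obtain t where "t \<in> M" "hreal y = val (random_filter M x) t"
    unfolding random_ext_def generic_ext_def by blast
  moreover from this have "real_of_name t x = y"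
    unfolding real_of_name_def by (metis inj_hreal inv_f_f rangeI)
  ultimately show ?thesis by blast
qed

lemma elts_val_sets: "{x. v \<in> elts (val (random_filter M x) t)} \<in> sets borel"
proof -
  have "{x. v \<in> elts (val (random_filter M x) t)} =
      (\<Union>z\<in>pairs t. {x. hsnd z \<in> random_filter M x} \<inter> {x. val (random_filter M x) (hfst z) = v})"
    unfolding elts_val_pairs by auto
  also have "\<dots> \<in> sets borel"
    by (auto intro!: sets.countable_UN' sets.Int val_sets filter_sets)
  finally show ?thesis .
qed

lemma real_of_name_measurable [measurable]: "real_of_name t \<in> borel_measurable borel"
proof (rule measurable_coordinates)
  fix n
  let ?v = "\<lambda>x. val (random_filter M x) t"
  let ?E = "\<lambda>n b. {x. opair (ord_nat n) (hbit b) \<in> elts (?v x)}"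
  \<comment> \<open>All possible members of a real. There are countably many, so being a real
    amounts to countably many conditions on membership.\<close>
  define W where "W = {opair (ord_nat n) (hbit b) | n b. True}"
  have "W = (\<Union>b. range (\<lambda>n. opair (ord_nat n) (hbit b)))" by (auto simp: W_def)
  then have W: "countable W"
    by (auto intro!: countable_UN countable_image countableI_type countable_finite)
  have mem: "opair (ord_nat n) (hbit b) \<in> elts (hreal y) \<longleftrightarrow> b = y n" for n b y by auto
  have real: "(z \<in> range hreal) \<longleftrightarrow> elts z \<subseteq> W \<and> (\<forall>n. opair (ord_nat n) (hbit True) \<in> elts z \<longleftrightarrow> opair (ord_nat n) (hbit False) \<notin> elts z)" for z
  proof
    assume "z \<in> range hreal"
    then obtain y where z: "z = hreal y" by blast
    have "elts (hreal y) \<subseteq> W" by (auto simp: W_def)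
    then show "elts z \<subseteq> W \<and> (\<forall>n. opair (ord_nat n) (hbit True) \<in> elts z \<longleftrightarrow> opair (ord_nat n) (hbit False) \<notin> elts z)"
      unfolding z mem by blast
  next
    assume z: "elts z \<subseteq> W \<and> (\<forall>n. opair (ord_nat n) (hbit True) \<in> elts z \<longleftrightarrow> opair (ord_nat n) (hbit False) \<notin> elts z)"
    define y where "y n = (opair (ord_nat n) (hbit True) \<in> elts z)" for n
    have y: "opair (ord_nat n) (hbit b) \<in> elts z \<longleftrightarrow> b = y n" for n b
      using z by (cases b) (auto simp: y_def)
    have "p \<in> elts z \<longleftrightarrow> p \<in> elts (hreal y)" for p
    proof
      assume p: "p \<in> elts z"
      then obtain n b where "p = opair (ord_nat n) (hbit b)" using z by (auto simp: W_def)
      then show "p \<in> elts (hreal y)" using y[of n b] p mem by simp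
    next
      assume "p \<in> elts (hreal y)"
      then obtain n where "p = opair (ord_nat n) (hbit (y n))" by auto
      then show "p \<in> elts z" using y by simp
    qed
    then have "z = hreal y" by (intro hc_ext) blast
    then show "z \<in> range hreal" by blast
  qed
  have "{x. elts (?v x) \<subseteq> W} \<in> sets borel"
  proof -
    have "{x. elts (?v x) \<subseteq> W} =
        (\<Inter>z\<in>pairs t. - {x. hsnd z \<in> random_filter M x} \<union> (\<Union>v\<in>W. {x. val (random_filter M x) (hfst z) = v}))"
      unfolding elts_val_pairs by auto
    also have "\<dots> \<in> sets borel"
      by (cases "pairs t = {}")
        (auto intro!: sets.countable_INT' sets.Un sets.countable_UN' W val_sets)
    finally show ?thesis .
  qed
  moreover have "{x. \<forall>n. opair (ord_nat n) (hbit True) \<in> elts (?v x) \<longleftrightarrow> opair (ord_nat n) (hbit False) \<notin> elts (?v x)} \<in> sets borel"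
  proof -
    have "{x. \<forall>n. opair (ord_nat n) (hbit True) \<in> elts (?v x) \<longleftrightarrow> opair (ord_nat n) (hbit False) \<notin> elts (?v x)}
      = (\<Inter>n. (?E n True - ?E n False) \<union> (?E n False - ?E n True))" by auto
    also have "\<dots> \<in> sets borel" by (intro sets.countable_INT'' countableI_type sets.Un sets.Diff elts_val_sets) simp
    finally show ?thesis .
  qed
  ultimately have S: "{x. ?v x \<in> range hreal} \<in> sets borel" (is "?S \<in> _")
    unfolding real using sets.Int by (simp add: Collect_conj_eq)
  have "real_of_name t x n = (if x \<in> ?S then x \<in> ?E n True else x n)" for x
  proof (cases "x \<in> ?S")
    case True
    then obtain y where "?v x = hreal y" by auto
    then show ?thesis by (simp add: real_of_name_def mem del: elts_hreal)
  qed (simp add: real_of_name_def)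
  then have "{x. real_of_name t x n} = (?S \<inter> ?E n True) \<union> ({x. x n = True} - ?S)" by auto
  also have "\<dots> \<in> sets borel" using coord_sets[of n True]
    by (intro sets.Un sets.Int sets.Diff S elts_val_sets) simp
  finally show "{x. real_of_name t x n} \<in> sets borel" .
qed

lemma countable_PP: "countable PP"
  by (rule countable_M) (auto intro: PP_M)

text \<open>As \<open>M\<close> and the poset are countable, genericity is a countable Boolean
  combination of the Borel sets \<open>{x. p \<in> random_filter M x}\<close>.\<close>

lemma random_reals_sets [measurable, simp]: "random_reals M \<in> sets borel"
proof -
  let ?F = "\<lambda>p. {x. p \<in> random_filter M x}"
  have "random_reals M = (\<Union>p\<in>PP. ?F p) \<inter>
     (\<Inter>p\<in>PP. \<Inter>q\<in>PP. if incl p q then - ?F p \<union> ?F q else UNIV) \<inter>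
     (\<Inter>p\<in>PP. \<Inter>q\<in>PP. - ?F p \<union> - ?F q \<union> (\<Union>r\<in>{r \<in> PP. incl r p \<and> incl r q}. ?F r)) \<inter>
     (\<Inter>D\<in>M. if dense_in PP incl (elts D) then (\<Union>d\<in>elts D. ?F d) else UNIV)"
  proof -
    have "random_filter M x \<subseteq> PP" for x by (simp add: random_filter_def)
    then have f: "p \<in> random_filter M x \<Longrightarrow> p \<in> PP" for p x by blast
    have g: "generic M PP incl G \<longleftrightarrow> (\<exists>p\<in>PP. p \<in> G) \<and> (\<forall>p\<in>PP. \<forall>q\<in>PP. incl p q \<longrightarrow> p \<notin> G \<or> q \<in> G) \<and>
       (\<forall>p\<in>PP. \<forall>q\<in>PP. (p \<notin> G \<or> q \<notin> G) \<or> (\<exists>r\<in>{r \<in> PP. incl r p \<and> incl r q}. r \<in> G)) \<and>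
       (\<forall>D\<in>M. dense_in PP incl (elts D) \<longrightarrow> (\<exists>d\<in>elts D. d \<in> G))" if "G \<subseteq> PP" for G
    proof -
      have 1: "G \<noteq> {} \<longleftrightarrow> (\<exists>p\<in>PP. p \<in> G)"
        and 2: "(\<forall>p\<in>G. \<forall>q\<in>PP. incl p q \<longrightarrow> q \<in> G) \<longleftrightarrow> (\<forall>p\<in>PP. \<forall>q\<in>PP. incl p q \<longrightarrow> p \<notin> G \<or> q \<in> G)"
        and 3: "(\<forall>p\<in>G. \<forall>q\<in>G. \<exists>r\<in>G. incl r p \<and> incl r q) \<longleftrightarrow>
          (\<forall>p\<in>PP. \<forall>q\<in>PP. (p \<notin> G \<or> q \<notin> G) \<or> (\<exists>r\<in>{r \<in> PP. incl r p \<and> incl r q}. r \<in> G))"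
        and 4: "(\<forall>D\<in>M. dense_in PP incl (elts D) \<longrightarrow> G \<inter> elts D \<noteq> {}) \<longleftrightarrow>
          (\<forall>D\<in>M. dense_in PP incl (elts D) \<longrightarrow> (\<exists>d\<in>elts D. d \<in> G))"
        using that by blast+
      show ?thesis unfolding generic_def filter_on_def 1 2 3 4 using that by simp
    qed
    have if_UNIV: "x \<in> (if b then A else UNIV) \<longleftrightarrow> (b \<longrightarrow> x \<in> A)" for x b and A :: "(nat \<Rightarrow> bool) set"
      by simp
    have "x \<in> random_reals M \<longleftrightarrow> generic M PP incl (random_filter M x)" for x
      by (simp add: random_reals_def)
    then show ?thesis
      unfolding set_eq_iff Int_iff INT_iff UN_iff if_UNIV Un_iff Compl_iff mem_Collect_eq
        g[OF \<open>\<And>x. random_filter M x \<subseteq> PP\<close>] by (simp only: conj_assoc simp_thms)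
  qed
  also have "\<dots> \<in> sets borel"
  proof (intro sets.Int)
    have ne [simp]: "PP \<noteq> {}" "M \<noteq> {}" using RMh_PP M_ne by blast+
    show "(\<Union>p\<in>PP. ?F p) \<in> sets borel" by (intro sets.countable_UN' countable_PP) auto
    show "(\<Inter>p\<in>PP. \<Inter>q\<in>PP. if incl p q then - ?F p \<union> ?F q else UNIV) \<in> sets borel"
      by (intro sets.countable_INT' countable_PP ne image_subsetI) (simp add: sets.Un)
    show "(\<Inter>p\<in>PP. \<Inter>q\<in>PP. - ?F p \<union> - ?F q \<union> (\<Union>r\<in>{r \<in> PP. incl r p \<and> incl r q}. ?F r)) \<in> sets borel"
      by (auto intro!: sets.countable_INT' countable_PP ne sets.Un sets.countable_UN'
          intro: countable_subset[OF _ countable_PP])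
    show "(\<Inter>D\<in>M. if dense_in PP incl (elts D) then (\<Union>d\<in>elts D. ?F d) else UNIV) \<in> sets borel"
      by (intro sets.countable_INT' M_countable ne image_subsetI) (auto intro!: sets.countable_UN')
  qed
  finally show ?thesis .
qed

end

section \<open>Automorphisms of the binary tree in the model\<close>

locale tree_inv =
  fixes g :: "(nat \<Rightarrow> bool) \<Rightarrow> nat \<Rightarrow> bool" and gs :: "bool list \<Rightarrow> bool list"
  assumes len [simp]: "length (gs s) = length s"
    and cyl_gs: "g x \<in> cyl (gs s) \<longleftrightarrow> x \<in> cyl s"
    and invol [simp]: "g (g x) = x"
begin

lemma cyl_gs': "g x \<in> cyl s \<longleftrightarrow> x \<in> cyl (gs s)"
  using cyl_gs[of "g x" s] by simp

lemma gs_map: "gs (map x [0..<n]) = map (g x) [0..<n]"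
  using cyl_gs[of x "map x [0..<n]"] by (simp add: cyl_map)

lemma gs_gs [simp]: "gs (gs s) = s"
proof -
  have "s = map (\<lambda>i. s ! i) [0..<length s]" by (simp add: map_nth)
  then obtain x n where s: "s = map x [0..<n]" by blast
  show ?thesis by (simp add: s gs_map)
qed

lemma gs_inj: "inj_on gs A"
  by (rule inj_on_inverseI[of _ gs]) simp

lemma level_g: "{x. map (g x) [0..<L] \<in> T} = {x. map x [0..<L] \<in> gs ` T}"
proof (rule Collect_cong)
  fix x
  show "map (g x) [0..<L] \<in> T \<longleftrightarrow> map x [0..<L] \<in> gs ` T"
    unfolding gs_map[symmetric] by (metis (no_types, lifting) gs_gs imageE imageI)
qed

lemma g_measurable [measurable]: "g \<in> borel_measurable borel"
proof (rule measurable_coordinates)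
  fix n
  have "{x. g x n} = {x. map (g x) [0..<Suc n] \<in> {t. length t = Suc n \<and> t ! n}}"
    by (auto simp: nth_append)
  then show "{x. g x n} \<in> sets borel" unfolding level_g by (simp only:) (rule measure_level, auto)
qed

text \<open>It suffices to test events that depend on the first \<open>L\<close> coordinates; there
  \<open>g\<close> permutes the strings of length \<open>L\<close>, which are equally
  likely.\<close>

lemma distr_g: "distr coin borel g = coin"
proof -
  have "distr coin borel g = PiM UNIV (\<lambda>_. measure_pmf (bernoulli_pmf (1/2)))"
  proof (rule coinP.PiM_eq)
    show "sets (distr coin borel g) = sets (PiM UNIV (\<lambda>_. measure_pmf (bernoulli_pmf (1/2))))"
      using sets_coin by (simp add: coin_def)
    fix J :: "nat set" and F :: "nat \<Rightarrow> bool set" assume J: "finite J"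
    let ?X = "prod_emb UNIV (\<lambda>_. measure_pmf (bernoulli_pmf (1/2))) J (\<Pi>\<^sub>E j\<in>J. F j)"
    obtain L where L: "\<And>j. j \<in> J \<Longrightarrow> j < L" using finite_nat_set_iff_bounded[of J] J by auto
    define T where "T = {t. length t = L \<and> (\<forall>j\<in>J. t ! j \<in> F j)}"
    have X: "?X = {x. map x [0..<L] \<in> T}"
      using L by (auto simp: prod_emb_def T_def space_PiM)
    have T: "T \<subseteq> {t. length t = L}" "gs ` T \<subseteq> {t. length t = L}" by (auto simp: T_def)
    have "emeasure (distr coin borel g) ?X = emeasure coin {x. map (g x) [0..<L] \<in> T}"
      unfolding X using measure_level(1)[OF T(1)] by (subst emeasure_distr) (auto simp: vimage_def)
    also have "\<dots> = emeasure coin ?X"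
      unfolding X level_g coin.emeasure_eq_measure measure_level(2)[OF T(1)] measure_level(2)[OF T(2)]
      by (simp add: card_image[OF gs_inj])
    also have "\<dots> = (\<Prod>j\<in>J. emeasure (measure_pmf (bernoulli_pmf (1/2))) (F j))"
      unfolding coin_def by (rule coinP.emeasure_PiM_emb) (auto simp: J)
    finally show "emeasure (distr coin borel g) ?X = (\<Prod>j\<in>J. emeasure (measure_pmf (bernoulli_pmf (1/2))) (F j))" .
  qed
  then show ?thesis by (simp add: coin_def)
qed

lemma AE_g: "AE x in coin. P x \<Longrightarrow> AE x in coin. P (g x)"
proof -
  assume "AE x in coin. P x"
  then have "AE x in distr coin borel g. P x" by (simp only: distr_g)
  then show "AE x in coin. P (g x)" by (rule AE_distrD[rotated]) simp
qed

end

locale ctm_aut = ctm M + tree_inv g gs for M g gs +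
  assumes gM: "hset (range (\<lambda>s. opair (hstring s) (hstring (gs s)))) \<in> M"
begin

definition "gsh = hset (range (\<lambda>s. opair (hstring s) (hstring (gs s))))"

lemma app_gsh [simp]: "app gsh (hstring s) = hstring (gs s)"
  by (rule app_eq) (auto simp: gsh_def)

text \<open>The action on reals recovered inside \<open>M\<close> from the action on strings, as the
  union of the images of the initial segments.\<close>

definition hg :: "hc \<Rightarrow> hc" where
  "hg z = hUnion (hset ((\<lambda>s. app gsh s) ` elts (hset {s \<in> elts Str. elts s \<subseteq> elts z})))"

lemma dtm_hg [dfn_intro]: "dtm t \<Longrightarrow> dtm (\<lambda>e. hg (t e))"
  by (erule dtm_subst1[rotated]) (unfold hg_def, intro dfn_intro dtm_const gM[folded gsh_def])

lemma hg_hreal [simp]: "hg (hreal x) = hreal (g x)"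
proof (rule hc_ext)
  have "elts (hset {s \<in> elts Str. elts s \<subseteq> elts (hreal x)}) = hstring ` {s. x \<in> cyl s}"
    unfolding elts_sep unfolding elts_Str using hstring_sub_hreal by blast
  then have "elts (hg (hreal x)) = (\<Union>s\<in>{s. x \<in> cyl s}. elts (hstring (gs s)))"
    by (simp add: hg_def image_image del: elts_hstring elts_hreal)
  also have "\<dots> = elts (hreal (g x))"
  proof (intro equalityI subsetI)
    fix p assume "p \<in> elts (hreal (g x))"
    then obtain n where "p = opair (ord_nat n) (hbit (g x n))" by auto
    then have "p \<in> elts (hstring (gs (map x [0..<Suc n])))"
      unfolding gs_map by (auto intro!: image_eqI[of _ _ n] simp del: upt_Suc)
    then show "p \<in> (\<Union>s\<in>{s. x \<in> cyl s}. elts (hstring (gs s)))"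
      by (intro UN_I[of "map x [0..<Suc n]"]) (auto simp: cyl_map simp del: upt_Suc elts_hstring)
  next
    fix p assume "p \<in> (\<Union>s\<in>{s. x \<in> cyl s}. elts (hstring (gs s)))"
    then show "p \<in> elts (hreal (g x))" using hstring_sub_hreal cyl_gs by blast
  qed
  finally show "elts (hg (hreal x)) = elts (hreal (g x))" .
qed

lemma g_RM [simp]: "g x \<in> RM \<longleftrightarrow> x \<in> RM"
proof -
  have "x \<in> RM \<Longrightarrow> g x \<in> RM" for x
    using dtm_M1[OF dtm_hg[OF dtm_var], of "hreal x"] by (simp add: reals_of_def)
  from this[of x] this[of "g x"] show ?thesis by auto
qed

lemma g_image_sub: "Y \<subseteq> RM \<Longrightarrow> g ` Y \<subseteq> RM"
  by auto

lemma g_image_iff: "y \<in> g ` Y \<longleftrightarrow> g y \<in> Y"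
  by (metis imageE imageI invol)

definition hG :: "hc \<Rightarrow> hc" where "hG p = hset (hg ` elts p)"

lemma dtm_hG [dfn_intro]: "dtm t \<Longrightarrow> dtm (\<lambda>e. hG (t e))"
  by (erule dtm_subst1[rotated]) (unfold hG_def, intro dfn_intro)

lemma hG_hreals: "Y \<subseteq> RM \<Longrightarrow> hG (hreals Y) = hreals (g ` Y)"
  by (rule hc_ext) (simp add: hG_def image_image g_image_sub del: elts_hreal)

lemma AE_interp_eq:
  assumes "c \<in> codes" "d \<in> codes" "interp RM c = interp RM d"
  shows "AE x in coin. x \<in> interp UNIV c \<longleftrightarrow> x \<in> interp UNIV d"
proof -
  have "measure coin (interp UNIV c - interp UNIV d) = 0" "measure coin (interp UNIV d - interp UNIV c) = 0"
    using interp_mono_null assms by simp_all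
  then have "interp UNIV c - interp UNIV d \<in> null_sets coin" "interp UNIV d - interp UNIV c \<in> null_sets coin"
    by (auto intro!: null_setsI simp: coin.emeasure_eq_measure)
  from AE_not_in[OF this(1)] AE_not_in[OF this(2)] show ?thesis by eventually_elim auto
qed

text \<open>In the universe the image is required only up to a null set. This is what survives the
  choice, inside \<open>M\<close>, of codes for the members of a sequence.\<close>

definition image_code :: "borel_code \<Rightarrow> borel_code \<Rightarrow> bool" where
  "image_code c d \<longleftrightarrow> interp RM d = g ` interp RM c \<and> (AE x in coin. g x \<in> interp UNIV d \<longleftrightarrow> x \<in> interp UNIV c)"

lemma ex_image_code: "c \<in> codes \<Longrightarrow> \<exists>d\<in>codes. image_code c d"
proof (induction c)
  case (Basic s)
  have "image_code (Basic s) (Basic (gs s))"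
    unfolding image_code_def by (auto simp: cyl_gs g_image_iff cyl_gs')
  then show ?case by (intro bexI[of _ "Basic (gs s)"]) auto
next
  case (Compl c)
  then obtain d where "d \<in> codes" "image_code c d" by auto
  then show ?case
    by (intro bexI[of _ "Compl d"]) (auto simp: image_code_def set_eq_iff g_image_iff)
next
  case (Union f)
  have IH: "\<exists>d\<in>codes. image_code (f n) d" for n
    by (rule Union.IH[OF rangeI codes_UnionD[OF Union.prems]])
  define F where "F = hseq (\<lambda>n. hcode (f n))"
  have F: "F \<in> M" using Union.prems by (simp add: F_def)
  \<comment> \<open>\<open>M\<close> can only ask for the right interpretation in \<open>M\<close>.
    By \<open>AE_interp_eq\<close> the chosen codes then have the right interpretation in the
    universe up to null sets.\<close>
  define R where "R n y \<longleftrightarrow> y \<in> range hcode \<and> Iop y = hG (Iop (app F n))" for n y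
  have R: "R (ord_nat n) (hcode d) \<longleftrightarrow> interp RM d = g ` interp RM (f n)" for n d
    using hreals_inj[OF interp_subset g_image_sub[OF interp_subset]]
    by (simp add: R_def F_def Iop_hcode hG_hreals interp_subset)
  have "dfn (\<lambda>e. R (e 0) (e 1))"
    unfolding R_def by (intro dfn_intro dtm_const F)
  moreover have "\<exists>y\<in>M. R (ord_nat n) y" for n
  proof -
    obtain d where "d \<in> codes" "image_code (f n) d" using IH by blast
    then show ?thesis by (intro bexI[of _ "hcode d"]) (auto simp: R image_code_def dest: codesD)
  qed
  ultimately obtain y where y: "\<And>n. y n \<in> M" "\<And>n. R (ord_nat n) (y n)" "hseq y \<in> M"
    using choice_M[of R] by blast
  then have "\<forall>n. \<exists>d. y n = hcode d" unfolding R_def by blast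
  then obtain d where d: "\<And>n. y n = hcode (d n)" by metis
  have U: "Union d \<in> codes" using y(3) by (simp flip: d)
  then have dc: "d n \<in> codes" for n by (rule codes_UnionD)
  have dR: "interp RM (d n) = g ` interp RM (f n)" for n using y(2)[of n] R d by simp
  have "AE x in coin. g x \<in> interp UNIV (d n) \<longleftrightarrow> x \<in> interp UNIV (f n)" for n
  proof -
    obtain e where e: "e \<in> codes" "interp RM e = g ` interp RM (f n)"
      "AE x in coin. g x \<in> interp UNIV e \<longleftrightarrow> x \<in> interp UNIV (f n)"
      using IH[of n] unfolding image_code_def by blast
    have "AE x in coin. g x \<in> interp UNIV e \<longleftrightarrow> g x \<in> interp UNIV (d n)"
      by (rule AE_g, rule AE_interp_eq) (use e dc dR in auto)
    with e(3) show ?thesis by eventually_elim simp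
  qed
  then have "AE x in coin. \<forall>n. g x \<in> interp UNIV (d n) \<longleftrightarrow> x \<in> interp UNIV (f n)"
    by (subst AE_all_countable) blast
  then have "AE x in coin. g x \<in> interp UNIV (Union d) \<longleftrightarrow> x \<in> interp UNIV (Union f)"
    by eventually_elim auto
  then have "image_code (Union f) (Union d)"
    using dR by (auto simp: image_code_def)
  then show ?case using U by blast
qed

definition im :: "borel_code \<Rightarrow> borel_code" where
  "im c = (SOME d. d \<in> codes \<and> image_code c d)"

lemma im: assumes "c \<in> codes" shows "im c \<in> codes" "image_code c (im c)"
proof -
  have "\<exists>d. d \<in> codes \<and> image_code c d" using ex_image_code[OF assms] by blast
  from someI_ex[OF this] show "im c \<in> codes" "image_code c (im c)" by (auto simp: im_def)
qed

lemma hG_PP: assumes "c \<in> codes" shows "hG (hreals (interp RM c)) = hreals (interp RM (im c))"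
  using im(2)[OF assms] by (simp add: image_code_def hG_hreals interp_subset)

text \<open>Countably many almost sure conditions that make the filter of \<open>g x\<close> the
  image under \<open>hG\<close> of the filter of \<open>x\<close>.\<close>

definition regular :: "(nat \<Rightarrow> bool) \<Rightarrow> bool" where
  "regular x \<longleftrightarrow> avoids_null x \<and> avoids_null (g x) \<and>
     (\<forall>c\<in>codes. g x \<in> interp UNIV (im c) \<longleftrightarrow> x \<in> interp UNIV c)"

lemma AE_regular: "AE x in coin. regular x"
proof -
  have "AE x in coin. \<forall>c\<in>codes. g x \<in> interp UNIV (im c) \<longleftrightarrow> x \<in> interp UNIV c"
    by (subst AE_ball_countable[OF countable_codes]) (use im(2) in \<open>auto simp: image_code_def\<close>)
  then show ?thesis using AE_avoids_null AE_g[OF AE_avoids_null]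
    by eventually_elim (simp add: regular_def)
qed

lemma regular_filter:
  assumes "regular x" "p \<in> PP"
  shows "hG p \<in> random_filter M (g x) \<longleftrightarrow> p \<in> random_filter M x" "p \<in> random_filter M x \<Longrightarrow> hG p \<in> PP"
proof -
  obtain c where c: "c \<in> codes" "p = hreals (interp RM c)" using PP_cases[OF assms(2)] by blast
  show *: "hG p \<in> random_filter M (g x) \<longleftrightarrow> p \<in> random_filter M x"
    using assms(1) c im(1)[OF c(1)] unfolding regular_def c(2) hG_PP[OF c(1)]
    by (simp add: avoids_null_filter)
  then show "p \<in> random_filter M x \<Longrightarrow> hG p \<in> PP" by (simp add: random_filter_def)
qed

text \<open>A set of positive measure contains a regular \<open>x\<close>; then \<open>hG p\<close>
  lies in the filter of \<open>g x\<close>, which consists of conditions.\<close>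

lemma hG_in_PP: assumes "p \<in> PP" shows "hG p \<in> PP"
proof -
  obtain c where c: "c \<in> codes" "p = hreals (interp RM c)" "measure coin (interp UNIV c) \<noteq> 0"
    using PP_cases[OF assms(1)] by blast
  have "\<exists>x. regular x \<and> x \<in> interp UNIV c"
  proof (rule ccontr)
    assume n: "\<not> (\<exists>x. regular x \<and> x \<in> interp UNIV c)"
    from AE_regular have "AE x in coin. x \<notin> interp UNIV c"
      by eventually_elim (use n in blast)
    then have "emeasure coin (interp UNIV c) = 0"
      by (subst (asm) AE_iff_measurable[of "interp UNIV c"]) auto
    then show False using c(3) by (simp add: measure_def)
  qed
  then obtain x where x: "regular x" "x \<in> interp UNIV c" by blast
  then have "p \<in> random_filter M x" using c by (simp add: avoids_null_filter regular_def)
  then show ?thesis using regular_filter[OF x(1) assms] by blast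
qed

definition nmap :: "hc \<Rightarrow> hc" where
  "nmap = hrec (\<lambda>t f. hset ((\<lambda>z. opair (app f (hfst z)) (hG (hsnd z))) ` elts t))"

lemma nmap_M: "t \<in> M \<Longrightarrow> nmap t \<in> M"
proof -
  have "dtm (\<lambda>e. nmap (e 0))" unfolding nmap_def by (rule dtm_hrec) (intro dfn_intro)+
  then show "t \<in> M \<Longrightarrow> nmap t \<in> M" by (rule dtm_M1)
qed

lemma elts_nmap:
  assumes "is_name PP t"
  shows "elts (nmap t) = {opair (nmap s) (hG p) | s p. opair s p \<in> elts t}"
proof -
  have pair: "\<exists>s p. z = opair s p" if "z \<in> elts t" for z
    using assms that by (cases rule: is_name.cases) blast
  have "elts (nmap t) = (\<lambda>z. opair (app (gr nmap (tc t)) (hfst z)) (hG (hsnd z))) ` elts t"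
    unfolding nmap_def by (subst hrec) simp
  also have "\<dots> = {opair (nmap s) (hG p) | s p. opair s p \<in> elts t}"
  proof (intro equalityI subsetI)
    fix w assume "w \<in> (\<lambda>z. opair (app (gr nmap (tc t)) (hfst z)) (hG (hsnd z))) ` elts t"
    then obtain z where z: "z \<in> elts t" "w = opair (app (gr nmap (tc t)) (hfst z)) (hG (hsnd z))" by blast
    obtain s p where "z = opair s p" using pair[OF z(1)] by blast
    then show "w \<in> {opair (nmap s) (hG p) | s p. opair s p \<in> elts t}"
      using z opair_tc[of s p t] by auto
  next
    fix w assume "w \<in> {opair (nmap s) (hG p) | s p. opair s p \<in> elts t}"
    then obtain s p where sp: "opair s p \<in> elts t" "w = opair (nmap s) (hG p)" by blast
    then show "w \<in> (\<lambda>z. opair (app (gr nmap (tc t)) (hfst z)) (hG (hsnd z))) ` elts t"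
      using opair_tc[of s p t] by (intro image_eqI[of _ _ "opair s p"]) auto
  qed
  finally show ?thesis .
qed

lemma name_nmap: "is_name PP t \<Longrightarrow> is_name PP (nmap t)"
proof (induction rule: is_name.induct)
  case (1 t)
  then have "is_name PP t" by (intro is_name.intros) blast
  show ?case
  proof (rule is_name.intros)
    fix z assume "z \<in> elts (nmap t)"
    then obtain s p where sp: "opair s p \<in> elts t" "z = opair (nmap s) (hG p)"
      unfolding elts_nmap[OF \<open>is_name PP t\<close>] by blast
    then have "p \<in> PP" "is_name PP (nmap s)" using 1[OF sp(1)] by auto
    then show "\<exists>s p. z = opair s p \<and> p \<in> PP \<and> is_name PP s" using sp hG_in_PP by blast
  qed
qed

text \<open>Conditions and names are moved together, so the filter of \<open>g x\<close> activates
  the image of a pair exactly when the filter of \<open>x\<close> activates the pair.\<close>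

lemma val_nmap:
  assumes x: "regular x"
  shows "is_name PP t \<Longrightarrow> val (random_filter M (g x)) (nmap t) = val (random_filter M x) t"
proof (induction rule: is_name.induct)
  case (1 t)
  then have t: "is_name PP t" by (intro is_name.intros) blast
  let ?G = "random_filter M x" and ?H = "random_filter M (g x)"
  have sp: "p \<in> PP" "val ?H (nmap s) = val ?G s" if "opair s p \<in> elts t" for s p
    using 1[OF that] by auto
  have "{s. \<exists>p\<in>?H. opair s p \<in> elts (nmap t)} = nmap ` {s. \<exists>p\<in>?G. opair s p \<in> elts t}"
  proof (intro equalityI subsetI)
    fix s' assume "s' \<in> {s. \<exists>p\<in>?H. opair s p \<in> elts (nmap t)}"
    then obtain s p where s: "opair s p \<in> elts t" "s' = nmap s" "hG p \<in> ?H"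
      unfolding elts_nmap[OF t] by auto
    then have "p \<in> ?G" using regular_filter[OF x] sp by blast
    then show "s' \<in> nmap ` {s. \<exists>p\<in>?G. opair s p \<in> elts t}" using s by blast
  next
    fix s' assume "s' \<in> nmap ` {s. \<exists>p\<in>?G. opair s p \<in> elts t}"
    then obtain s p where s: "opair s p \<in> elts t" "s' = nmap s" "p \<in> ?G" by blast
    then have "hG p \<in> ?H" using regular_filter[OF x] sp by blast
    then show "s' \<in> {s. \<exists>p\<in>?H. opair s p \<in> elts (nmap t)}"
      unfolding elts_nmap[OF t] using s by blast
  qed
  then have "elts (val ?H (nmap t)) = (\<lambda>s. val ?H (nmap s)) ` {s. \<exists>p\<in>?G. opair s p \<in> elts t}"
    by (simp add: elts_val image_image)
  also have "\<dots> = elts (val ?G t)"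
    unfolding elts_val using sp(2) by (intro image_cong) auto
  finally show ?case by (rule hc_ext)
qed

lemma regular_ext: assumes "regular x" shows "random_ext M x \<subseteq> random_ext M (g x)"
proof
  fix w assume "w \<in> random_ext M x"
  then obtain t where "t \<in> M" "is_name PP t" "w = val (random_filter M x) t"
    unfolding random_ext_def generic_ext_def by blast
  then show "w \<in> random_ext M (g x)"
    unfolding random_ext_def generic_ext_def
    using val_nmap[OF assms] nmap_M name_nmap by (auto intro!: exI[of _ "nmap t"])
qed

text \<open>The two inclusions are \<open>regular_ext\<close> at \<open>x\<close> and at
  \<open>g x\<close>, as \<open>g\<close> is an involution; \<open>g x\<close> too is almost surely
  regular since \<open>g\<close> preserves the measure.\<close>

theorem AE_random_equiv: "AE x in coin. (x, g x) \<in> random_equiv M"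
  using AE_random AE_g[OF AE_random] AE_regular AE_g[OF AE_regular]
proof eventually_elim
  case (elim x)
  then show ?case
    using regular_ext[of x] regular_ext[of "g x"] by (auto simp: random_equiv_def)
qed

end

section \<open>Weighted distances in forests\<close>

definition cut :: "'a rel \<Rightarrow> 'a \<times> 'a \<Rightarrow> 'a rel" where
  "cut T e = T - {e, prod.swap e}"

text \<open>In a forest these are the edges of the path from \<open>x\<close> to \<open>y\<close>,
  each in both orientations if \<open>T\<close> is symmetric. No path has to be chosen, and the
  triangle inequality becomes the inclusion \<open>sep_trans\<close>.\<close>

definition sep :: "'a rel \<Rightarrow> 'a \<Rightarrow> 'a \<Rightarrow> ('a \<times> 'a) set" where
  "sep T x y = {e \<in> T. (x, y) \<notin> (cut T e)\<^sup>*}"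

lemma finite_path: "(x, y) \<in> T\<^sup>* \<Longrightarrow> \<exists>F\<subseteq>T. finite F \<and> (x, y) \<in> F\<^sup>*"
proof (induction rule: rtrancl_induct)
  case (step y z)
  then obtain F where F: "F \<subseteq> T" "finite F" "(x, y) \<in> F\<^sup>*" by blast
  then have "(x, y) \<in> (insert (y, z) F)\<^sup>*" by (meson rtrancl_mono subset_insertI subsetD)
  then have "(x, z) \<in> (insert (y, z) F)\<^sup>*" by (rule rtrancl_into_rtrancl) simp
  then show ?case using F step by (intro exI[of _ "insert (y, z) F"]) auto
qed auto

text \<open>A finite connecting set of edges must contain every separating edge in one of its
  orientations.\<close>

lemma finite_sep: assumes "(x, y) \<in> T\<^sup>*" shows "finite (sep T x y)"
proof -
  obtain F where F: "F \<subseteq> T" "finite F" "(x, y) \<in> F\<^sup>*" using finite_path[OF assms] by blast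
  have "sep T x y \<subseteq> F \<union> prod.swap ` F"
  proof
    fix e assume e: "e \<in> sep T x y"
    show "e \<in> F \<union> prod.swap ` F"
    proof (rule ccontr)
      assume "e \<notin> F \<union> prod.swap ` F"
      then have "e \<notin> F" "prod.swap e \<notin> F" using image_eqI[of e prod.swap "prod.swap e" F] by auto
      then have "F \<subseteq> cut T e" using F(1) unfolding cut_def by blast
      then have "(x, y) \<in> (cut T e)\<^sup>*" using F(3) rtrancl_mono by blast
      then show False using e by (simp add: sep_def)
    qed
  qed
  then show ?thesis using F(2) finite_subset by blast
qed

lemma sep_trans: "sep T x y \<subseteq> sep T x z \<union> sep T z y"
  by (auto simp: sep_def intro: rtrancl_trans)

lemma sym_cut: "sym T \<Longrightarrow> sym (cut T e)"
  by (cases e) (auto simp: cut_def sym_def)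

lemma sep_sym: "sym T \<Longrightarrow> sep T x y = sep T y x"
  using sym_rtrancl[OF sym_cut[of T]] by (auto simp: sep_def sym_def)

definition path :: "'a rel \<Rightarrow> 'a list \<Rightarrow> bool" where
  "path T p \<longleftrightarrow> successively (\<lambda>x y. (x, y) \<in> T) p"

lemma path_Cons [simp]: "path T (x # p) \<longleftrightarrow> (p = [] \<or> (x, hd p) \<in> T) \<and> path T p"
  by (cases p) (auto simp: path_def)

lemma path_appendD: "path T (p @ q) \<Longrightarrow> path T q"
  by (auto simp: path_def successively_append_iff)

lemma path_rtrancl: "path T p \<Longrightarrow> p \<noteq> [] \<Longrightarrow> (hd p, last p) \<in> T\<^sup>*"
  by (induction p) (auto intro: converse_rtrancl_into_rtrancl)

lemma simple_path:
  "(x, y) \<in> T\<^sup>* \<Longrightarrow> \<exists>p. p \<noteq> [] \<and> hd p = x \<and> last p = y \<and> distinct p \<and> path T p"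
proof (induction rule: converse_rtrancl_induct)
  case base
  then show ?case by (intro exI[of _ "[y]"]) (auto simp: path_def)
next
  case (step x z)
  then obtain p where p: "p \<noteq> []" "hd p = z" "last p = y" "distinct p" "path T p" by blast
  show ?case
  proof (cases "x \<in> set p")
    case True
    then obtain q r where "p = q @ x # r" by (meson split_list)
    then show ?thesis using p path_appendD[of T q "x # r"] by (intro exI[of _ "x # r"]) auto
  next
    case False
    then show ?thesis using p step by (intro exI[of _ "x # p"]) auto
  qed
qed

lemma path_nth: "path T p \<Longrightarrow> Suc i < length p \<Longrightarrow> (p ! i, p ! Suc i) \<in> T"
  by (simp add: path_def successively_conv_nth)

text \<open>A simple path from \<open>x\<close> to \<open>v\<close> that avoids the edge has at
  least three vertices and is closed to a cycle by the edge.\<close>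

lemma bridge:
  assumes T: "sym T" "irrefl T" "acyclic_graph T" and xv: "(x, v) \<in> T"
  shows "(x, v) \<notin> (cut T (x, v))\<^sup>*"
proof
  assume "(x, v) \<in> (cut T (x, v))\<^sup>*"
  then obtain p where p: "p \<noteq> []" "hd p = x" "last p = v" "distinct p" "path (cut T (x, v)) p"
    using simple_path by metis
  have "x \<noteq> v" using T(2) xv by (auto simp: irrefl_def)
  have len: "length p \<ge> 3"
  proof (rule ccontr)
    assume "\<not> length p \<ge> 3"
    obtain q where q: "p = x # q" using p(1,2) by (cases p) auto
    show False
    proof (cases q)
      case Nil
      then show False using p(3) q \<open>x \<noteq> v\<close> by simp
    next
      case (Cons b r)
      then have "r = []" using \<open>\<not> length p \<ge> 3\<close> q by (cases r) auto
      then have "q = [v]" using p(3) q Cons by simp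
      then show False using p(5) q by (simp add: cut_def)
    qed
  qed
  have "(p ! i, p ! (Suc i mod length p)) \<in> T" if "i < length p" for i
  proof (cases "Suc i < length p")
    case True
    then show ?thesis using path_nth[OF p(5)] by (auto simp: cut_def)
  next
    case False
    then have "Suc i = length p" using that by simp
    then have "p ! i = v" "Suc i mod length p = 0" using p(1,3)
      by (simp_all add: last_conv_nth flip: \<open>Suc i = length p\<close>)
    then show ?thesis using p(1,2) xv T(1) by (auto simp: hd_conv_nth sym_def)
  qed
  then show False using T(3) len p(4) unfolding acyclic_graph_def by blast
qed

text \<open>Take the first edge of a simple path: the rest never returns to \<open>x\<close>, so
  this edge separates \<open>x\<close> from \<open>y\<close> but not \<open>v\<close> from
  \<open>y\<close>. It is the induction step for distances.\<close>

lemma first_edge: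
  assumes T: "sym T" "irrefl T" "acyclic_graph T" and xy: "(x, y) \<in> T\<^sup>*" "x \<noteq> y"
  obtains v where "(x, v) \<in> T" "(v, y) \<in> T\<^sup>*" "(x, v) \<in> sep T x y" "sep T v y \<subseteq> sep T x y - {(x, v)}"
proof -
  obtain p where p: "p \<noteq> []" "hd p = x" "last p = y" "distinct p" "path T p"
    using simple_path[OF xy(1)] by blast
  then obtain v q where q: "p = x # v # q" using xy(2)
    by (metis last_ConsL list.exhaust_sel)
  have xv: "(x, v) \<in> T" using p(5) by (simp add: q)
  have "path (cut T (x, v)) (v # q)"
  proof -
    have "successively (\<lambda>a b. (a, b) \<in> cut T (x, v)) (v # q)"
    proof (rule successively_mono)
      show "successively (\<lambda>a b. (a, b) \<in> T) (v # q)" using p(5) by (simp add: q path_def)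
      show "(a, b) \<in> cut T (x, v)" if "a \<in> set (v # q)" "b \<in> set (v # q)" "(a, b) \<in> T" for a b
        using that p(4) by (auto simp: q cut_def)
    qed
    then show ?thesis by (simp add: path_def)
  qed
  then have vy: "(v, y) \<in> (cut T (x, v))\<^sup>*" using path_rtrancl[of "cut T (x, v)" "v # q"] p(3) by (simp add: q)
  then have "(v, y) \<in> T\<^sup>*" by (rule rev_subsetD[OF _ rtrancl_mono]) (auto simp: cut_def)
  moreover have "(x, v) \<in> sep T x y"
  proof -
    have "(x, y) \<notin> (cut T (x, v))\<^sup>*"
    proof
      assume a: "(x, y) \<in> (cut T (x, v))\<^sup>*"
      have "(y, v) \<in> (cut T (x, v))\<^sup>*" using vy sym_rtrancl[OF sym_cut[OF T(1)]] by (auto dest: symD)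
      then show False using a bridge[OF T xv] rtrancl_trans by metis
    qed
    then show ?thesis using xv by (simp add: sep_def)
  qed
  moreover have "sep T v y \<subseteq> sep T x y - {(x, v)}"
  proof
    fix e assume e: "e \<in> sep T v y"
    have "e \<noteq> (x, v)" using e vy by (auto simp: sep_def)
    moreover have "e \<noteq> (v, x)"
    proof
      assume "e = (v, x)"
      then have "cut T e = cut T (x, v)" by (auto simp: cut_def)
      then show False using e vy by (auto simp: sep_def)
    qed
    ultimately have "(v, x) \<in> cut T e" using xv T(1) by (cases e) (auto simp: cut_def sym_def)
    then have "(x, y) \<notin> (cut T e)\<^sup>*" using e by (auto simp: sep_def dest: converse_rtrancl_into_rtrancl)
    then show "e \<in> sep T x y - {(x, v)}" using e \<open>e \<noteq> (x, v)\<close> by (auto simp: sep_def)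
  qed
  ultimately show ?thesis using that xv by blast
qed

definition wsum :: "'a rel \<Rightarrow> ('a \<times> 'a \<Rightarrow> real) \<Rightarrow> 'a \<Rightarrow> 'a \<Rightarrow> real" where
  "wsum T w x y = (\<Sum>e\<in>sep T x y. w e)"

lemma wsum_nonneg: "(\<And>e. 0 \<le> w e) \<Longrightarrow> 0 \<le> wsum T w x y"
  by (simp add: wsum_def sum_nonneg)

text \<open>Each edge costs at least 1, so after a first edge, for which there are finitely many
  choices, the remaining budget has dropped by 1.\<close>

lemma finite_ball:
  assumes T: "sym T" "irrefl T" "acyclic_graph T"
    and w: "\<And>e. e \<in> T \<Longrightarrow> 1 \<le> w e" "\<And>u r. finite {v. (u, v) \<in> T \<and> w (u, v) \<le> r}"
  shows "finite {y. (x, y) \<in> T\<^sup>* \<and> wsum T w x y \<le> real N}"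
proof (induction N arbitrary: x)
  case 0
  have "{y. (x, y) \<in> T\<^sup>* \<and> wsum T w x y \<le> real 0} \<subseteq> {x}"
  proof safe
    fix y assume y: "(x, y) \<in> T\<^sup>*" "wsum T w x y \<le> real 0"
    show "y = x"
    proof (rule ccontr)
      assume "y \<noteq> x"
      then obtain v where v: "(x, v) \<in> sep T x y" using first_edge[OF T y(1)] by metis
      then have "w (x, v) \<le> wsum T w x y"
        unfolding wsum_def using finite_sep[OF y(1)] w(1)
        by (intro member_le_sum) (auto simp: sep_def intro: order_trans[OF zero_le_one])
      moreover have "1 \<le> w (x, v)" using v w(1) by (auto simp: sep_def)
      ultimately show False using y(2) by simp
    qed
  qed
  then show ?case using finite_subset by blast
next
  case (Suc N)
  let ?B = "\<lambda>v. {y. (v, y) \<in> T\<^sup>* \<and> wsum T w v y \<le> real N}"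
  have "{y. (x, y) \<in> T\<^sup>* \<and> wsum T w x y \<le> real (Suc N)} \<subseteq>
      {x} \<union> (\<Union>v\<in>{v. (x, v) \<in> T \<and> w (x, v) \<le> real (Suc N)}. ?B v)"
  proof
    fix y assume "y \<in> {y. (x, y) \<in> T\<^sup>* \<and> wsum T w x y \<le> real (Suc N)}"
    then have y: "(x, y) \<in> T\<^sup>*" "wsum T w x y \<le> real (Suc N)" by auto
    show "y \<in> {x} \<union> (\<Union>v\<in>{v. (x, v) \<in> T \<and> w (x, v) \<le> real (Suc N)}. ?B v)"
    proof (cases "x = y")
      case False
      then obtain v where v: "(x, v) \<in> T" "(v, y) \<in> T\<^sup>*" "(x, v) \<in> sep T x y" "sep T v y \<subseteq> sep T x y - {(x, v)}"
        using first_edge[OF T y(1)] by metis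
      have fin: "finite (sep T x y)" by (rule finite_sep[OF y(1)])
      have w0: "0 \<le> w e" if "e \<in> sep T x y" for e using w(1)[of e] that by (auto simp: sep_def)
      have "wsum T w v y \<le> (\<Sum>e\<in>sep T x y - {(x, v)}. w e)"
        unfolding wsum_def using v(4) fin w0 by (intro sum_mono2) auto
      also have "\<dots> = wsum T w x y - w (x, v)"
        unfolding wsum_def using fin v(3) by (subst sum_diff1) auto
      finally have le: "wsum T w v y \<le> wsum T w x y - w (x, v)" .
      have "0 \<le> wsum T w v y"
        unfolding wsum_def by (intro sum_nonneg) (use v(4) w0 in blast)
      then have "w (x, v) \<le> real (Suc N)" "wsum T w v y \<le> real N" using le y(2) w(1)[OF v(1)] by auto
      then show ?thesis using v by blast
    qed simp
  qed
  moreover have "finite ({x} \<union> (\<Union>v\<in>{v. (x, v) \<in> T \<and> w (x, v) \<le> real (Suc N)}. ?B v))"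
    using w(2) Suc by blast
  ultimately show ?case by (rule finite_subset)
qed

section \<open>Free actions on forests\<close>

text \<open>Removing an edge outside the component of \<open>x\<close> disconnects nothing within
  it.\<close>

lemma sep_reachable:
  assumes "sym T" "(x, y) \<in> T\<^sup>*" "(u, v) \<in> sep T x y"
  shows "(x, u) \<in> T\<^sup>*" "(x, v) \<in> T\<^sup>*"
proof -
  have uv: "(u, v) \<in> T" "(v, u) \<in> T" using assms(1,3) by (auto simp: sep_def sym_def)
  have "(x, u) \<in> T\<^sup>*"
  proof (rule ccontr)
    assume u: "(x, u) \<notin> T\<^sup>*"
    then have v: "(x, v) \<notin> T\<^sup>*" using uv(2) by (meson rtrancl_into_rtrancl)
    have "(x, y) \<in> (cut T (u, v))\<^sup>*" using assms(2)
    proof (induction rule: rtrancl_induct)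
      case (step y z)
      then have "(y, z) \<in> cut T (u, v)" using u v by (auto simp: cut_def)
      then show ?case using step(3) by (rule rtrancl_into_rtrancl[rotated])
    qed simp
    then show False using assms(3) by (simp add: sep_def)
  qed
  then show "(x, u) \<in> T\<^sup>*" "(x, v) \<in> T\<^sup>*" using uv(1) by (auto intro: rtrancl_into_rtrancl)
qed

lemma abs_sum_diff_le:
  fixes f w :: "'a \<Rightarrow> real"
  assumes fin: "finite S" "finite S'" "finite E" and sub: "S \<subseteq> E \<union> S'" "S' \<subseteq> E \<union> S"
    and f: "\<And>e. 0 \<le> f e" "\<And>e. f e \<le> w e"
  shows "\<bar>sum f S - sum f S'\<bar> \<le> sum w E"
proof -
  have *: "sum f A \<le> sum w E + sum f B" if "finite A" "finite B" "A \<subseteq> E \<union> B" for A B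
  proof -
    have "sum f A \<le> sum f (E \<union> B)" using that fin(3) f(1) by (intro sum_mono2) auto
    also have "\<dots> \<le> sum f E + sum f B" using that fin(3) f(1) by (subst sum_Un) (auto intro: sum_nonneg)
    also have "sum f E \<le> sum w E" using f(2) by (intro sum_mono)
    finally show ?thesis by simp
  qed
  show ?thesis using *[OF fin(1,2) sub(1)] *[OF fin(2,1) sub(2)] by linarith
qed

text \<open>Sum along the enumeration and count an element at its first index only; since
  \<open>S x\<close> is finite, the partial sums are eventually constant.\<close>

lemma borel_measurable_finite_sum:
  fixes f :: "'a \<Rightarrow> 'b \<Rightarrow> real"
  assumes fin: "\<And>x. finite (S x)" and cov: "\<And>x. S x \<subseteq> range (\<lambda>n::nat. k n x)"
    and S [measurable]: "\<And>n. Measurable.pred M (\<lambda>x. k n x \<in> S x)"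
    and k [measurable]: "\<And>m n. Measurable.pred M (\<lambda>x. k m x = k n x)"
    and f [measurable]: "\<And>n. (\<lambda>x. f x (k n x)) \<in> borel_measurable M"
  shows "(\<lambda>x. \<Sum>e\<in>S x. f x e) \<in> borel_measurable M"
proof (rule borel_measurable_LIMSEQ_real)
  let ?P = "\<lambda>x n. k n x \<in> S x \<and> (\<forall>m<n. k m x \<noteq> k n x)"
  let ?g = "\<lambda>N x. \<Sum>n<N. if ?P x n then f x (k n x) else 0"
  show "?g N \<in> borel_measurable M" for N by measurable
  show "(\<lambda>N. ?g N x) \<longlonglongrightarrow> (\<Sum>e\<in>S x. f x e)" for x
  proof (rule tendsto_eventually)
    obtain C where C: "finite C" "S x = (\<lambda>n. k n x) ` C"
      using finite_subset_image[OF fin cov] by metis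
    obtain N0 where N0: "C \<subseteq> {..<N0}" using finite_nat_iff_bounded C(1) by blast
    have "?g N x = (\<Sum>e\<in>S x. f x e)" if "N0 \<le> N" for N
    proof -
      have "bij_betw (\<lambda>n. k n x) {n\<in>{..<N}. ?P x n} (S x)"
        unfolding bij_betw_def
      proof
        show "inj_on (\<lambda>n. k n x) {n\<in>{..<N}. ?P x n}"
          by (rule inj_onI) (metis (mono_tags, lifting) mem_Collect_eq nat_neq_iff)
        show "(\<lambda>n. k n x) ` {n\<in>{..<N}. ?P x n} = S x"
        proof
          show "S x \<subseteq> (\<lambda>n. k n x) ` {n\<in>{..<N}. ?P x n}"
          proof
            fix e assume e: "e \<in> S x"
            then obtain n where n: "n \<in> C" "e = k n x" using C(2) by blast
            obtain l where l: "k l x = e" "\<And>m. m < l \<Longrightarrow> k m x \<noteq> e"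
              using n(2) exists_least_iff[of "\<lambda>m. k m x = e"] by auto
            then have "l \<le> n" using n(2) by (metis not_le)
            then have "l < N" using n N0 that by auto
            then have "l \<in> {n\<in>{..<N}. ?P x n}" using l e by auto
            then show "e \<in> (\<lambda>n. k n x) ` {n\<in>{..<N}. ?P x n}"
              unfolding l(1)[symmetric] by (rule imageI)
          qed
        qed auto
      qed
      then have "(\<Sum>e\<in>S x. f x e) = (\<Sum>n\<in>{n\<in>{..<N}. ?P x n}. f x (k n x))"
        by (rule sum.reindex_bij_betw[symmetric])
      also have "\<dots> = ?g N x" by (rule sum.inter_filter) simp
      finally show ?thesis by simp
    qed
    then show "eventually (\<lambda>N. ?g N x = (\<Sum>e\<in>S x. f x e)) sequentially"
      by (rule eventually_sequentiallyI)
  qed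
qed

text \<open>The setting freed from the model. The forest enters measurably only through the
  countably many sets in \<open>T_meas\<close>, where \<open>h\<close> enumerates its
  components.\<close>

locale forest_action = prob_space P for P :: "'a::topological_space measure" +
  fixes R :: "'a set" and T :: "'a rel" and h :: "nat \<Rightarrow> 'a \<Rightarrow> 'a"
    and \<alpha> :: "'c::finite \<Rightarrow> 'a \<Rightarrow> 'a" and z :: "nat \<Rightarrow> 'a \<Rightarrow> 'a"
  assumes sets_P: "sets P = sets borel"
    and h_meas [measurable]: "\<And>n. h n \<in> borel_measurable borel"
    and \<alpha>_meas [measurable]: "\<And>c. \<alpha> c \<in> borel_measurable borel"
    and z_meas [measurable]: "\<And>n. z n \<in> borel_measurable borel"
    and eq_meas: "\<And>f g :: 'a \<Rightarrow> 'a. f \<in> borel_measurable borel \<Longrightarrow> g \<in> borel_measurable borel \<Longrightarrow>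
      {x. f x = g x} \<in> sets borel"
    and T_meas: "\<And>i j. {x. (h i x, h j x) \<in> T} \<in> sets borel"
    and T: "T \<subseteq> R \<times> R" "sym T" "irrefl T" "acyclic_graph T"
    and enum: "\<And>x y. x \<in> R \<Longrightarrow> (x, y) \<in> T\<^sup>* \<Longrightarrow> \<exists>n. h n x = y"
    and \<alpha>_distr: "\<And>c. distr P borel (\<alpha> c) = P"
    and z_distr: "\<And>n. distr P borel (z n) = P"
    and invol: "\<And>c x. \<alpha> c (\<alpha> c x) = x"
    and comm: "\<And>n c x. z n (\<alpha> c x) = \<alpha> c (z n x)"
    and z_inj: "\<And>x. inj (\<lambda>n. z n x)"
begin

lemma eq_pred [measurable (raw)]:
  fixes f g :: "'a \<Rightarrow> 'a"
  assumes "f \<in> borel_measurable borel" "g \<in> borel_measurable borel"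
  shows "Measurable.pred borel (\<lambda>x. f x = g x)"
  unfolding pred_def using eq_meas[OF assms] by simp

lemma T_pred [measurable]: "Measurable.pred borel (\<lambda>x. (h i x, h j x) \<in> T)"
  unfolding pred_def using T_meas by simp

lemma AE_\<alpha>: "AE x in P. Q x \<Longrightarrow> AE x in P. Q (\<alpha> c x)"
  using \<alpha>_meas[of c] by (intro AE_distrD[of "\<alpha> c" P borel Q])
    (simp_all only: \<alpha>_distr measurable_cong_sets[OF sets_P refl])

lemma AE_z: "AE x in P. Q x \<Longrightarrow> AE x in P. Q (z n x)"
  using z_meas[of n] by (intro AE_distrD[of "z n" P borel Q])
    (simp_all only: z_distr measurable_cong_sets[OF sets_P refl])

lemma reach_R: "(x, y) \<in> T\<^sup>* \<Longrightarrow> x \<in> R \<Longrightarrow> y \<in> R"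
  by (induction rule: rtrancl_induct) (use T(1) in auto)

lemma T_rtrancl_sym: "(x, y) \<in> T\<^sup>* \<Longrightarrow> (y, x) \<in> T\<^sup>*"
  using sym_rtrancl[OF T(2)] by (rule symD)

subsection \<open>Reduced words\<close>

text \<open>\<open>fold\<close> applies the head of the word first, so \<open>hd w\<close> is the
  first step away from \<open>x\<close>.\<close>

abbreviation act :: "'c list \<Rightarrow> 'a \<Rightarrow> 'a" where
  "act \<equiv> fold \<alpha>"

lemma act_meas [measurable]: "act w \<in> borel_measurable borel"
proof (induction w)
  case (Cons c w)
  have "act (c # w) = (\<lambda>x. act w (\<alpha> c x))" by auto
  then show ?case using measurable_compose[OF \<alpha>_meas Cons] by simp
qed (simp add: id_def[symmetric] flip: eq_id_iff)

lemma act_append: "act (v @ w) x = act w (act v x)"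
  by (induction v arbitrary: x) auto

lemma act_rev: "act (rev w) (act w x) = x"
  by (induction w arbitrary: x) (auto simp: act_append invol)

definition free :: "'a \<Rightarrow> bool" where
  "free x \<longleftrightarrow> (\<forall>w. w \<noteq> [] \<longrightarrow> distinct_adj w \<longrightarrow> act w x \<noteq> x)"

text \<open>Equal last letters cancel. If they differ, one word followed by the reversal of the
  other is reduced and fixes \<open>x\<close>.\<close>

lemma act_unique:
  assumes "free x"
  shows "act w x = act w' x \<Longrightarrow> distinct_adj w \<Longrightarrow> distinct_adj w' \<Longrightarrow> w = w'"
proof (induction w arbitrary: w' rule: rev_induct)
  case Nil
  then show ?case using assms unfolding free_def by (metis fold_simps(1))
next
  case (snoc c v)
  show ?case
  proof (cases w' rule: rev_cases)
    case Nil
    then show ?thesis using assms snoc.prems unfolding free_def by (metis fold_simps(1))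
  next
    case (snoc v' c')
    show ?thesis
    proof (cases "c = c'")
      case True
      then have "\<alpha> c (\<alpha> c (act v x)) = \<alpha> c (\<alpha> c (act v' x))"
        using snoc.prems(1) by (simp add: snoc act_append)
      then have "v = v'"
        using snoc.IH[of v'] snoc.prems(2,3) by (auto simp: snoc invol distinct_adj_append_iff)
      then show ?thesis using True snoc by simp
    next
      case False
      let ?w = "(v @ [c]) @ rev (v' @ [c'])"
      have "act ?w x = act (rev w') (act w' x)"
        using snoc.prems(1) by (simp add: snoc act_append del: rev_append)
      moreover have "distinct_adj ?w"
        using snoc.prems(2,3) False unfolding distinct_adj_append_iff[of "v @ [c]"] snoc distinct_adj_rev by simp
      ultimately show ?thesis using assms unfolding free_def act_rev by (metis Nil_is_append_conv list.distinct(1))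
    qed
  qed
qed

definition orbit :: "'a \<Rightarrow> 'a set" where
  "orbit x = {act w x | w. distinct_adj w}"

lemma orbit_\<alpha>_subset: "orbit x \<subseteq> orbit (\<alpha> c x)"
proof
  fix y assume "y \<in> orbit x"
  then obtain w where w: "distinct_adj w" "y = act w x" by (auto simp: orbit_def)
  show "y \<in> orbit (\<alpha> c x)"
  proof (cases "w \<noteq> [] \<and> hd w = c")
    case True
    then have "w = c # tl w" by (cases w) auto
    then have "y = act (tl w) (\<alpha> c x)" "distinct_adj (tl w)" using w by (metis fold_simps(2), metis distinct_adj_ConsD)
    then show ?thesis by (auto simp: orbit_def)
  next
    case False
    then have "distinct_adj (c # w)" using w by (auto simp: distinct_adj_Cons)
    moreover have "y = act (c # w) (\<alpha> c x)" using w by (simp add: invol)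
    ultimately show ?thesis unfolding orbit_def by blast
  qed
qed

lemma orbit_\<alpha>: "orbit (\<alpha> c x) = orbit x"
  using orbit_\<alpha>_subset[of x c] orbit_\<alpha>_subset[of "\<alpha> c x" c] by (auto simp: invol)

lemma self_in_orbit: "x \<in> orbit x"
  unfolding orbit_def using fold_simps(1) distinct_adj_Nil by (metis (mono_tags) mem_Collect_eq)

text \<open>The point \<open>u\<close> distinguishes the point \<open>h m u\<close> of the orbit of \<open>x\<close> with \<open>m\<close> least, and \<open>toward c x u\<close>
  says that the reduced word leading from \<open>x\<close> to that point begins with \<open>c\<close>.\<close>

definition toward :: "'c \<Rightarrow> 'a \<Rightarrow> 'a \<Rightarrow> bool" where
  "toward c x u \<longleftrightarrow> (\<exists>m. (\<exists>w. distinct_adj (c # w) \<and> act (c # w) x = h m u) \<and> (\<forall>k<m. h k u \<notin> orbit x))"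

lemma towardE:
  assumes "toward c x u"
  obtains w where "distinct_adj (c # w)" "act (c # w) x = h (LEAST m. h m u \<in> orbit x) u"
proof -
  obtain m w where m: "distinct_adj (c # w)" "act (c # w) x = h m u" "\<forall>k<m. h k u \<notin> orbit x"
    using assms unfolding toward_def by blast
  then have "h m u \<in> orbit x" unfolding orbit_def by (metis (mono_tags, lifting) mem_Collect_eq)
  then have "(LEAST m. h m u \<in> orbit x) = m" using m(3) by (intro Least_equality) (auto simp: not_less[symmetric])
  then show ?thesis using m that by simp
qed

lemma towardI:
  assumes "distinct_adj (c # w)" "act (c # w) x = h (LEAST m. h m u \<in> orbit x) u"
  shows "toward c x u"
  unfolding toward_def using assms not_less_Least[of _ "\<lambda>m. h m u \<in> orbit x"] by blast

lemma toward_unique: "free x \<Longrightarrow> toward c x u \<Longrightarrow> toward d x u \<Longrightarrow> c = d"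
  by (elim towardE) (metis act_unique list.inject)

text \<open>Both points have the same orbit, hence \<open>u\<close> picks the same point for both,
  and the words leading to it differ by a leading \<open>c\<close>. Some point is picked since the
  enumeration from \<open>u\<close> reaches \<open>x\<close>.\<close>

lemma toward_\<alpha>:
  assumes "free x" "x \<in> R" "(u, x) \<in> T\<^sup>*"
  shows "toward c (\<alpha> c x) u \<longleftrightarrow> \<not> toward c x u"
proof
  assume "toward c (\<alpha> c x) u"
  then obtain w where w: "distinct_adj (c # w)" "act (c # w) (\<alpha> c x) = h (LEAST m. h m u \<in> orbit x) u"
    by (elim towardE) (simp add: orbit_\<alpha>)
  show "\<not> toward c x u"
  proof
    assume "toward c x u"
    then obtain w' where "distinct_adj (c # w')" "act (c # w') x = h (LEAST m. h m u \<in> orbit x) u"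
      by (elim towardE)
    moreover have "act w x = h (LEAST m. h m u \<in> orbit x) u" using w(2) by (simp add: invol)
    ultimately have "w = c # w'" using act_unique[OF assms(1), of w "c # w'"] distinct_adj_ConsD[OF w(1)] by simp
    then show False using w(1) by simp
  qed
next
  assume n: "\<not> toward c x u"
  have "u \<in> R" using assms(2,3) T_rtrancl_sym reach_R by blast
  then obtain m where "h m u = x" using enum assms(3) by blast
  then have "h m u \<in> orbit x" by (simp add: self_in_orbit)
  then have "h (LEAST m. h m u \<in> orbit x) u \<in> orbit x" by (rule LeastI)
  then obtain w where w: "distinct_adj w" "act w x = h (LEAST m. h m u \<in> orbit x) u"
    unfolding orbit_def by force
  have "\<not> (w \<noteq> [] \<and> hd w = c)"
  proof
    assume "w \<noteq> [] \<and> hd w = c"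
    then have "w = c # tl w" by (cases w) auto
    then show False using n towardI[of c "tl w" x u] w by simp
  qed
  then have "distinct_adj (c # w)" using w(1) by (auto simp: distinct_adj_Cons)
  moreover have "act (c # w) (\<alpha> c x) = h (LEAST m. h m u \<in> orbit (\<alpha> c x)) u"
    using w(2) by (simp add: invol orbit_\<alpha>)
  ultimately show "toward c (\<alpha> c x) u" by (rule towardI)
qed

lemma toward_pred [measurable]: "Measurable.pred borel (\<lambda>x. toward c x (h i x))"
  unfolding toward_def orbit_def mem_Collect_eq by measurable

end

text \<open>The indicators tend to 0 pointwise and are bounded by 1, so dominated convergence
  applies.\<close>

lemma (in prob_space) prob_finitely_often:
  assumes B: "\<And>n::nat. B n \<in> events" and fin: "\<And>x. finite {n. x \<in> B n}"
  shows "(\<lambda>n. prob (B n)) \<longlonglongrightarrow> 0"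
proof -
  have "(\<lambda>n. \<integral>x. indicator (B n) x \<partial>M) \<longlonglongrightarrow> (\<integral>x. (0::real) \<partial>M)"
  proof (rule integral_dominated_convergence[where w = "\<lambda>_. 1"])
    show "AE x in M. (\<lambda>n. indicator (B n) x :: real) \<longlonglongrightarrow> 0"
    proof (rule AE_I2)
      fix x
      obtain N where N: "{n. x \<in> B n} \<subseteq> {..<N}" using fin[of x] finite_nat_iff_bounded by blast
      have "indicator (B n) x = (0::real)" if "n \<ge> N" for n
        using that N by (auto simp: indicator_def)
      then show "(\<lambda>n. indicator (B n) x :: real) \<longlonglongrightarrow> 0"
        by (intro tendsto_eventually eventually_sequentiallyI)
    qed
  qed (use B in \<open>auto intro!: borel_measurable_indicator simp: indicator_def\<close>)
  then show ?thesis using B by simp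
qed

text \<open>The error in the numerators and the change of denominator cost \<open>K / D'\<close>
  each. For \<open>D = 0\<close> also \<open>N = 0\<close>, and the quotient is 0.\<close>

lemma abs_ratio_sum_le:
  fixes N N' D D' K :: real
  assumes "0 \<le> N" "N \<le> D" "0 < D'" "\<bar>N' + N - D'\<bar> \<le> K" "\<bar>D' - D\<bar> \<le> K"
  shows "\<bar>N' / D' + N / D - 1\<bar> \<le> 2 * K / D'"
proof -
  have "\<bar>N / D - N / D'\<bar> \<le> K / D'"
  proof (cases "D = 0")
    case True
    then have "N = 0" using assms(1,2) by simp
    then show ?thesis using assms(3,5) by simp
  next
    case False
    then have "0 < D" using assms(1,2) by simp
    then have "N / D - N / D' = (N / D) * ((D' - D) / D')" using assms(3) by (simp add: field_simps)
    then have "\<bar>N / D - N / D'\<bar> = (N / D) * (\<bar>D' - D\<bar> / D')"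
      using assms(1,3) \<open>0 < D\<close> by (simp add: abs_mult)
    also have "\<dots> \<le> 1 * (K / D')"
      using assms \<open>0 < D\<close> by (intro mult_mono divide_right_mono) auto
    finally show ?thesis by simp
  qed
  moreover have "\<bar>(N' + N - D') / D'\<bar> \<le> K / D'"
    using assms(3,4) by (simp add: divide_right_mono)
  moreover have "N' / D' + N / D - 1 = (N' + N - D') / D' + (N / D - N / D')"
    using assms(3) by (simp add: field_simps)
  moreover have "2 * K / D' = K / D' + K / D'" by (simp add: field_simps)
  ultimately show ?thesis by linarith
qed

section \<open>Weights, shares of a path and their measurability\<close>

context forest_action
begin

definition good :: "'a \<Rightarrow> bool" where
  "good x \<longleftrightarrow> x \<in> R \<and> free x \<and> (\<forall>c. (x, \<alpha> c x) \<in> T\<^sup>*) \<and> (\<forall>n. (x, z n x) \<in> T\<^sup>*)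
     \<and> (\<forall>n c. (z n x, \<alpha> c (z n x)) \<in> T\<^sup>*)"

text \<open>One more than the index of the second vertex in the enumeration from the first: at each
  vertex only finitely many edges are light, and the weight is Borel along \<open>h\<close>.\<close>

definition weight :: "'a \<times> 'a \<Rightarrow> real" where
  "weight e = 1 + real (LEAST n. h n (fst e) = snd e)"

lemma weight_ge_1: "1 \<le> weight e"
  by (simp add: weight_def)

lemma weight_nonneg: "0 \<le> weight e"
  by (simp add: weight_def)

lemma finite_light_edges: "finite {v. (u, v) \<in> T \<and> weight (u, v) \<le> r}"
proof (cases "u \<in> R")
  case True
  have "{v. (u, v) \<in> T \<and> weight (u, v) \<le> r} \<subseteq> (\<lambda>n. h n u) ` {..nat \<lfloor>r\<rfloor>}"
  proof
    fix v assume v: "v \<in> {v. (u, v) \<in> T \<and> weight (u, v) \<le> r}"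
    then obtain n where "h n u = v" using enum[OF True, of v] by blast
    then have "h (LEAST n. h n u = v) u = v" by (rule LeastI)
    moreover have "(LEAST n. h n u = v) \<le> nat \<lfloor>r\<rfloor>"
      using v by (simp add: weight_def le_nat_floor)
    ultimately show "v \<in> (\<lambda>n. h n u) ` {..nat \<lfloor>r\<rfloor>}" by (metis atMost_iff image_eqI)
  qed
  then show ?thesis by (rule finite_subset) simp
next
  case False
  then have "{v. (u, v) \<in> T \<and> weight (u, v) \<le> r} = {}" using T(1) by blast
  then show ?thesis by (simp only: finite.emptyI)
qed

lemma finite_weighted_ball: "finite {y. (x, y) \<in> T\<^sup>* \<and> wsum T weight x y \<le> r}"
proof (rule finite_subset)
  show "finite {y. (x, y) \<in> T\<^sup>* \<and> wsum T weight x y \<le> real (nat \<lceil>r\<rceil>)}"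
    by (rule finite_ball[OF T(2-4) weight_ge_1 finite_light_edges])
  show "{y. (x, y) \<in> T\<^sup>* \<and> wsum T weight x y \<le> r} \<subseteq> {y. (x, y) \<in> T\<^sup>* \<and> wsum T weight x y \<le> real (nat \<lceil>r\<rceil>)}"
    using real_nat_ceiling_ge[of r] by (auto intro: order_trans)
qed

text \<open>An oriented edge votes by its first vertex. Both orientations occur in
  \<open>sep T x y\<close>, so both end points of an edge vote, each with the weight of its own
  orientation.\<close>

definition toward_sum :: "'c \<Rightarrow> 'a \<Rightarrow> 'a \<Rightarrow> real" where
  "toward_sum c x y = (\<Sum>e\<in>sep T x y. if toward c x (fst e) then weight e else 0)"

lemma toward_sum_nonneg: "0 \<le> toward_sum c x y"
  unfolding toward_sum_def by (intro sum_nonneg) (simp add: weight_nonneg)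

lemma toward_sum_le: "toward_sum c x y \<le> wsum T weight x y"
  unfolding toward_sum_def wsum_def by (intro sum_mono) (simp add: weight_nonneg)

lemma sum_toward_sum:
  assumes "free x"
  shows "(\<Sum>c\<in>UNIV. toward_sum c x y) \<le> wsum T weight x y"
proof -
  have "(\<Sum>c\<in>UNIV. if toward c x u then weight e else 0) \<le> weight e" for u e
  proof (cases "\<exists>c. toward c x u")
    case True
    then obtain c where c: "toward c x u" by blast
    then have "toward d x u \<longleftrightarrow> d = c" for d using toward_unique[OF assms] by blast
    then show ?thesis by simp
  qed (simp add: weight_nonneg)
  then have "(\<Sum>e\<in>sep T x y. \<Sum>c\<in>UNIV. if toward c x (fst e) then weight e else 0) \<le> wsum T weight x y"
    unfolding wsum_def by (intro sum_mono)
  then show ?thesis unfolding toward_sum_def by (subst sum.swap)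
qed

text \<open>The two paths differ only by edges in \<open>?E\<close>, between \<open>x\<close> and
  \<open>\<alpha> c x\<close> or between \<open>z n x\<close> and its image. On the common part
  \<open>toward_\<alpha>\<close> makes the votes complementary.\<close>

lemma ratio_bound:
  assumes "good x" and pos: "0 < wsum T weight (\<alpha> c x) (z n (\<alpha> c x))"
  shows "\<bar>toward_sum c (\<alpha> c x) (z n (\<alpha> c x)) / wsum T weight (\<alpha> c x) (z n (\<alpha> c x))
      + toward_sum c x (z n x) / wsum T weight x (z n x) - 1\<bar>
    \<le> 2 * (wsum T weight x (\<alpha> c x) + wsum T weight (z n x) (\<alpha> c (z n x)))
      / wsum T weight (\<alpha> c x) (z n (\<alpha> c x))"
proof -
  let ?y = "\<alpha> c x" let ?u = "z n x" let ?v = "z n ?y"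
  let ?S = "sep T x ?u" let ?S' = "sep T ?y ?v" let ?E = "sep T x ?y \<union> sep T ?u ?v"
  let ?K = "wsum T weight x ?y + wsum T weight ?u ?v"
  have v: "?v = \<alpha> c ?u" by (rule comm)
  have xR: "x \<in> R" "free x" and xy: "(x, ?y) \<in> T\<^sup>*" and xu: "(x, ?u) \<in> T\<^sup>*" and uv: "(?u, ?v) \<in> T\<^sup>*"
    using assms(1) by (auto simp: good_def v)
  have yv: "(?y, ?v) \<in> T\<^sup>*" using T_rtrancl_sym[OF xy] xu uv by (meson rtrancl_trans)
  have fin: "finite ?S" "finite ?S'" "finite ?E" using finite_sep xy xu uv yv by auto
  have sub: "?S \<subseteq> ?E \<union> ?S'"
    using sep_trans[of T x ?u ?y] sep_trans[of T ?y ?u ?v] sep_sym[OF T(2), of ?v ?u] by blast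
  have sub': "?S' \<subseteq> ?E \<union> ?S"
    using sep_trans[of T ?y ?v x] sep_trans[of T x ?v ?u] sep_sym[OF T(2), of ?y x] by blast
  have E: "sum weight ?E \<le> ?K"
    unfolding wsum_def using fin by (subst sum_Un) (auto intro!: sum_nonneg weight_nonneg)
  let ?f = "\<lambda>e. if toward c x (fst e) then weight e else 0"
  have "toward_sum c ?y ?v = (\<Sum>e\<in>?S'. weight e - ?f e)"
    unfolding toward_sum_def
  proof (rule sum.cong[OF refl])
    fix e assume e: "e \<in> ?S'"
    have "(?y, fst e) \<in> T\<^sup>*" using sep_reachable(1)[OF T(2) yv, of "fst e" "snd e"] e by simp
    then have "(fst e, x) \<in> T\<^sup>*" using xy by (meson T_rtrancl_sym rtrancl_trans)
    from toward_\<alpha>[OF xR(2,1) this, of c]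
    show "(if toward c ?y (fst e) then weight e else 0) = weight e - ?f e" by simp
  qed
  then have N': "toward_sum c ?y ?v = wsum T weight ?y ?v - sum ?f ?S'"
    by (simp add: sum_subtractf wsum_def)
  have "\<bar>sum ?f ?S - sum ?f ?S'\<bar> \<le> sum weight ?E"
    by (rule abs_sum_diff_le[OF fin sub sub']) (simp_all add: weight_nonneg)
  then have 1: "\<bar>toward_sum c ?y ?v + toward_sum c x ?u - wsum T weight ?y ?v\<bar> \<le> ?K"
    using E unfolding N' by (simp add: toward_sum_def)
  have "\<bar>sum weight ?S' - sum weight ?S\<bar> \<le> sum weight ?E"
    by (rule abs_sum_diff_le[OF fin(2,1,3) sub' sub]) (simp_all add: weight_nonneg)
  then have 2: "\<bar>wsum T weight ?y ?v - wsum T weight x ?u\<bar> \<le> ?K" using E by (simp add: wsum_def)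
  show ?thesis
    using abs_ratio_sum_le[OF toward_sum_nonneg toward_sum_le pos 1 2] by (simp add: v)
qed

text \<open>Walks of length \<open>n\<close> from \<open>x\<close> to \<open>h p x\<close> that
  avoid the edge between \<open>h i x\<close> and \<open>h j x\<close>. Vertices are given by
  indices, so only countable quantifiers occur.\<close>

primrec reach :: "nat \<Rightarrow> nat \<Rightarrow> nat \<Rightarrow> nat \<Rightarrow> 'a \<Rightarrow> bool" where
  "reach 0 i j p x \<longleftrightarrow> h p x = x"
| "reach (Suc n) i j p x \<longleftrightarrow> (\<exists>l. reach n i j l x \<and> (h l x, h p x) \<in> T
     \<and> \<not> (h l x = h i x \<and> h p x = h j x) \<and> \<not> (h l x = h j x \<and> h p x = h i x))"

lemma reach_pred [measurable]: "Measurable.pred borel (reach n i j p)"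
proof (induction n arbitrary: p)
  case 0
  show ?case unfolding reach.simps by measurable
next
  case (Suc n)
  note [measurable] = this
  show ?case unfolding reach.simps by measurable
qed

lemma reach_iff:
  assumes "x \<in> R"
  shows "reach n i j p x \<longleftrightarrow> (x, h p x) \<in> cut T (h i x, h j x) ^^ n"
proof (induction n arbitrary: p)
  case (Suc n)
  show ?case
  proof
    assume "reach (Suc n) i j p x"
    then obtain l where "reach n i j l x" "(h l x, h p x) \<in> cut T (h i x, h j x)"
      by (auto simp: cut_def)
    then show "(x, h p x) \<in> cut T (h i x, h j x) ^^ Suc n" using Suc by auto
  next
    assume "(x, h p x) \<in> cut T (h i x, h j x) ^^ Suc n"
    then obtain y where y: "(x, y) \<in> cut T (h i x, h j x) ^^ n" "(y, h p x) \<in> cut T (h i x, h j x)"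
      by (rule relpow_Suc_E)
    have "cut T (h i x, h j x) \<subseteq> T" by (auto simp: cut_def)
    then have "(x, y) \<in> T\<^sup>*" using relpow_imp_rtrancl[OF y(1)] rtrancl_mono by blast
    then obtain l where l: "h l x = y" using enum[OF assms] by blast
    then have "reach n i j l x" using Suc y(1) by simp
    moreover have "(h l x, h p x) \<in> T" "\<not> (h l x = h i x \<and> h p x = h j x)" "\<not> (h l x = h j x \<and> h p x = h i x)"
      using y(2) l by (auto simp: cut_def)
    ultimately show "reach (Suc n) i j p x" unfolding reach.simps by blast
  qed
qed auto

context
  fixes X and \<phi> :: "'a \<Rightarrow> 'a"
  assumes X [measurable]: "X \<in> sets borel" and X_R: "X \<subseteq> R"
    and \<phi> [measurable]: "\<phi> \<in> borel_measurable borel"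
    and conn: "\<And>x. x \<in> X \<Longrightarrow> (x, \<phi> x) \<in> T\<^sup>*"
begin

text \<open>Countably many walks \<open>reach n i j p\<close> decide whether the edge separates; on
  \<open>X\<close> the point \<open>\<phi> x\<close> is sure to have an index
  \<open>p\<close>.\<close>

lemma sep_pred:
  "Measurable.pred borel (\<lambda>x. (h i x, h j x) \<in> (if x \<in> X then sep T x (\<phi> x) else {}))"
proof -
  have "(x, \<phi> x) \<in> (cut T (h i x, h j x))\<^sup>* \<longleftrightarrow> (\<exists>n p. h p x = \<phi> x \<and> reach n i j p x)" if "x \<in> X" for x
  proof -
    have "\<exists>p. h p x = \<phi> x" using enum[of x "\<phi> x"] conn[OF that] X_R that by blast
    moreover have "reach n i j p x \<longleftrightarrow> (x, h p x) \<in> cut T (h i x, h j x) ^^ n" for n p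
      using reach_iff X_R that by blast
    ultimately show ?thesis unfolding rtrancl_is_UN_relpow by force
  qed
  then have "(h i x, h j x) \<in> (if x \<in> X then sep T x (\<phi> x) else {}) \<longleftrightarrow>
      x \<in> X \<and> (h i x, h j x) \<in> T \<and> \<not> (\<exists>n p. h p x = \<phi> x \<and> reach n i j p x)" for x
    by (simp add: sep_def)
  then show ?thesis by simp
qed

lemma weighted_sum_measurable:
  assumes [measurable]: "\<And>i. Measurable.pred borel (\<lambda>x. f x (h i x))"
  shows "(\<lambda>x. if x \<in> X then \<Sum>e\<in>sep T x (\<phi> x). if f x (fst e) then weight e else 0 else 0) \<in> borel_measurable borel"
proof -
  let ?S = "\<lambda>x. if x \<in> X then sep T x (\<phi> x) else {}"
  let ?k = "\<lambda>n x. (h (fst (prod_decode n)) x, h (snd (prod_decode n)) x)"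
  have "(\<lambda>x. \<Sum>e\<in>?S x. if f x (fst e) then weight e else 0) \<in> borel_measurable borel"
  proof (rule borel_measurable_finite_sum[where k = ?k])
    show "finite (?S x)" for x by (simp add: finite_sep conn)
    show "?S x \<subseteq> range (\<lambda>n. ?k n x)" for x
    proof safe
      fix u v assume uv: "(u, v) \<in> ?S x"
      then have x: "x \<in> X" by (simp split: if_splits)
      then have "(x, u) \<in> T\<^sup>*" "(x, v) \<in> T\<^sup>*" using sep_reachable[OF T(2) conn] uv by auto
      then obtain i j where "h i x = u" "h j x = v" using enum X_R x by (meson subsetD)
      then have "(u, v) = ?k (prod_encode (i, j)) x" by simp
      then show "(u, v) \<in> range (\<lambda>n. ?k n x)" by blast
    qed
    show "Measurable.pred borel (\<lambda>x. ?k n x \<in> ?S x)" for n by (rule sep_pred)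
    show "Measurable.pred borel (\<lambda>x. ?k m x = ?k n x)" for m n unfolding prod.inject by measurable
    show "(\<lambda>x. if f x (fst (?k n x)) then weight (?k n x) else 0) \<in> borel_measurable borel" for n
      unfolding weight_def fst_conv snd_conv by measurable
  qed
  moreover have "(\<Sum>e\<in>?S x. if f x (fst e) then weight e else 0) =
      (if x \<in> X then \<Sum>e\<in>sep T x (\<phi> x). if f x (fst e) then weight e else 0 else 0)" for x by simp
  ultimately show ?thesis by simp
qed

end

end

section \<open>The contradiction by integration\<close>

locale free_forest_action = forest_action P R T h \<alpha> z
  for P :: "'a::topological_space measure" and R T h
    and \<alpha> :: "'c::finite \<Rightarrow> 'a \<Rightarrow> 'a" and z +
  assumes AE_conn: "AE x in P. x \<in> R \<and> (\<forall>c. (x, \<alpha> c x) \<in> T\<^sup>*) \<and> (\<forall>n. (x, z n x) \<in> T\<^sup>*)"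
    and AE_fold: "AE x in P. \<forall>w. w \<noteq> [] \<longrightarrow> distinct_adj w \<longrightarrow> fold \<alpha> w x \<noteq> x"
    and three: "3 \<le> CARD('c)"
begin

lemma AE_good: "AE x in P. good x"
proof -
  have "AE x in P. \<forall>n. z n x \<in> R \<and> (\<forall>c. (z n x, \<alpha> c (z n x)) \<in> T\<^sup>*) \<and> (\<forall>m. (z n x, z m (z n x)) \<in> T\<^sup>*)"
    unfolding AE_all_countable by (intro allI AE_z AE_conn)
  with AE_conn AE_fold show ?thesis unfolding good_def free_def by eventually_elim blast
qed

text \<open>The complement of a measurable null set around the bad points; a Borel set of full
  measure can stand in for the set of all good points.\<close>

lemma good_set:
  obtains X where "X \<in> sets borel" "AE x in P. x \<in> X" "\<And>x. x \<in> X \<Longrightarrow> good x"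
proof -
  have "\<exists>N\<in>null_sets P. {x \<in> space P. \<not> good x} \<subseteq> N"
    using AE_good unfolding eventually_ae_filter .
  then obtain N where N: "{x \<in> space P. \<not> good x} \<subseteq> N" "N \<in> null_sets P"
    by (elim bexE)
  have sp: "space P = UNIV" using sets_eq_imp_space_eq[OF sets_P] by simp
  show ?thesis
  proof (rule that[of "- N"])
    show "- N \<in> sets borel" using N(2) sets_P by (metis borel_comp null_setsD2)
    show "AE x in P. x \<in> - N" using AE_not_in[OF N(2)] by simp
    show "good x" if "x \<in> - N" for x using N(1) that sp by auto
  qed
qed

lemma P_measurable: "f \<in> borel_measurable borel \<Longrightarrow> f \<in> borel_measurable P"
  by (simp add: measurable_cong_sets[OF sets_P refl])

lemma prob_preimage:
  assumes "distr P borel g = P" "g \<in> borel_measurable borel" "B \<in> sets borel"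
  shows "prob (g -` B) = prob B"
proof -
  have "prob B = measure (distr P borel g) B" by (simp add: assms(1))
  also have "\<dots> = prob (g -` B \<inter> space P)"
    by (rule measure_distr) (use assms P_measurable in auto)
  finally show ?thesis using sets_eq_imp_space_eq[OF sets_P] by simp
qed

theorem inconsistent: False
proof -
  obtain X where X [measurable]: "X \<in> sets borel" and AE_X: "AE x in P. x \<in> X" and X_good: "\<And>x. x \<in> X \<Longrightarrow> good x"
    using good_set by blast
  have X_R: "X \<subseteq> R" using X_good by (auto simp: good_def)
  have conn: "(x, \<alpha> c x) \<in> T\<^sup>*" "(x, z n x) \<in> T\<^sup>*" if "x \<in> X" for x c n
    using X_good[OF that] by (auto simp: good_def)
  define d where "d \<phi> x = (if x \<in> X then wsum T weight x (\<phi> x) else 0)" for \<phi> x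
  \<comment> \<open>The fraction takes the value 0 outside \<open>X\<close> and where the path has
    no weight.\<close>
  define F where "F c n x = (if x \<in> X then toward_sum c x (z n x) else 0) / d (z n) x" for c n x
  have d_meas: "d \<phi> \<in> borel_measurable borel"
    if "\<phi> \<in> borel_measurable borel" "\<And>x. x \<in> X \<Longrightarrow> (x, \<phi> x) \<in> T\<^sup>*" for \<phi>
    using weighted_sum_measurable[OF X X_R that, of "\<lambda>_ _. True"]
    unfolding d_def[abs_def] wsum_def if_True by simp
  have d\<alpha> [measurable]: "d (\<alpha> c) \<in> borel_measurable borel" for c by (rule d_meas) (auto intro: conn)
  have dz [measurable]: "d (z n) \<in> borel_measurable borel" for n by (rule d_meas) (auto intro: conn)
  have F_meas [measurable]: "F c n \<in> borel_measurable borel" for c n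
  proof -
    have [measurable]: "(\<lambda>x. if x \<in> X then toward_sum c x (z n x) else 0) \<in> borel_measurable borel"
      unfolding toward_sum_def by (rule weighted_sum_measurable[OF X X_R z_meas conn(2)]) auto
    show ?thesis unfolding F_def[abs_def] by measurable
  qed
  have d0: "0 \<le> d \<phi> x" for \<phi> x by (simp add: d_def wsum_nonneg weight_nonneg)
  have F0: "0 \<le> F c n x" for c n x
    unfolding F_def using d0 toward_sum_nonneg by (intro divide_nonneg_nonneg) auto
  have F_sum: "(\<Sum>c\<in>UNIV. F c n x) \<le> 1" for n x
  proof (cases "x \<in> X \<and> d (z n) x \<noteq> 0")
    case True
    then have "free x" using X_good by (simp add: good_def)
    then have "(\<Sum>c\<in>UNIV. toward_sum c x (z n x)) \<le> d (z n) x"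
      using sum_toward_sum True by (simp add: d_def)
    then show ?thesis using True d0[of "z n" x] by (simp add: F_def flip: sum_divide_distrib)
  next
    case False
    then have "F c n x = 0" for c unfolding F_def by auto
    then show ?thesis by simp
  qed
  have F1: "F c n x \<le> 1" for c n x
    using F_sum[of n x] member_le_sum[of c UNIV "\<lambda>c. F c n x"] F0 by auto
  have int: "integrable P (F c n)" for c n
    by (rule integrable_const_bound[of _ 1]) (use F0 F1 in \<open>auto intro!: P_measurable F_meas\<close>)
  have int': "integrable P (\<lambda>x. F c n (\<alpha> c x))" for c n
    by (rule integrable_const_bound[of _ 1]) (use F0 F1 in \<open>auto intro!: P_measurable\<close>)
  have integral_\<alpha>: "(\<integral>x. F c n (\<alpha> c x) \<partial>P) = (\<integral>x. F c n x \<partial>P)" for c n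
    using integral_distr[of "\<alpha> c" P borel "F c n"] P_measurable[OF \<alpha>_meas] F_meas by (simp add: \<alpha>_distr)
  \<comment> \<open>One bound for the cost of a generator, valid for all of the finitely many
    letters outside small events.\<close>
  have "\<exists>N. \<forall>c. prob {x. d (\<alpha> c) x > real N} < 1/40"
  proof -
    have "eventually (\<lambda>N. prob {x. d (\<alpha> c) x > real N} < 1/40) sequentially" for c
    proof (rule order_tendstoD(2)[OF prob_finitely_often])
      show "{x. d (\<alpha> c) x > real N} \<in> events" for N unfolding sets_P by measurable
      show "finite {N. x \<in> {x. d (\<alpha> c) x > real N}}" for x
        by (rule finite_subset[of _ "{..nat \<lceil>d (\<alpha> c) x\<rceil>}"]) (auto, linarith)
    qed simp
    then have "eventually (\<lambda>N. \<forall>c. prob {x. d (\<alpha> c) x > real N} < 1/40) sequentially"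
      by (rule eventually_all_finite)
    then show ?thesis by (rule eventually_happens'[OF sequentially_bot])
  qed
  then obtain N where N: "\<And>c. prob {x. d (\<alpha> c) x > real N} < 1/40" by blast
  \<comment> \<open>Both ends cost at most \<open>N\<close>, so by \<open>ratio_bound\<close> the
    error on a path of weight above \<open>L\<close> is at most \<open>4 * real N / L\<close>, which
    is below \<open>1/40\<close>.\<close>
  define L where "L = 160 * real N + 1"
  have "\<exists>n. prob {x \<in> X. d (z n) x \<le> L} < 1/40"
  proof -
    have "eventually (\<lambda>n. prob {x \<in> X. d (z n) x \<le> L} < 1/40) sequentially"
    proof (rule order_tendstoD(2)[OF prob_finitely_often])
      show "{x \<in> X. d (z n) x \<le> L} \<in> events" for n unfolding sets_P by measurable
      show "finite {n. x \<in> {x \<in> X. d (z n) x \<le> L}}" for x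
      proof (cases "x \<in> X")
        \<comment> \<open>Balls are finite and the points \<open>z n x\<close> are distinct, so only
          finitely many of them are close to \<open>x\<close>.\<close>
        case True
        have "finite ((\<lambda>n. z n x) -` {y. (x, y) \<in> T\<^sup>* \<and> wsum T weight x y \<le> L})"
          by (rule finite_vimageI[OF finite_weighted_ball z_inj])
        then show ?thesis using True conn(2) by (simp add: d_def vimage_def)
      qed simp
    qed simp
    then show ?thesis by (rule eventually_happens'[OF sequentially_bot])
  qed
  then obtain n where n: "prob {x \<in> X. d (z n) x \<le> L} < 1/40" by blast
  \<comment> \<open>The error \<open>1/40\<close> and three bad events of probability below
    \<open>1/40\<close> leave \<open>2 * 9/20 = 36/40\<close> for the two equal integrals.\<close>
  have F_int: "9/20 \<le> (\<integral>x. F c n x \<partial>P)" for c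
  proof -
    let ?E = "{x. d (\<alpha> c) x > real N}" let ?D = "{x \<in> X. d (z n) x \<le> L}"
    \<comment> \<open>Bad are a costly generator at \<open>x\<close>, a costly one at
      \<open>z n x\<close>, and a short path from \<open>\<alpha> c x\<close>. The last two are
      preimages under measure-preserving maps.\<close>
    let ?B = "?E \<union> z n -` ?E \<union> \<alpha> c -` ?D"
    have E [measurable]: "?E \<in> sets borel" and D [measurable]: "?D \<in> sets borel" by measurable
    have B: "z n -` ?E \<in> sets borel" "\<alpha> c -` ?D \<in> sets borel"
      using measurable_sets[OF z_meas E] measurable_sets[OF \<alpha>_meas D] by auto
    have "prob ?B \<le> prob (?E \<union> z n -` ?E) + prob (\<alpha> c -` ?D)"
      using E B by (intro measure_Un_le) (auto simp: sets_P)
    also have "prob (?E \<union> z n -` ?E) \<le> prob ?E + prob (z n -` ?E)"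
      using E B by (intro measure_Un_le) (auto simp: sets_P)
    also have "prob (z n -` ?E) = prob ?E" by (rule prob_preimage[OF z_distr z_meas E])
    also have "prob (\<alpha> c -` ?D) = prob ?D" by (rule prob_preimage[OF \<alpha>_distr \<alpha>_meas D])
    finally have pB: "prob ?B \<le> 3/40" using N[of c] n by linarith
    have Bm: "?B \<in> events" using E B by (auto simp: sets_P)
    have "AE x in P. x \<in> X \<and> \<alpha> c x \<in> X \<and> z n x \<in> X"
      using AE_X AE_\<alpha>[OF AE_X] AE_z[OF AE_X] by eventually_elim blast
    then have "AE x in P. \<bar>F c n (\<alpha> c x) + F c n x - 1\<bar> \<le> 1/40 + indicator ?B x"
    proof eventually_elim
      case (elim x)
      show ?case
      proof (cases "x \<in> ?B")
        case True
        then have "indicator ?B x = (1::real)" by simp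
        then show ?thesis using F0[of c n x] F1[of c n x] F0[of c n "\<alpha> c x"] F1[of c n "\<alpha> c x"]
          by linarith
      next
        case False
        then have b: "d (\<alpha> c) x \<le> real N" "d (\<alpha> c) (z n x) \<le> real N" "L < d (z n) (\<alpha> c x)"
          using elim by auto
        have L0: "0 < L" by (simp add: L_def)
        have "\<bar>F c n (\<alpha> c x) + F c n x - 1\<bar> \<le> 2 * (d (\<alpha> c) x + d (\<alpha> c) (z n x)) / d (z n) (\<alpha> c x)"
          using ratio_bound[OF X_good, of x c n] elim b(3) L0 by (simp add: F_def d_def)
        also have "\<dots> \<le> 4 * real N / L"
          using b L0 d0 by (intro frac_le) auto
        also have "\<dots> \<le> 1/40" using L0 by (simp add: L_def field_simps)
        finally show ?thesis using False by simp
      qed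
    qed
    then have AE_le: "AE x in P. 1 - (1/40 + indicator ?B x) \<le> F c n (\<alpha> c x) + F c n x"
      by (rule AE_mp) (intro AE_I2 impI, linarith)
    have int_B: "integrable P (indicator ?B :: 'a \<Rightarrow> real)"
      using Bm by (intro integrable_real_indicator) (simp_all add: less_top[symmetric])
    have "(\<integral>x. 1 - (1/40 + indicator ?B x) \<partial>P) \<le> (\<integral>x. F c n (\<alpha> c x) + F c n x \<partial>P)"
      by (intro integral_mono_AE AE_le Bochner_Integration.integrable_diff Bochner_Integration.integrable_add int int' int_B)
        simp_all
    also have "\<dots> = 2 * (\<integral>x. F c n x \<partial>P)" using int int' by (simp add: integral_\<alpha>)
    also have "(\<integral>x. 1 - (1/40 + indicator ?B x) \<partial>P) = 1 - (1/40 + prob ?B)"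
      using Bm int_B by (simp add: prob_space del: vimage_Un)
    finally show ?thesis using pB by simp
  qed
  \<comment> \<open>Here three letters matter: \<open>3 * (9/20)\<close> exceeds 1.\<close>
  have "3 * (9/20) \<le> real CARD('c) * (9/20)" using three by simp
  also have "\<dots> = (\<Sum>c\<in>(UNIV::'c set). 9/20)" by simp
  also have "\<dots> \<le> (\<Sum>c\<in>UNIV. \<integral>x. F c n x \<partial>P)" by (intro sum_mono F_int)
  also have "\<dots> = (\<integral>x. (\<Sum>c\<in>UNIV. F c n x) \<partial>P)" using int by simp
  also have "\<dots> \<le> (\<integral>x. 1 \<partial>P)" by (intro integral_mono) (use int F_sum in auto)
  also have "\<dots> = 1" by (simp add: prob_space)
  finally show False by simp
qed

end

section \<open>A free action by flips\<close>

definition flip :: "((nat \<Rightarrow> bool) \<Rightarrow> nat \<Rightarrow> bool) \<Rightarrow> (nat \<Rightarrow> bool) \<Rightarrow> nat \<Rightarrow> bool" where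
  "flip \<phi> x i \<longleftrightarrow> x i \<noteq> \<phi> x i"

definition flips :: "((nat \<Rightarrow> bool) \<Rightarrow> nat \<Rightarrow> bool) \<Rightarrow> bool list \<Rightarrow> bool list" where
  "flips \<phi> s = map (flip \<phi> ((!) s)) [0..<length s]"

text \<open>By \<open>causal\<close> the action is determined on finite strings, and by
  \<open>inv\<close> a second flip changes the same coordinates back.\<close>

lemma tree_inv_flip:
  assumes causal: "\<And>x y i. (\<And>j. j < i \<Longrightarrow> x j = y j) \<Longrightarrow> \<phi> x i = \<phi> y i"
    and inv: "\<And>x i. \<phi> (flip \<phi> x) i = \<phi> x i"
  shows "tree_inv (flip \<phi>) (flips \<phi>)"
proof
  show "length (flips \<phi> s) = length s" for s by (simp add: flips_def)
  show "flip \<phi> (flip \<phi> x) = x" for x by (auto simp: flip_def inv)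
  show "flip \<phi> x \<in> cyl (flips \<phi> s) \<longleftrightarrow> x \<in> cyl s" for x s
  proof
    assume "x \<in> cyl s"
    then have "\<phi> x i = \<phi> ((!) s) i" if "i < length s" for i
      using that by (intro causal) (simp add: cyl_def)
    then show "flip \<phi> x \<in> cyl (flips \<phi> s)" using \<open>x \<in> cyl s\<close> by (simp add: cyl_def flips_def flip_def)
  next
    assume *: "flip \<phi> x \<in> cyl (flips \<phi> s)"
    have "i < length s \<longrightarrow> x i = s ! i" for i
    proof (induction i rule: less_induct)
      case (less i)
      have "\<phi> x i = \<phi> ((!) s) i" if "i < length s" using that less by (intro causal) simp
      then show ?case using * by (auto simp: cyl_def flips_def flip_def)
    qed
    then show "x \<in> cyl s" by (simp add: cyl_def)
  qed
qed

text \<open>Cantor space is divided into sites of five coordinates: a marker, a letter of two bits, the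
  coordinate flipped by the involutions \<open>swap c\<close>, and the coordinate flipped by \<open>toggle n\<close>. The
  involution \<open>swap c\<close> acts at an unmarked site with letter \<open>c\<close> if the preceding site is excited
  and is not itself such a site.\<close>

definition marked :: "(nat \<Rightarrow> bool) \<Rightarrow> nat \<Rightarrow> bool" where
  "marked x n \<longleftrightarrow> x (5 * n)"

definition letter :: "(nat \<Rightarrow> bool) \<Rightarrow> nat \<Rightarrow> bool \<times> bool" where
  "letter x n = (x (5 * n + 1), x (5 * n + 2))"

definition excited :: "(nat \<Rightarrow> bool) \<Rightarrow> nat \<Rightarrow> bool" where
  "excited x n \<longleftrightarrow> x (5 * n + 3)"

text \<open>By the last conjunct \<open>swap c\<close> never alters the excitation that it consults,
  which makes it an involution. A marked site counts as carrying no letter, so it passes excitation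
  on for every \<open>c\<close>.\<close>

definition swaps_at :: "bool \<times> bool \<Rightarrow> (nat \<Rightarrow> bool) \<Rightarrow> nat \<Rightarrow> bool" where
  "swaps_at c x n \<longleftrightarrow> \<not> marked x (Suc n) \<and> letter x (Suc n) = c \<and> excited x n \<and> (marked x n \<or> letter x n \<noteq> c)"

text \<open>Coordinate \<open>5 * n + 8\<close> is the excitation of site \<open>Suc n\<close>; that
  of site 0 is never changed.\<close>

definition swap_pos :: "bool \<times> bool \<Rightarrow> (nat \<Rightarrow> bool) \<Rightarrow> nat \<Rightarrow> bool" where
  "swap_pos c x i \<longleftrightarrow> (\<exists>n. i = 5 * n + 8 \<and> swaps_at c x n)"

abbreviation swap :: "bool \<times> bool \<Rightarrow> (nat \<Rightarrow> bool) \<Rightarrow> nat \<Rightarrow> bool" where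
  "swap c \<equiv> flip (swap_pos c)"

text \<open>The fifth coordinate of a site is not consulted by any \<open>swap c\<close>, whence the
  two kinds of maps commute.\<close>

definition toggle_pos :: "nat \<Rightarrow> (nat \<Rightarrow> bool) \<Rightarrow> nat \<Rightarrow> bool" where
  "toggle_pos n x i \<longleftrightarrow> i = 5 * n + 4"

abbreviation toggle :: "nat \<Rightarrow> (nat \<Rightarrow> bool) \<Rightarrow> nat \<Rightarrow> bool" where
  "toggle n \<equiv> flip (toggle_pos n)"

lemma swap_pos_simps [simp]:
  "swap_pos c x (5 * n) = False" "swap_pos c x (Suc (5 * n)) = False" "swap_pos c x (Suc (Suc (5 * n))) = False"
  "swap_pos c x (5 * n + 4) = False" "swap_pos c x 3 = False"
  "swap_pos c x (5 * n + 8) = swaps_at c x n"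
  unfolding swap_pos_def by (auto, presburger+)

lemma swap_marked [simp]: "marked (swap c x) n = marked x n"
  by (simp add: marked_def flip_def)

lemma swap_letter [simp]: "letter (swap c x) n = letter x n"
  by (simp add: letter_def flip_def)

lemma swap_excited_Suc: "excited (swap c x) (Suc n) \<longleftrightarrow> excited x (Suc n) \<noteq> swaps_at c x n"
proof -
  have "5 * Suc n + 3 = 5 * n + 8" by simp
  then show ?thesis unfolding excited_def flip_def by (simp only: swap_pos_simps)
qed

lemma swap_excited_0: "excited (swap c x) 0 \<longleftrightarrow> excited x 0"
  by (simp add: excited_def flip_def)

lemma swaps_at_swap [simp]: "swaps_at c (swap c x) n = swaps_at c x n"
proof (cases n)
  case 0
  then show ?thesis by (simp add: swaps_at_def swap_excited_0)
next
  case (Suc m)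
  then show ?thesis by (auto simp: swaps_at_def swap_excited_Suc)
qed

lemma tree_inv_swap: "tree_inv (swap c) (flips (swap_pos c))"
proof (rule tree_inv_flip)
  fix x y :: "nat \<Rightarrow> bool" and i assume eq: "\<And>j. j < i \<Longrightarrow> x j = y j"
  have "swaps_at c x n = swaps_at c y n" if "i = 5 * n + 8" for n
    using eq that by (simp add: swaps_at_def marked_def letter_def excited_def)
  then show "swap_pos c x i = swap_pos c y i" by (auto simp: swap_pos_def)
qed (simp add: swap_pos_def)

lemma tree_inv_toggle: "tree_inv (toggle n) (flips (toggle_pos n))"
  by (rule tree_inv_flip) (simp_all add: toggle_pos_def)

lemma toggle_pos_simps [simp]:
  "toggle_pos m x (5 * n) = False" "toggle_pos m x (Suc (5 * n)) = False"
  "toggle_pos m x (Suc (Suc (5 * n))) = False" "toggle_pos m x (5 * n + 3) = False"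
  unfolding toggle_pos_def by presburger+

lemma toggle_marked [simp]: "marked (toggle m x) n = marked x n"
  by (simp add: marked_def flip_def)

lemma toggle_letter [simp]: "letter (toggle m x) n = letter x n"
  by (simp add: letter_def flip_def)

lemma toggle_excited [simp]: "excited (toggle m x) n = excited x n"
  by (simp add: excited_def flip_def)

lemma swap_toggle: "toggle n (swap c x) = swap c (toggle n x)"
proof -
  have "swap_pos c (toggle n x) = swap_pos c x"
    by (simp add: fun_eq_iff swap_pos_def swaps_at_def)
  then show ?thesis by (auto simp: fun_eq_iff flip_def[of "swap_pos c"] flip_def[of "toggle_pos n"] toggle_pos_def)
qed

lemma toggle_inj: "inj (\<lambda>n. toggle n x)"
proof (rule injI)
  fix m n assume "toggle m x = toggle n x"
  then have "toggle m x (5 * m + 4) = toggle n x (5 * m + 4)" by simp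
  then show "m = n" by (auto simp: flip_def toggle_pos_def)
qed

text \<open>Each letter of a reduced word moves the last excited site of the window one step further.\<close>

lemma excited_fold_swap:
  assumes "excited x a" "w \<noteq> [] \<Longrightarrow> marked x a \<or> letter x a \<noteq> hd w" "distinct_adj w"
    and "\<And>i. i < length w \<Longrightarrow> \<not> marked x (Suc (a + i)) \<and> letter x (Suc (a + i)) = w ! i \<and> \<not> excited x (Suc (a + i))"
  shows "excited (fold swap w x) (a + length w)"
  using assms
proof (induction w arbitrary: x a)
  case (Cons c w)
  have s: "swaps_at c x a" using Cons.prems(1,2) Cons.prems(4)[of 0] by (simp add: swaps_at_def)
  have "excited (fold swap w (swap c x)) (Suc a + length w)"
  proof (rule Cons.IH)
    show "excited (swap c x) (Suc a)" using s Cons.prems(4)[of 0] by (simp add: swap_excited_Suc)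
    show "marked (swap c x) (Suc a) \<or> letter (swap c x) (Suc a) \<noteq> hd w" if "w \<noteq> []"
      using that Cons.prems(3) Cons.prems(4)[of 0] by (simp add: distinct_adj_Cons)
    show "distinct_adj w" using Cons.prems(3) by (rule distinct_adj_ConsD)
    fix i assume i: "i < length w"
    have "\<not> excited x (Suc (a + i))" using Cons.prems(4)[of i] i by simp
    then have "\<not> swaps_at c x (Suc (a + i))" using Cons.prems(4)[of i] i by (simp add: swaps_at_def)
    then show "\<not> marked (swap c x) (Suc (Suc a + i)) \<and> letter (swap c x) (Suc (Suc a + i)) = w ! i
        \<and> \<not> excited (swap c x) (Suc (Suc a + i))"
      using Cons.prems(4)[of "Suc i"] i by (simp add: swap_excited_Suc)
  qed
  then show ?case by simp
qed simp

text \<open>\<open>G K\<close> holds the strings made of \<open>K\<close> blocks different from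
  \<open>q\<close>. Missing \<open>q\<close> in \<open>K\<close> consecutive blocks has probability
  at most \<open>?r ^ K\<close>, which tends to 0.\<close>

lemma AE_block:
  assumes "q \<noteq> []"
  shows "AE x in coin. \<exists>j. map x [j * length q..<j * length q + length q] = q"
proof -
  let ?l = "length q"
  define G where "G = rec_nat {[]} (\<lambda>_ G. (\<lambda>(s, t). s @ t) ` (G \<times> {t. length t = ?l \<and> t \<noteq> q}))"
  have G: "G 0 = {[]}" "G (Suc K) = (\<lambda>(s, t). s @ t) ` (G K \<times> {t. length t = ?l \<and> t \<noteq> q})" for K
    by (simp_all add: G_def)
  have fin: "finite {t :: bool list. length t = n}" for n
    using finite_lists_length_eq[of "UNIV :: bool set" n] by simp
  have card: "card {t :: bool list. length t = ?l \<and> t \<noteq> q} = 2 ^ ?l - 1"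
  proof -
    have "card {t :: bool list. length t = ?l} = 2 ^ ?l"
      using card_lists_length_eq[of "UNIV :: bool set" ?l] by simp
    moreover have "{t. length t = ?l \<and> t \<noteq> q} = {t. length t = ?l} - {q}" by blast
    ultimately show ?thesis using fin[of ?l] by simp
  qed
  have len: "G K \<subseteq> {t. length t = K * ?l}" for K by (induction K) (auto simp: G)
  have card_G: "card (G K) \<le> (2 ^ ?l - 1) ^ K" for K
  proof (induction K)
    case (Suc K)
    have "card (G (Suc K)) \<le> card (G K \<times> {t. length t = ?l \<and> t \<noteq> q})"
      unfolding G(2) using finite_subset[OF len fin] finite_subset[OF _ fin[of ?l], of "{t. length t = ?l \<and> t \<noteq> q}"]
      by (intro card_image_le) auto
    also have "\<dots> \<le> (2 ^ ?l - 1) ^ Suc K" using Suc by (simp add: card_cartesian_product card)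
    finally show ?case .
  qed (simp add: G)
  let ?E = "\<lambda>K. {x. map x [0..<K * ?l] \<in> G K}"
  let ?r = "(2 ^ ?l - 1) * (1/2) ^ ?l :: real"
  have r: "0 \<le> ?r" "?r < 1" by (simp_all add: field_simps)
  have meas: "measure coin (?E K) \<le> ?r ^ K" for K
  proof -
    have "measure coin (?E K) = real (card (G K)) * (1/2) ^ (K * ?l)" by (rule measure_level(2)[OF len])
    also have "\<dots> \<le> real ((2 ^ ?l - 1) ^ K) * (1/2) ^ (K * ?l)"
      using card_G by (intro mult_right_mono) (simp_all only: of_nat_le_iff, simp)
    also have "\<dots> = ?r ^ K" by (simp add: of_nat_diff power_mult_distrib mult.commute[of K] power_mult)
    finally show ?thesis .
  qed
  define N where "N = (\<Inter>K. ?E K)"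
  have N: "N \<in> sets coin" unfolding N_def using measure_level(1)[OF len] by simp
  have "measure coin N \<le> ?r ^ K" for K
    using coin.finite_measure_mono[of N "?E K"] measure_level(1)[OF len, of K] meas[of K]
    by (force simp: N_def)
  then have "measure coin N \<le> 0"
    using LIMSEQ_power_zero[of ?r] r by (intro LIMSEQ_le_const) auto
  then have "N \<in> null_sets coin"
    using N by (simp add: coin.emeasure_eq_measure null_sets_def measure_le_0_iff)
  moreover have "x \<in> N" if no: "\<And>j. map x [j * ?l..<j * ?l + ?l] \<noteq> q" for x
  proof -
    have "map x [0..<K * ?l] \<in> G K" for K
    proof (induction K)
      case (Suc K)
      have "Suc K * ?l = K * ?l + ?l" by simp
      then have "map x [0..<Suc K * ?l] = map x [0..<K * ?l] @ map x [K * ?l..<K * ?l + ?l]"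
        by (simp only: upt_add_eq_append[OF le0] map_append)
      moreover have "map x [K * ?l..<K * ?l + ?l] \<in> {t. length t = ?l \<and> t \<noteq> q}" using no by simp
      ultimately show ?case unfolding G(2) using Suc by (metis (mono_tags, lifting) SigmaI case_prod_conv image_eqI)
    qed (simp add: G)
    then show ?thesis by (simp add: N_def)
  qed
  ultimately show ?thesis by (intro AE_I'[of N]) auto
qed

text \<open>Almost every \<open>x\<close> contains a marked excited site followed by unmarked sites
  at rest that spell \<open>w\<close>. There the word carries the excitation to the last of these
  sites, so it moves \<open>x\<close>.\<close>

lemma AE_free_word:
  assumes w: "w \<noteq> []" "distinct_adj w"
  shows "AE x in coin. fold swap w x \<noteq> x"
proof -
  let ?k = "Suc (length w)"
  \<comment> \<open>The pattern by positions: site 0 has marker and excitation set, site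
    \<open>i > 0\<close> carries the letter \<open>w ! (i - 1)\<close>, and all else is
    \<open>False\<close>.\<close>
  define Q where "Q p = (let i = p div 5; r = p mod 5 in
    if i = 0 then r = 0 \<or> r = 3 else (r = 1 \<and> fst (w ! (i - 1))) \<or> (r = 2 \<and> snd (w ! (i - 1))))" for p
  have Q0: "Q 0" "Q 3" by (simp_all add: Q_def)
  have QS: "Q (5 * Suc i) = False" "Q (5 * Suc i + 1) = fst (w ! i)" "Q (5 * Suc i + 2) = snd (w ! i)"
    "Q (5 * Suc i + 3) = False" for i
    unfolding Q_def Let_def by simp_all
  define q where "q = map Q [0..<5 * ?k]"
  have q: "length q = 5 * ?k" "q \<noteq> []" by (auto simp: q_def)
  have "fold swap w x \<noteq> x" if j: "map x [j * length q..<j * length q + length q] = q" for x j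
  proof -
    \<comment> \<open>The length of the pattern is a multiple of five, so every block begins at a
      site, here number \<open>?a\<close>.\<close>
    let ?a = "j * ?k"
    have xQ: "x (5 * ?a + p) = Q p" if "p < 5 * ?k" for p
    proof -
      have "map x [j * length q..<j * length q + length q] ! p = q ! p" by (simp only: j)
      moreover have "j * length q + p = 5 * ?a + p" by (simp add: q(1) algebra_simps)
      ultimately show ?thesis using that by (simp add: q_def)
    qed
    have a: "excited x ?a" "marked x ?a" using xQ[of 0] xQ[of 3] Q0 by (simp_all add: excited_def marked_def)
    have b: "\<not> marked x (Suc (?a + i)) \<and> letter x (Suc (?a + i)) = w ! i \<and> \<not> excited x (Suc (?a + i))"
      if "i < length w" for i
    proof -
      have e: "5 * Suc (?a + i) + r = 5 * ?a + (5 * Suc i + r)" for r by simp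
      have "x (5 * Suc (?a + i) + r) = Q (5 * Suc i + r)" if "r < 5" for r
        unfolding e using that \<open>i < length w\<close> by (intro xQ) simp
      from this[of 0] this[of 1] this[of 2] this[of 3] show ?thesis
        unfolding marked_def letter_def excited_def using QS[of i] by simp
    qed
    have "excited (fold swap w x) (?a + length w)"
      using a b w(2) by (intro excited_fold_swap) auto
    moreover have "\<not> excited x (?a + length w)" using b[of "length w - 1"] w(1) by (cases w) auto
    ultimately show ?thesis by metis
  qed
  then show ?thesis using AE_block[OF q(2)] by (rule_tac AE_mp[OF AE_block[OF q(2)]]) auto
qed

section \<open>Membership of the flips in the model\<close>

context ctm
begin

lemma app_hstring [simp]: "i < length s \<Longrightarrow> app (hstring s) (ord_nat i) = hbit (s ! i)"
  by (rule app_eq) auto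

lemma flips_M:
  assumes P: "dfn (\<lambda>e. P (e 0) (e (Suc 0)))"
    and P_iff: "\<And>i s. i < length s \<Longrightarrow> P (ord_nat i) (hstring s) \<longleftrightarrow> \<phi> ((!) s) i"
  shows "hset (range (\<lambda>s. opair (hstring s) (hstring (flips \<phi> s)))) \<in> M"
proof -
  define F where "F x = hset ((\<lambda>k. opair k (if P k x then if app x k = ord_nat 0 then ord_nat 1 else ord_nat 0
    else app x k)) ` elts (hdom x))" for x
  have "dtm (\<lambda>e. F (e 0))" unfolding F_def by (intro dfn_intro P)
  then have "gr F Str \<in> M" by (rule gr_M) simp
  moreover have "F (hstring s) = hstring (flips \<phi> s)" for s
  proof (rule hc_ext)
    have "elts (F (hstring s)) = (\<lambda>i. opair (ord_nat i) (hbit (flip \<phi> ((!) s) i))) ` {..<length s}"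
      unfolding F_def hdom_hstring
      by (simp add: elts_ord_nat image_image) (rule image_cong, simp_all add: P_iff flip_def hbit_def)
    also have "\<dots> = elts (hstring (flips \<phi> s))" by (simp add: flips_def)
    finally show "elts (F (hstring s)) = elts (hstring (flips \<phi> s))" .
  qed
  then have "gr F Str = hset (range (\<lambda>s. opair (hstring s) (hstring (flips \<phi> s))))"
    by (intro hc_ext) (simp add: image_image del: elts_opair)
  ultimately show ?thesis by simp
qed

text \<open>\<open>hUnion\<close> is the predecessor on numbers, so this reads the bit
  \<open>j\<close> places before \<open>k\<close>, stopping at 0.\<close>

definition back_bit :: "nat \<Rightarrow> hc \<Rightarrow> hc \<Rightarrow> bool" where
  "back_bit j k s \<longleftrightarrow> app s ((hUnion ^^ j) k) = ord_nat 1"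

lemma hUnion_funpow: "(hUnion ^^ j) (ord_nat i) = ord_nat (i - j)"
proof (induction j)
  case (Suc j)
  have "hUnion (ord_nat m) = ord_nat (m - 1)" for m
    by (cases m) (simp_all only: hUnion_ord_nat diff_Suc_1, auto intro: hc_ext simp: elts_ord_nat)
  then show ?case using Suc by simp
qed simp

lemma back_bit: "i < length s \<Longrightarrow> back_bit j (ord_nat i) (hstring s) \<longleftrightarrow> s ! (i - j)"
  by (simp add: back_bit_def hUnion_funpow hbit_def)

lemma dfn_back_bit [dfn_intro]: "dtm t \<Longrightarrow> dtm s \<Longrightarrow> dfn (\<lambda>e. back_bit j (t e) (s e))"
proof -
  assume "dtm t" "dtm s"
  then have "dtm (\<lambda>e. (hUnion ^^ j) (t e))" by (induction j) (auto intro: dtm_Union)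
  then show ?thesis unfolding back_bit_def using \<open>dtm s\<close> by (intro dfn_intro)
qed

text \<open>Residues come from iterating a cyclic successor, so no arithmetic has to be formalized
  in \<open>M\<close>.\<close>

lemma mod5_M: "hseq (\<lambda>n. ord_nat (n mod 5)) \<in> M"
proof -
  let ?h = "\<lambda>x. if x = ord_nat 4 then ord_nat 0 else hins x x"
  have "(?h ^^ n) (ord_nat 0) = ord_nat (n mod 5)" for n
    by (induction n) (auto simp: mod_Suc ord_nat_Suc simp del: ord_nat.simps)
  moreover have "hseq (\<lambda>n. (?h ^^ n) (ord_nat 0)) \<in> M"
    by (rule funpow_seq_M) (intro dfn_intro, simp)
  ultimately show ?thesis by simp
qed

lemma swap_aut: "ctm_aut M (swap c) (flips (swap_pos c))"
proof -
  \<comment> \<open>Seen from coordinate \<open>5 * n + 8\<close>, the marker and letter of its own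
    site lie 3, 2 and 1 places back, the excitation of the preceding site 5, and the marker and
    letter of that site 8, 7 and 6. Excluding \<open>ord_nat 3\<close> leaves out site 0 and keeps
    all these places nonnegative.\<close>
  let ?P = "\<lambda>k s. app (hseq (\<lambda>n. ord_nat (n mod 5))) k = ord_nat 3 \<and> k \<noteq> ord_nat 3
    \<and> \<not> back_bit 3 k s \<and> (back_bit 2 k s \<longleftrightarrow> fst c) \<and> (back_bit 1 k s \<longleftrightarrow> snd c) \<and> back_bit 5 k s
    \<and> (back_bit 8 k s \<or> \<not> ((back_bit 7 k s \<longleftrightarrow> fst c) \<and> (back_bit 6 k s \<longleftrightarrow> snd c)))"
  have "hset (range (\<lambda>s. opair (hstring s) (hstring (flips (swap_pos c) s)))) \<in> M"
  proof (rule flips_M)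
    show "dfn (\<lambda>e. ?P (e 0) (e (Suc 0)))" by (intro dfn_intro mod5_M)
    fix i and s :: "bool list" assume i: "i < length s"
    have "i mod 5 = 3 \<and> i \<noteq> 3 \<longleftrightarrow> (\<exists>n. i = 5 * n + 8)" by presburger
    moreover have "\<not> s ! (i - 3) \<and> (s ! (i - 2) \<longleftrightarrow> fst c) \<and> (s ! (i - 1) \<longleftrightarrow> snd c) \<and> s ! (i - 5)
        \<and> (s ! (i - 8) \<or> \<not> ((s ! (i - 7) \<longleftrightarrow> fst c) \<and> (s ! (i - 6) \<longleftrightarrow> snd c))) \<longleftrightarrow> swaps_at c ((!) s) n"
      if "i = 5 * n + 8" for n
    proof -
      have "i - 3 = 5 * Suc n" "i - 2 = 5 * Suc n + 1" "i - 1 = 5 * Suc n + 2" "i - 5 = 5 * n + 3"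
        "i - 8 = 5 * n" "i - 7 = 5 * n + 1" "i - 6 = 5 * n + 2" using that by simp_all
      then show ?thesis
        unfolding swaps_at_def marked_def letter_def excited_def by (cases c) auto
    qed
    ultimately show "?P (ord_nat i) (hstring s) \<longleftrightarrow> swap_pos c ((!) s) i"
      unfolding app_hseq ord_nat_inj back_bit[OF i] swap_pos_def by blast
  qed
  then show ?thesis
    using ctm_axioms tree_inv_swap by (simp add: ctm_aut_def ctm_aut_axioms_def)
qed

lemma toggle_aut: "ctm_aut M (toggle n) (flips (toggle_pos n))"
proof -
  have "hset (range (\<lambda>s. opair (hstring s) (hstring (flips (toggle_pos n) s)))) \<in> M"
  proof (rule flips_M)
    show "dfn (\<lambda>e. e 0 = ord_nat (5 * n + 4))" by (intro dfn_intro)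
  qed (simp add: toggle_pos_def)
  then show ?thesis
    using ctm_axioms tree_inv_toggle by (simp add: ctm_aut_def ctm_aut_axioms_def)
qed

end

theorem theorem4p7:
  fixes M :: "hc set"
  assumes "ctm_ZFC M"
  shows "\<not> treeable (random_reals M) (random_equiv M)"
proof
  interpret ctm M by standard (rule assms)
  let ?R = "random_reals M"
  assume "treeable ?R (random_equiv M)"
  then obtain T where T: "T \<subseteq> ?R \<times> ?R" "T \<in> sets (restrict_space borel (?R \<times> ?R))" "sym T" "irrefl T" "acyclic_graph T"
    and E: "\<And>x y. x \<in> ?R \<Longrightarrow> y \<in> ?R \<Longrightarrow> (x, y) \<in> random_equiv M \<longleftrightarrow> (x, y) \<in> T\<^sup>*"
    unfolding treeable_def by blast
  obtain B where B: "B \<in> sets borel" "T = ?R \<times> ?R \<inter> B" using T(2) unfolding sets_restrict_space by blast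
  \<comment> \<open>All elements of \<open>M\<close> are evaluated as if they were names of reals;
    the default keeps this total, and each class is enumerated.\<close>
  define h where "h n = real_of_name (from_nat_into M n)" for n
  have h [measurable]: "h n \<in> borel_measurable borel" for n
    unfolding h_def by (rule real_of_name_measurable)
  have R: "(x, y) \<in> T\<^sup>* \<Longrightarrow> x \<in> ?R \<Longrightarrow> y \<in> ?R" for x y
    by (induction rule: rtrancl_induct) (use T(1) in auto)
  have conn: "(x, y) \<in> random_equiv M \<Longrightarrow> x \<in> ?R \<and> (x, y) \<in> T\<^sup>*" for x y
    using E by (auto simp: random_equiv_def)
  interpret free_forest_action coin ?R T h swap toggle
  proof
    show "sets coin = sets borel" by simp
    show "{x. f x = g x} \<in> sets borel"
      if [measurable]: "f \<in> borel_measurable borel" "g \<in> borel_measurable borel" for f g :: "(nat \<Rightarrow> bool) \<Rightarrow> nat \<Rightarrow> bool"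
    proof -
      have "{x. f x = g x} = (\<Inter>n. (f -` {y. y n = True} \<inter> g -` {y. y n = True})
          \<union> (f -` {y. y n = False} \<inter> g -` {y. y n = False}))" (is "_ = (\<Inter>n. ?S n)") by (auto simp: fun_eq_iff)
      moreover have "?S n \<in> sets borel" for n
        by (intro sets.Un sets.Int measurable_sets_borel[OF that(1) coord_sets] measurable_sets_borel[OF that(2) coord_sets])
      ultimately show ?thesis by (simp only:) (rule sets.countable_INT''[OF _ countableI_type], simp, assumption)
    qed
    show "{x. (h i x, h j x) \<in> T} \<in> sets borel" for i j
    proof -
      have "{x. (h i x, h j x) \<in> T} = h i -` ?R \<inter> h j -` ?R \<inter> (\<lambda>x. (h i x, h j x)) -` B"
        by (auto simp: B(2))
      moreover have "(\<lambda>x. (h i x, h j x)) \<in> borel_measurable borel" by measurable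
      ultimately show ?thesis
        by (simp only:) (intro sets.Int measurable_sets_borel[OF h random_reals_sets] measurable_sets_borel[OF _ B(1)])
    qed
    show "\<exists>n. h n x = y" if "x \<in> ?R" "(x, y) \<in> T\<^sup>*" for x y
    proof -
      have "(x, y) \<in> random_equiv M" using E R that by blast
      then obtain t where "t \<in> M" "real_of_name t x = y" using random_equiv_name by blast
      moreover from this(1) obtain n where "from_nat_into M n = t"
        using from_nat_into_surj[OF M_countable] by blast
      ultimately show ?thesis unfolding h_def by blast
    qed
    show "AE x in coin. x \<in> ?R \<and> (\<forall>c. (x, swap c x) \<in> T\<^sup>*) \<and> (\<forall>n. (x, toggle n x) \<in> T\<^sup>*)"
    proof -
      have "AE x in coin. \<forall>c. (x, swap c x) \<in> random_equiv M" "AE x in coin. \<forall>n. (x, toggle n x) \<in> random_equiv M"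
        unfolding AE_all_countable using ctm_aut.AE_random_equiv swap_aut toggle_aut by blast+
      then show ?thesis by eventually_elim (use conn in blast)
    qed
    show "AE x in coin. \<forall>w. w \<noteq> [] \<longrightarrow> distinct_adj w \<longrightarrow> fold swap w x \<noteq> x"
      unfolding AE_all_countable using AE_free_word by (auto simp del: AE_conj_iff)
    show "3 \<le> CARD(bool \<times> bool)" by simp
  qed (use T h in \<open>simp_all add: swap_toggle toggle_inj
      tree_inv.g_measurable[OF tree_inv_swap] tree_inv.g_measurable[OF tree_inv_toggle]
      tree_inv.distr_g[OF tree_inv_swap] tree_inv.distr_g[OF tree_inv_toggle] tree_inv.invol[OF tree_inv_swap]\<close>)
  show False by (rule inconsistent)
qed

end
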